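(* There is an absolute constant $K>0$ such that for every integer $N\ge 1$, every $N$-lacunary set $\Omega$ of directions (unit vectors) in the plane $\mathbb{R}^2$, and every $f\in L^2(\mathbb{R}^2)$, $$\|M_\Omega f\|_{L^2(\mathbb{R}^2)}\le K\,N\,\|f\|_{L^2(\mathbb{R}^2)}.$$
   Context: A direction is a unit vector in $\mathbb{R}^2$. For a set $\Omega$ of directions, $\mathcal{R}_\Omega$ denotes the set of all rectangles in $\mathbb{R}^2$ (of arbitrary side lengths) which have a side parallel to some direction from $\Omega$, and the associated maximal operator is $$M_\Omega f(x)=\sup_{x\in R\in\mathcal{R}_\Omega}\frac{1}{|R|}\int_R|f(y)|\,dy,\qquad x\in\mathbb{R}^2,$$ where $|R|$ is the area of $R$. Neighboring points: two distinct points of a set $\Omega$ of directions are neighboring (in $\Omega$) if they are the endpoints of an arc of the unit circle whose interior contains no point of $\Omega$; a point lies between these two neighbors if it lies in the interior of that arc. $N$-lacunary sets are defined by induction on $N$. (1) A set of directions $\Omega=\{v_k\}$ (a sequence $v_1,v_2,\dots$, finite or infinite, of distinct directions) is $1$-lacunary iff for each $k$ (for which $v_k$ and $v_{k+1}$ are both defined) $v_k$ and $v_{k+1}$ are neighboring points of $\Omega$, and there is a direction $v_\infty$ so that for all such $k$ $$\tfrac12|v_k-v_{k+1}|<|v_{k+1}-v_\infty|<|v_k-v_{k+1}|.$$ (2) A set is $(N+1)$-lacunary if it can be obtained from some $N$-lacunary set $\Omega_N$ by adding points to $\Omega_N$ as follows: between each two neighboring points $a,b\in\Omega_N$ one may add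 a $1$-lacunary sequence (finite or infinite; possibly no points are added). *)

theory Defs
  imports "HOL-Analysis.Analysis" "HOL-Library.Extended_Nat"
begin

subsection \<open>The directional maximal operator\<close>

text \<open>The closed rectangles of positive side lengths \<open>a\<close>, \<open>b\<close> with sides along the orthonormal
  pair \<open>u\<close>, \<open>w\<close>, where \<open>u \<in> \<Omega>\<close>. The vertex \<open>p\<close> is arbitrary, so it is no restriction that
  the sides leave \<open>p\<close> in the positive directions \<open>u\<close>, \<open>w\<close>.\<close>

definition rectangles_along :: "(real^2) set \<Rightarrow> (real^2) set set" where
  "rectangles_along \<Omega> =
     {{p + s *\<^sub>R u + t *\<^sub>R w | s t. 0 \<le> s \<and> s \<le> a \<and> 0 \<le> t \<and> t \<le> b} | p u w a b.
        u \<in> \<Omega> \<and> norm u = 1 \<and> norm w = 1 \<and> orthogonal u w \<and> 0 < a \<and> 0 < b}"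

definition maximal_op :: "(real^2) set \<Rightarrow> (real^2 \<Rightarrow> complex) \<Rightarrow> real^2 \<Rightarrow> ennreal" where
  "maximal_op \<Omega> f x =
     (SUP R \<in> {R \<in> rectangles_along \<Omega>. x \<in> R}.
        (\<integral>\<^sup>+ y \<in> R. ennreal (norm (f y)) \<partial>lebesgue) / emeasure lebesgue R)"

text \<open>The norm is defined for functions with values in \<open>[0,\<infinity>]\<close>, since \<open>maximal_op\<close> may be
  infinite at some points; for complex \<open>f\<close> it is applied to \<open>|f|\<close>.\<close>

definition L2_norm :: "(real^2 \<Rightarrow> ennreal) \<Rightarrow> ennreal" where
  "L2_norm g =
     (let I = (\<integral>\<^sup>+ x. (g x)\<^sup>2 \<partial>lebesgue)
      in if I = \<infinity> then \<infinity> else ennreal (sqrt (enn2real I)))"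

definition in_L2 :: "(real^2 \<Rightarrow> complex) \<Rightarrow> bool" where
  "in_L2 f \<longleftrightarrow> f \<in> borel_measurable lebesgue \<and> L2_norm (\<lambda>x. ennreal (norm (f x))) < \<infinity>"

subsection \<open>Lacunary sets of directions\<close>

definition direction :: "real \<Rightarrow> real^2" where
  "direction \<theta> = vector [cos \<theta>, sin \<theta>]"

text \<open>\<open>A\<close> is the interior of an arc of the unit circle with the two distinct endpoints \<open>a\<close>, \<open>b\<close>.
  Both of the complementary arcs determined by \<open>a\<close> and \<open>b\<close> qualify.\<close>

definition arc_interior :: "(real^2) set \<Rightarrow> real^2 \<Rightarrow> real^2 \<Rightarrow> bool" where
  "arc_interior A a b \<longleftrightarrow>
     (\<exists>\<alpha> \<beta>. \<alpha> < \<beta> \<and> \<beta> < \<alpha> + 2 * pi \<and> {a, b} = {direction \<alpha>, direction \<beta>} \<and>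
            A = direction ` {\<alpha><..<\<beta>})"

definition neighboring :: "(real^2) set \<Rightarrow> real^2 \<Rightarrow> real^2 \<Rightarrow> bool" where
  "neighboring \<Omega> a b \<longleftrightarrow>
     a \<in> \<Omega> \<and> b \<in> \<Omega> \<and> a \<noteq> b \<and> (\<exists>A. arc_interior A a b \<and> A \<inter> \<Omega> = {})"

text \<open>The arcs witnessing that two points of \<open>\<Omega>\<close> are neighboring. Each such arc belongs to a
  unique pair of neighbors, and each pair of neighbors to a unique arc, unless \<open>\<Omega>\<close> has exactly
  two points, when both complementary arcs are gaps.\<close>

definition gaps :: "(real^2) set \<Rightarrow> (real^2) set set" where
  "gaps \<Omega> = {A. \<exists>a\<in>\<Omega>. \<exists>b\<in>\<Omega>. a \<noteq> b \<and> arc_interior A a b \<and> A \<inter> \<Omega> = {}}"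

text \<open>The sequence is \<open>v 0, v 1, \<dots>\<close>, of length \<open>L\<close>, where \<open>L = \<infinity>\<close> is an infinite sequence.
  The empty sequence is allowed.\<close>

definition one_lacunary :: "(real^2) set \<Rightarrow> bool" where
  "one_lacunary \<Omega> \<longleftrightarrow> \<Omega> \<subseteq> sphere 0 1 \<and>
     (\<exists>(v :: nat \<Rightarrow> real^2) (L :: enat).
        inj_on v {k. enat k < L} \<and> \<Omega> = v ` {k. enat k < L} \<and>
        (\<forall>k. enat (Suc k) < L \<longrightarrow> neighboring \<Omega> (v k) (v (Suc k))) \<and>
        (\<exists>w \<in> sphere 0 1. \<forall>k. enat (Suc k) < L \<longrightarrow>
            1/2 * norm (v k - v (Suc k)) < norm (v (Suc k) - w) \<and>
            norm (v (Suc k) - w) < norm (v k - v (Suc k))))"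

text \<open>In the step, \<open>S A\<close> is the (possibly empty) 1-lacunary set of points added in the gap \<open>A\<close>.\<close>

inductive lacunary :: "nat \<Rightarrow> (real^2) set \<Rightarrow> bool" where
  one: "one_lacunary \<Omega> \<Longrightarrow> lacunary 1 \<Omega>"
| step: "lacunary N \<Omega> \<Longrightarrow> (\<And>A. A \<in> gaps \<Omega> \<Longrightarrow> S A \<subseteq> A \<and> one_lacunary (S A)) \<Longrightarrow>
     lacunary (Suc N) (\<Omega> \<union> (\<Union>A \<in> gaps \<Omega>. S A))"

end

theory Submission
  imports Defs
begin

text \<open>The proof is a \<open>TT\<^sup>*\<close> argument. An \<open>L\<^sup>2\<close> bound \<open>A\<close> for the maximal operator of a class of sets is
  dual to the inequality
  \<open>\<Sum>\<^sub>i\<^sub>j c\<^sub>i c\<^sub>j |P\<^sub>i \<inter> P\<^sub>j| / (|P\<^sub>i| |P\<^sub>j|) \<le> A\<^sup>2 \<Sum>\<^sub>i c\<^sub>i\<^sup>2 / |E\<^sub>i|\<close>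
  for finite families of sets \<open>P\<^sub>i\<close> of the class, disjoint \<open>E\<^sub>i \<subseteq> P\<^sub>i\<close> and \<open>c\<^sub>i \<ge> 0\<close>. Suppose that two
  rectangles have directions \<open>u \<noteq> v\<close>, and that \<open>e\<close> is a direction with \<open>|u - e| \<le> C |u - v|\<close>. If the
  rectangle along \<open>u\<close> is the shorter one, replacing it by a suitable rectangle along \<open>e\<close> that contains it
  decreases the normalized overlap at most by a constant factor. Hence, if a set of directions is split
  into pieces such that every direction has boundedly many such points \<open>e\<close> in a fixed set \<open>\<Sigma>\<close>, which serve
  for all directions of the other pieces, then the off-diagonal part of the double sum is controlled by
  the Cauchy-Schwarz inequality, and the bound of the whole set is at most the supremum of the bounds of
  the pieces plus a constant times the bound of \<open>\<Sigma>\<close>. With single directions as pieces and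
  \<open>\<Sigma> = {v\<^sub>\<infinity>}\<close> this bounds 1-lacunary sets, starting from the strong maximal operator; with the gaps
  of a 1-lacunary set as pieces, every level of lacunarity adds one constant.\<close>

subsection \<open>Testing against weighted families of sets\<close>

text \<open>The linear growth in \<open>N\<close> comes from the form of the off-diagonal estimate.
  Let \<open>Q\<close> be the double sum, \<open>G\<close> the sum on the right and \<open>S\<close>
  the bound of the pieces. Cauchy-Schwarz leaves the unknown \<open>Q\<close> under a root,
  \<open>Q \<le> S\<^sup>2 G + 4 k sqrt (Q G)\<close> with \<open>k\<close> proportional to the
  bound of \<Sigma>, and this forces \<open>sqrt Q \<le> (S + 4 k) sqrt G\<close>: the new bound is
  additive in \<open>S\<close>. Finite families make \<open>Q\<close> a real number that may be
  absorbed. The same device, with the unknown constant on both sides, gives the one- and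
  two-dimensional starting bounds without a covering lemma or interpolation.

  The shorter rectangle has to be replaced because the longer one then runs through the enlarged set
  far enough to compensate for its greater area.

  Directions are turned into slopes of parallelograms with vertical sides, as shears preserve area
  and make the bound the same for all slopes. This works only near a horizontal direction, while the
  end points of a gap may lie anywhere on the circle; hence the charts on a quarter circle with
  exceptional values elsewhere.\<close>

lemma indicator_sums_integral:
  fixes x :: "'i \<Rightarrow> real" and y :: "'j \<Rightarrow> real"
  assumes "finite I" "finite J" "\<And>i. i \<in> I \<Longrightarrow> A i \<in> fmeasurable M" "\<And>j. j \<in> J \<Longrightarrow> B j \<in> fmeasurable M"
  defines "h \<equiv> (\<lambda>z. (\<Sum>i\<in>I. x i * indicat_real (A i) z) * (\<Sum>j\<in>J. y j * indicat_real (B j) z))"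
  shows "integrable M h"
    and "integral\<^sup>L M h = (\<Sum>i\<in>I. \<Sum>j\<in>J. x i * y j * measure M (A i \<inter> B j))"
proof -
  have eq: "h = (\<lambda>z. \<Sum>i\<in>I. \<Sum>j\<in>J. x i * y j * indicat_real (A i \<inter> B j) z)"
    unfolding h_def by (auto simp: sum_product indicator_inter_arith mult_ac)
  have fm: "A i \<inter> B j \<in> fmeasurable M" if "i \<in> I" "j \<in> J" for i j
    using assms that by (simp add: fmeasurable.Int)
  have int: "integrable M (\<lambda>z. x i * y j * indicat_real (A i \<inter> B j) z)" if "i \<in> I" "j \<in> J" for i j
    using fm[OF that] by (intro integrable_mult_right integrable_real_indicator) (auto simp: fmeasurable_def)
  show "integrable M h"
    unfolding eq by (intro Bochner_Integration.integrable_sum int)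
  show "integral\<^sup>L M h = (\<Sum>i\<in>I. \<Sum>j\<in>J. x i * y j * measure M (A i \<inter> B j))"
    unfolding eq using int fm
    by (simp add: Bochner_Integration.integral_sum Bochner_Integration.integrable_sum fmeasurableD
        flip: fmeasurableD)
qed

text \<open>The three double sums are the integrals of \<open>F G\<close>, \<open>F\<^sup>2\<close>
  and \<open>G\<^sup>2\<close>, and \<open>2 F G \<le> s F\<^sup>2 + G\<^sup>2 / s\<close> holds
  pointwise. A free weight \<open>s\<close> replaces the product of square roots, so that terms
  containing an unknown can later be absorbed linearly.\<close>

lemma gram_Cauchy_Schwarz:
  fixes x :: "'i \<Rightarrow> real" and y :: "'j \<Rightarrow> real"
  assumes fin: "finite I" "finite J" and A: "\<And>i. i \<in> I \<Longrightarrow> A i \<in> fmeasurable M"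
    and B: "\<And>j. j \<in> J \<Longrightarrow> B j \<in> fmeasurable M" and s: "s > 0"
  shows "2 * (\<Sum>i\<in>I. \<Sum>j\<in>J. x i * y j * measure M (A i \<inter> B j))
    \<le> s * (\<Sum>i\<in>I. \<Sum>j\<in>I. x i * x j * measure M (A i \<inter> A j))
      + (\<Sum>i\<in>J. \<Sum>j\<in>J. y i * y j * measure M (B i \<inter> B j)) / s"
proof -
  define F where "F z = (\<Sum>i\<in>I. x i * indicat_real (A i) z)" for z
  define G where "G z = (\<Sum>j\<in>J. y j * indicat_real (B j) z)" for z
  note FG = indicator_sums_integral[where A=A and B=B and x=x and y=y, OF fin A B, folded F_def G_def]
  note FF = indicator_sums_integral[where A=A and B=A and x=x and y=x, OF fin(1) fin(1) A A, folded F_def]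
  note GG = indicator_sums_integral[where A=B and B=B and x=y and y=y, OF fin(2) fin(2) B B, folded G_def]
  have pw: "2 * (F z * G z) \<le> s * (F z * F z) + (G z * G z) / s" for z
  proof -
    have "0 \<le> (s * F z - G z)\<^sup>2 / s" using s by simp
    also have "\<dots> = s * (F z * F z) + (G z * G z) / s - 2 * (F z * G z)"
      using s by (simp add: power2_eq_square field_simps)
    finally show ?thesis by simp
  qed
  have "(\<integral>z. 2 * (F z * G z) \<partial>M) \<le> (\<integral>z. s * (F z * F z) + (G z * G z) / s \<partial>M)"
    by (rule integral_mono) (use FG(1) FF(1) GG(1) pw in auto)
  then show ?thesis using FG FF GG by simp
qed

text \<open>The inner product in \<open>L\<^sup>2\<close> of the indicators of \<open>P\<close> and
  \<open>R\<close>, each divided by the measure of its set. Thus \<open>overlap_form\<close> below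
  is the squared norm of the sum of the normalized indicators of the \<open>P i\<close> with
  coefficients \<open>c i\<close>.\<close>

definition overlap :: "'a measure \<Rightarrow> 'a set \<Rightarrow> 'a set \<Rightarrow> real" where
  "overlap M P R = measure M (P \<inter> R) / (measure M P * measure M R)"

definition overlap_form :: "'a measure \<Rightarrow> nat set \<Rightarrow> (nat \<Rightarrow> 'a set) \<Rightarrow> (nat \<Rightarrow> real) \<Rightarrow> real" where
  "overlap_form M J P c = (\<Sum>i\<in>J. \<Sum>j\<in>J. c i * c j * overlap M (P i) (P j))"

text \<open>The coefficients \<open>c\<^sub>i\<close> are written as \<open>a\<^sub>i |E\<^sub>i|\<close>, so that null sets \<open>E\<^sub>i\<close> need no exception.\<close>
definition admissible :: "'a measure \<Rightarrow> 'a set set \<Rightarrow> nat set \<Rightarrow> (nat \<Rightarrow> 'a set) \<Rightarrow> (nat \<Rightarrow> 'a set) \<Rightarrow> (nat \<Rightarrow> real) \<Rightarrow> bool" where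
  "admissible M \<C> J P E a \<longleftrightarrow> finite J \<and> disjoint_family_on E J \<and>
     (\<forall>i\<in>J. P i \<in> \<C> \<and> E i \<in> sets M \<and> E i \<subseteq> P i \<and> 0 \<le> a i)"

text \<open>Let an averaging operator send \<open>f\<close> to its mean over \<open>P i\<close> at
  all points of \<open>E i\<close>. Its adjoint, applied to the step function with value
  \<open>a i\<close> on \<open>E i\<close>, has squared norm \<open>overlap_form\<close>, and the
  sum on the right is the squared norm of the step function. So \<open>A\<close> bounds these
  adjoints uniformly in the family.\<close>

definition dual_bounded :: "'a measure \<Rightarrow> 'a set set \<Rightarrow> real \<Rightarrow> bool" where
  "dual_bounded M \<C> A \<longleftrightarrow> 0 \<le> A \<and> (\<forall>J P E a. admissible M \<C> J P E a \<longrightarrow>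
     overlap_form M J P (\<lambda>i. a i * measure M (E i)) \<le> A\<^sup>2 * (\<Sum>i\<in>J. (a i)\<^sup>2 * measure M (E i)))"

lemma dual_boundedD:
  "dual_bounded M \<C> A \<Longrightarrow> admissible M \<C> J P E a \<Longrightarrow>
     overlap_form M J P (\<lambda>i. a i * measure M (E i)) \<le> A\<^sup>2 * (\<Sum>i\<in>J. (a i)\<^sup>2 * measure M (E i))"
  unfolding dual_bounded_def by blast

lemma overlap_nonneg [simp]: "0 \<le> overlap M P R"
  by (simp add: overlap_def)

lemma overlap_sym: "overlap M P R = overlap M R P"
  by (simp add: overlap_def Int_commute mult.commute)

lemma overlap_Cauchy_Schwarz:
  assumes fin: "finite J" and P: "\<And>i. i \<in> J \<Longrightarrow> P i \<in> fmeasurable M"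
    and R: "\<And>i. i \<in> J \<Longrightarrow> R i \<in> fmeasurable M" and s: "s > 0"
  shows "2 * (\<Sum>i\<in>J. \<Sum>j\<in>J. c i * c j * overlap M (P i) (R j))
    \<le> s * overlap_form M J P c + overlap_form M J R c / s"
  using gram_Cauchy_Schwarz[where A=P and B=R and x="\<lambda>i. c i / measure M (P i)" and y="\<lambda>i. c i / measure M (R i)", OF fin fin P R s]
  by (simp add: overlap_form_def overlap_def)

lemma dual_bounded_mono:
  assumes "dual_bounded M \<C> A" "\<D> \<subseteq> \<C>" "A \<le> B"
  shows "dual_bounded M \<D> B"
  unfolding dual_bounded_def
proof (intro conjI allI impI)
  show "0 \<le> B" using assms by (auto simp: dual_bounded_def)
  fix J P E a assume "admissible M \<D> J P E a"
  then have ad: "admissible M \<C> J P E a" using assms(2) by (auto simp: admissible_def)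
  have "A\<^sup>2 * (\<Sum>i\<in>J. (a i)\<^sup>2 * measure M (E i)) \<le> B\<^sup>2 * (\<Sum>i\<in>J. (a i)\<^sup>2 * measure M (E i))"
    using assms by (intro mult_right_mono power_mono sum_nonneg) (auto simp: dual_bounded_def)
  with dual_boundedD[OF assms(1) ad]
  show "overlap_form M J P (\<lambda>i. a i * measure M (E i)) \<le> B\<^sup>2 * (\<Sum>i\<in>J. (a i)\<^sup>2 * measure M (E i))"
    by linarith
qed

lemma overlap_le_dominated:
  assumes "P \<subseteq> P'" "R \<subseteq> R'" "P' \<in> fmeasurable M" "R' \<in> fmeasurable M" "P \<in> sets M" "R \<in> sets M"
    "measure M P' \<le> C * measure M P" "measure M R' \<le> D * measure M R" "0 \<le> C" "0 \<le> D"
  shows "overlap M P R \<le> C * D * overlap M P' R'"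
proof (cases "measure M P = 0 \<or> measure M R = 0")
  case True
  then show ?thesis using assms by (auto simp: overlap_def)
next
  case False
  have fm: "P' \<inter> R' \<in> fmeasurable M" using assms by (simp add: fmeasurable.Int)
  have le: "measure M (P \<inter> R) \<le> measure M (P' \<inter> R')"
    using assms fm by (intro measure_mono_fmeasurable) auto
  have "measure M P \<le> measure M P'" "measure M R \<le> measure M R'"
    using assms by (auto intro!: measure_mono_fmeasurable)
  with False have pos: "0 < measure M P" "0 < measure M P'" "0 < measure M R" "0 < measure M R'"
    using measure_nonneg[of M P] measure_nonneg[of M R] by linarith+
  have "measure M P' * measure M R' \<le> (C * measure M P) * (D * measure M R)"
    using assms pos by (intro mult_mono) auto
  then have "measure M (P \<inter> R) * (measure M P' * measure M R')
      \<le> measure M (P' \<inter> R') * ((C * measure M P) * (D * measure M R))"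
    using le pos assms by (intro mult_mono) auto
  then show ?thesis using pos by (simp add: overlap_def field_simps)
qed

text \<open>A set \<open>E i\<close> contained in \<open>R i\<close> also lies in the larger
  \<open>d (R i)\<close>, so the family of larger sets is admissible with the same data. Each
  overlap loses at most \<open>C\<^sup>2\<close>, which is a factor \<open>C\<close> for the bound
  itself.\<close>

lemma dual_bounded_dominated:
  assumes bd: "dual_bounded M \<D> A" and C: "0 \<le> C" and sub: "\<D> \<subseteq> fmeasurable M" "\<C> \<subseteq> sets M"
    and dom: "\<And>R. R \<in> \<C> \<Longrightarrow> \<exists>P\<in>\<D>. R \<subseteq> P \<and> measure M P \<le> C * measure M R"
  shows "dual_bounded M \<C> (C * A)"
  unfolding dual_bounded_def
proof (intro conjI allI impI)
  show "0 \<le> C * A" using assms by (auto simp: dual_bounded_def)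
  fix J R E a assume ad: "admissible M \<C> J R E a"
  have "\<forall>R\<in>\<C>. \<exists>P. P \<in> \<D> \<and> R \<subseteq> P \<and> measure M P \<le> C * measure M R" using dom by blast
  then obtain d where d: "\<And>R. R \<in> \<C> \<Longrightarrow> d R \<in> \<D> \<and> R \<subseteq> d R \<and> measure M (d R) \<le> C * measure M R"
    by metis
  have ad': "admissible M \<D> J (\<lambda>i. d (R i)) E a" using ad d by (fastforce simp: admissible_def)
  let ?c = "\<lambda>i. a i * measure M (E i)"
  have c: "0 \<le> ?c i" if "i \<in> J" for i using ad that by (auto simp: admissible_def)
  have "overlap_form M J R ?c \<le> (\<Sum>i\<in>J. \<Sum>j\<in>J. ?c i * ?c j * (C * C * overlap M (d (R i)) (d (R j))))"
    unfolding overlap_form_def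
  proof (intro sum_mono mult_left_mono overlap_le_dominated)
    fix i j assume "i \<in> J" "j \<in> J"
    then have "R i \<in> \<C>" "R j \<in> \<C>" using ad by (auto simp: admissible_def)
    then show "R i \<subseteq> d (R i)" "R j \<subseteq> d (R j)" "d (R i) \<in> fmeasurable M" "d (R j) \<in> fmeasurable M"
      "R i \<in> sets M" "R j \<in> sets M" "measure M (d (R i)) \<le> C * measure M (R i)"
      "measure M (d (R j)) \<le> C * measure M (R j)" using d sub by auto
    show "0 \<le> ?c i * ?c j" using c \<open>i \<in> J\<close> \<open>j \<in> J\<close> by (simp add: mult_nonneg_nonneg)
  qed (use C in auto)
  also have "\<dots> = C\<^sup>2 * overlap_form M J (\<lambda>i. d (R i)) ?c"
    unfolding overlap_form_def sum_distrib_left by (intro sum.cong refl) (simp add: power2_eq_square)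
  also have "\<dots> \<le> C\<^sup>2 * (A\<^sup>2 * (\<Sum>i\<in>J. (a i)\<^sup>2 * measure M (E i)))"
    using dual_boundedD[OF bd ad'] by (intro mult_left_mono) auto
  finally show "overlap_form M J R ?c \<le> (C * A)\<^sup>2 * (\<Sum>i\<in>J. (a i)\<^sup>2 * measure M (E i))"
    by (simp add: power_mult_distrib)
qed

lemma admissible_subset: "admissible M \<C> J P E a \<Longrightarrow> I \<subseteq> J \<Longrightarrow> (\<And>i. i \<in> I \<Longrightarrow> P i \<in> \<D>) \<Longrightarrow> admissible M \<D> I P E a"
  by (auto simp: admissible_def finite_subset dest: disjoint_family_on_mono)

text \<open>Cauchy-Schwarz absorbs the mixed terms into twice the two pure ones, and the right-hand
  sums add up because each index is assigned to only one of the two classes.\<close>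

lemma dual_bounded_Un:
  assumes bd: "dual_bounded M \<C> A" "dual_bounded M \<D> A" and sub: "\<C> \<union> \<D> \<subseteq> fmeasurable M"
  shows "dual_bounded M (\<C> \<union> \<D>) (2 * A)"
  unfolding dual_bounded_def
proof (intro conjI allI impI)
  show A: "0 \<le> 2 * A" using bd by (auto simp: dual_bounded_def)
  fix J P E a assume ad: "admissible M (\<C> \<union> \<D>) J P E a"
  define J1 where "J1 = {i\<in>J. P i \<in> \<C>}"
  define J2 where "J2 = J - J1"
  have fin: "finite J" "finite J1" "finite J2" using ad by (auto simp: admissible_def J1_def J2_def)
  have J: "J = J1 \<union> J2" "J1 \<inter> J2 = {}" by (auto simp: J1_def J2_def)
  let ?c = "\<lambda>i. a i * measure M (E i)"
  let ?g = "\<lambda>I. \<Sum>i\<in>I. (a i)\<^sup>2 * measure M (E i)"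
  have ad1: "admissible M \<C> J1 P E a" using ad by (rule admissible_subset) (auto simp: J1_def)
  have ad2: "admissible M \<D> J2 P E a"
    using ad by (rule admissible_subset) (use ad in \<open>auto simp: J1_def J2_def admissible_def\<close>)
  have fm: "P i \<in> fmeasurable M" if "i \<in> J" for i using ad that sub by (auto simp: admissible_def)
  define x where "x i = ?c i / measure M (P i)" for i
  have qf: "overlap_form M I P ?c = (\<Sum>i\<in>I. \<Sum>j\<in>I. x i * x j * measure M (P i \<inter> P j))" for I
    unfolding overlap_form_def overlap_def x_def by (intro sum.cong refl) simp
  have cs: "2 * (\<Sum>i\<in>J1. \<Sum>j\<in>J2. x i * x j * measure M (P i \<inter> P j)) \<le> 1 * overlap_form M J1 P ?c + overlap_form M J2 P ?c / 1"
    unfolding qf by (intro gram_Cauchy_Schwarz fin fm) (auto simp: J1_def J2_def)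
  have sym: "(\<Sum>i\<in>J2. \<Sum>j\<in>J1. x i * x j * measure M (P i \<inter> P j)) = (\<Sum>i\<in>J1. \<Sum>j\<in>J2. x i * x j * measure M (P i \<inter> P j))"
    by (subst sum.swap) (simp add: Int_commute mult.commute)
  have "overlap_form M J P ?c = overlap_form M J1 P ?c + overlap_form M J2 P ?c + 2 * (\<Sum>i\<in>J1. \<Sum>j\<in>J2. x i * x j * measure M (P i \<inter> P j))"
    unfolding qf J(1) using fin J(2) sym by (simp add: sum.union_disjoint sum.distrib algebra_simps)
  also have "\<dots> \<le> 2 * overlap_form M J1 P ?c + 2 * overlap_form M J2 P ?c" using cs by simp
  also have "\<dots> \<le> 2 * (A\<^sup>2 * ?g J1) + 2 * (A\<^sup>2 * ?g J2)"
    using dual_boundedD[OF bd(1) ad1] dual_boundedD[OF bd(2) ad2] by simp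
  also have "\<dots> = 2 * A\<^sup>2 * ?g J"
    unfolding J(1) using fin J(2) by (simp add: sum.union_disjoint algebra_simps)
  also have "\<dots> \<le> (2 * A)\<^sup>2 * ?g J"
    using A by (intro mult_right_mono sum_nonneg) (auto simp: power2_eq_square)
  finally show "overlap_form M J P ?c \<le> (2 * A)\<^sup>2 * ?g J" .
qed

lemma overlap_le_inverse_max:
  assumes "P \<in> fmeasurable M" "R \<in> fmeasurable M" "0 < measure M P" "0 < measure M R"
  shows "overlap M P R \<le> 1 / measure M P" "overlap M P R \<le> 1 / measure M R"
proof -
  have "measure M (P \<inter> R) \<le> measure M P" "measure M (P \<inter> R) \<le> measure M R"
    using assms by (auto intro!: measure_mono_fmeasurable)
  then show "overlap M P R \<le> 1 / measure M P" "overlap M P R \<le> 1 / measure M R"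
    using assms by (auto simp: overlap_def field_simps)
qed

text \<open>\<open>a i * a j\<close> is split into halves of the two squares; in each half the mass
  of the other set, \<open>E j\<close> or \<open>E i\<close>, cancels the normalization of the
  overlap.\<close>

lemma overlap_form_le_card:
  assumes ad: "admissible M \<C> J P E a" and fm: "\<C> \<subseteq> fmeasurable M"
    and pos: "\<And>P. P \<in> \<C> \<Longrightarrow> 0 < measure M P"
  shows "overlap_form M J P (\<lambda>i. a i * measure M (E i)) \<le> real (card J) * (\<Sum>i\<in>J. (a i)\<^sup>2 * measure M (E i))"
proof -
  let ?e = "\<lambda>i. measure M (E i)"
  have trm: "(a i * ?e i) * (a j * ?e j) * overlap M (P i) (P j)
      \<le> ((a i)\<^sup>2 * ?e i) / 2 + ((a j)\<^sup>2 * ?e j) / 2" if ij: "i \<in> J" "j \<in> J" for i j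
  proof -
    have P: "P i \<in> fmeasurable M" "P j \<in> fmeasurable M" "0 < measure M (P i)" "0 < measure M (P j)"
      using ad ij fm pos by (auto simp: admissible_def)
    have e: "?e i \<le> measure M (P i)" "?e j \<le> measure M (P j)"
      using ad ij P by (auto simp: admissible_def intro!: measure_mono_fmeasurable)
    have a: "0 \<le> a i" "0 \<le> a j" using ad ij by (auto simp: admissible_def)
    have k1: "?e i * overlap M (P i) (P j) \<le> 1"
    proof -
      have "?e i * overlap M (P i) (P j) \<le> measure M (P i) * (1 / measure M (P i))"
        using overlap_le_inverse_max[OF P] e by (intro mult_mono) auto
      then show ?thesis using P by simp
    qed
    have k2: "?e j * overlap M (P i) (P j) \<le> 1"
    proof -
      have "?e j * overlap M (P i) (P j) \<le> measure M (P j) * (1 / measure M (P j))"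
        using overlap_le_inverse_max[OF P] e by (intro mult_mono) auto
      then show ?thesis using P by simp
    qed
    have "(a i * ?e i) * (a j * ?e j) * overlap M (P i) (P j) = (a i * a j) * (?e i * ?e j * overlap M (P i) (P j))"
      by simp
    also have "\<dots> \<le> ((a i)\<^sup>2 / 2 + (a j)\<^sup>2 / 2) * (?e i * ?e j * overlap M (P i) (P j))"
      using sum_squares_bound[of "a i" "a j"] by (intro mult_right_mono) (auto simp: power2_eq_square)
    also have "\<dots> = ((a i)\<^sup>2 / 2 * ?e i) * (?e j * overlap M (P i) (P j)) + ((a j)\<^sup>2 / 2 * ?e j) * (?e i * overlap M (P i) (P j))"
      by (simp add: algebra_simps)
    also have "\<dots> \<le> ((a i)\<^sup>2 / 2 * ?e i) * 1 + ((a j)\<^sup>2 / 2 * ?e j) * 1"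
      using k1 k2 by (intro add_mono mult_left_mono) auto
    finally show ?thesis by simp
  qed
  have "overlap_form M J P (\<lambda>i. a i * ?e i) \<le> (\<Sum>i\<in>J. \<Sum>j\<in>J. ((a i)\<^sup>2 * ?e i) / 2 + ((a j)\<^sup>2 * ?e j) / 2)"
    unfolding overlap_form_def by (intro sum_mono trm)
  also have "\<dots> = real (card J) * (\<Sum>i\<in>J. (a i)\<^sup>2 * ?e i)"
    by (simp add: sum.distrib sum_distrib_left flip: sum_divide_distrib)
  finally show ?thesis .
qed

lemma sum_indicator_disjoint:
  assumes "admissible M \<C> J P E a"
  shows "(\<Sum>i\<in>J. \<Sum>j\<in>J. a i * a j * measure M (E i \<inter> E j)) = (\<Sum>i\<in>J. (a i)\<^sup>2 * measure M (E i))"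
proof (rule sum.cong[OF refl])
  fix i assume i: "i \<in> J"
  have "(\<Sum>j\<in>J. a i * a j * measure M (E i \<inter> E j)) = (\<Sum>j\<in>J. if i = j then (a i)\<^sup>2 * measure M (E i) else 0)"
    using assms i by (intro sum.cong) (auto simp: admissible_def disjoint_family_on_def power2_eq_square)
  then show "(\<Sum>j\<in>J. a i * a j * measure M (E i \<inter> E j)) = (a i)\<^sup>2 * measure M (E i)"
    using assms i by (simp add: admissible_def)
qed

text \<open>Families of \<open>n\<close> sets have some finite bound, by \<open>overlap_form_le_card\<close>. The hypotheses bound the
  optimal one by a multiple of its square root, independently of \<open>n\<close>.\<close>
lemma dual_bounded_self_improve:
  assumes fm: "\<C> \<subseteq> fmeasurable M" and pos: "\<And>P. P \<in> \<C> \<Longrightarrow> 0 < measure M P"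
    and q: "0 \<le> q" and x0: "0 \<le> x0"
    and dil: "\<And>P. P \<in> \<C> \<Longrightarrow> \<exists>D\<in>\<C>. P \<subseteq> D \<and> measure M D \<le> q * measure M P \<and> (\<forall>R\<in>\<C>. sm P R \<longrightarrow> R \<subseteq> D)"
    and overlap: "\<And>P R. P \<in> \<C> \<Longrightarrow> R \<in> \<C> \<Longrightarrow> overlap M P R \<le>
      (if sm P R then 1 / measure M P else 0) + (if sm R P then 1 / measure M R else 0) + X P R"
    and X: "\<And>J P E a. admissible M \<C> J P E a \<Longrightarrow>
      (\<Sum>i\<in>J. \<Sum>j\<in>J. (a i * measure M (E i)) * (a j * measure M (E j)) * X (P i) (P j))
        \<le> x0 * (\<Sum>i\<in>J. (a i)\<^sup>2 * measure M (E i))"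
  shows "dual_bounded M \<C> (2 * q + x0 + 1)"
  unfolding dual_bounded_def
proof (intro conjI allI impI)
  show "0 \<le> 2 * q + x0 + 1" using q x0 by simp
  fix J0 P0 E0 a0 assume ad0: "admissible M \<C> J0 P0 E0 a0"
  define n where "n = card J0"
  define d where "d P = (SOME D. D \<in> \<C> \<and> P \<subseteq> D \<and> measure M D \<le> q * measure M P \<and> (\<forall>R\<in>\<C>. sm P R \<longrightarrow> R \<subseteq> D))" for P
  have d': "d P \<in> \<C> \<and> P \<subseteq> d P \<and> measure M (d P) \<le> q * measure M P \<and> (\<forall>R\<in>\<C>. sm P R \<longrightarrow> R \<subseteq> d P)"
    if "P \<in> \<C>" for P
    using someI_ex[OF dil[OF that, unfolded Bex_def], folded d_def] .
  have d: "P \<in> \<C> \<Longrightarrow> d P \<in> \<C>" "P \<in> \<C> \<Longrightarrow> P \<subseteq> d P" "P \<in> \<C> \<Longrightarrow> measure M (d P) \<le> q * measure M P"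
      "P \<in> \<C> \<Longrightarrow> R \<in> \<C> \<Longrightarrow> sm P R \<Longrightarrow> R \<subseteq> d P" for P R
    using d' by blast+
  let ?G = "\<lambda>J E a. \<Sum>i\<in>J. (a i)\<^sup>2 * measure M (E i)"
  \<comment> \<open>The constants valid for all families of exactly \<open>n\<close> sets. Fixing
    \<open>n\<close> makes this set nonempty, and replacing every set by its dilate does not change
    \<open>n\<close>.\<close>
  define V where "V = {D::real. 0 \<le> D \<and> (\<forall>J P E a. admissible M \<C> J P E a \<and> card J = n \<longrightarrow>
     overlap_form M J P (\<lambda>i. a i * measure M (E i)) \<le> D * ?G J E a)}"
  have Gnn: "0 \<le> ?G J E a" for J E a by (intro sum_nonneg) auto
  have "real n \<in> V" unfolding V_def using overlap_form_le_card[OF _ fm pos] by auto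
  define I where "I = Inf V"
  have bdd: "bdd_below V" by (rule bdd_belowI[of _ 0]) (auto simp: V_def)
  have I0: "0 \<le> I" unfolding I_def by (rule cInf_greatest) (use \<open>real n \<in> V\<close> in blast, simp add: V_def)
  \<comment> \<open>The infimum is itself a valid constant. Division by the right-hand sum is
    impossible when it vanishes, and there the constant \<open>n\<close> already forces the
    claim.\<close>
  have IV: "overlap_form M J P (\<lambda>i. a i * measure M (E i)) \<le> I * ?G J E a"
    if ad: "admissible M \<C> J P E a" "card J = n" for J P E a
  proof (cases "?G J E a = 0")
    case True
    have "overlap_form M J P (\<lambda>i. a i * measure M (E i)) \<le> real n * ?G J E a"
      using \<open>real n \<in> V\<close> ad by (auto simp: V_def)
    then show ?thesis using True by simp
  next
    case False
    then have gp: "0 < ?G J E a" using Gnn by (simp add: order_less_le)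
    have "overlap_form M J P (\<lambda>i. a i * measure M (E i)) / ?G J E a \<le> I"
      unfolding I_def using \<open>real n \<in> V\<close>
    proof (intro cInf_greatest)
      fix D assume "D \<in> V"
      then show "overlap_form M J P (\<lambda>i. a i * measure M (E i)) / ?G J E a \<le> D"
        using ad gp by (auto simp: V_def divide_le_eq)
    qed auto
    then show ?thesis using gp by (simp add: divide_le_eq)
  qed
  \<comment> \<open>With \<open>I = s\<^sup>2\<close> the hypotheses make
    \<open>2 * q * s + x0\<close> a valid constant as well. It is linear in \<open>s\<close>, so for
    large \<open>s\<close> it would lie below the infimum.\<close>
  have "sqrt I \<le> 2 * q + x0 + 1"
  proof (rule ccontr)
    assume neg: "\<not> ?thesis"
    define s where "s = sqrt I"
    have s: "0 < s" "2 * q + x0 + 1 < s" "I = s\<^sup>2" using neg q x0 I0 unfolding s_def by (linarith, linarith, simp)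
    have "2 * q * s + x0 \<in> V"
      unfolding V_def
    proof (intro CollectI conjI allI impI)
      show "0 \<le> 2 * q * s + x0" using q x0 s by simp
      fix J P E a assume "admissible M \<C> J P E a \<and> card J = n"
      then have ad: "admissible M \<C> J P E a" and card: "card J = n" by auto
      have fin: "finite J" using ad by (simp add: admissible_def)
      have PC: "P i \<in> \<C>" if "i \<in> J" for i using ad that by (auto simp: admissible_def)
      let ?c = "\<lambda>i. a i * measure M (E i)"
      let ?D = "\<lambda>i j. if sm (P i) (P j) then 1 / measure M (P i) else 0"
      define Q where "Q i = d (P i)" for i
      have c: "0 \<le> ?c i" if "i \<in> J" for i using ad that by (auto simp: admissible_def)
      have Efm: "E i \<in> fmeasurable M" if "i \<in> J" for i
      proof (rule fmeasurableI2)
        show "P i \<in> fmeasurable M" using PC[OF that] fm by auto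
      qed (use ad that in \<open>auto simp: admissible_def\<close>)
      have Qfm: "Q i \<in> fmeasurable M" if "i \<in> J" for i
        using d(1) PC[OF that] fm by (auto simp: Q_def)
      have adQ: "admissible M \<C> J Q E a"
        using ad d(1,2) by (fastforce simp: admissible_def Q_def)
      have sw: "(\<Sum>i\<in>J. \<Sum>j\<in>J. ?c i * ?c j * ?D j i) = (\<Sum>i\<in>J. \<Sum>j\<in>J. ?c i * ?c j * ?D i j)"
        by (subst sum.swap) (simp add: mult.commute)
      have "overlap_form M J P ?c \<le> (\<Sum>i\<in>J. \<Sum>j\<in>J. ?c i * ?c j * (?D i j + ?D j i + X (P i) (P j)))"
        unfolding overlap_form_def using c PC by (intro sum_mono mult_left_mono overlap) auto
      also have "\<dots> = (\<Sum>i\<in>J. \<Sum>j\<in>J. ?c i * ?c j * ?D i j) + (\<Sum>i\<in>J. \<Sum>j\<in>J. ?c i * ?c j * ?D j i)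
          + (\<Sum>i\<in>J. \<Sum>j\<in>J. ?c i * ?c j * X (P i) (P j))"
        unfolding sum.distrib[symmetric] by (intro sum.cong refl) (simp add: algebra_simps)
      also have "\<dots> \<le> 2 * (\<Sum>i\<in>J. \<Sum>j\<in>J. ?c i * ?c j * ?D i j) + x0 * ?G J E a"
        using X[OF ad] sw by linarith
      finally have s1: "overlap_form M J P ?c \<le> 2 * (\<Sum>i\<in>J. \<Sum>j\<in>J. ?c i * ?c j * ?D i j) + x0 * ?G J E a" .
      \<comment> \<open>The inner product of the normalized sum over the dilates \<open>Q i\<close>
        with the step function of the sets \<open>E j\<close>. If \<open>sm (P i) (P j)\<close>,
        then \<open>E j\<close> lies in \<open>Q i\<close> and its full mass is recovered.\<close>
      define Y where "Y = (\<Sum>i\<in>J. \<Sum>j\<in>J. (?c i / measure M (Q i)) * a j * measure M (Q i \<inter> E j))"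
      have "(\<Sum>i\<in>J. \<Sum>j\<in>J. ?c i * ?c j * ?D i j)
          \<le> (\<Sum>i\<in>J. \<Sum>j\<in>J. q * ((?c i / measure M (Q i)) * a j * measure M (Q i \<inter> E j)))"
      proof (intro sum_mono)
        fix i j assume ij: "i \<in> J" "j \<in> J"
        have nn: "0 \<le> q * ((?c i / measure M (Q i)) * a j * measure M (Q i \<inter> E j))"
          using q ad ij by (auto simp: admissible_def)
        show "?c i * ?c j * ?D i j \<le> q * ((?c i / measure M (Q i)) * a j * measure M (Q i \<inter> E j))"
        proof (cases "sm (P i) (P j)")
          case True
          have "E j \<subseteq> Q i" using ad ij d(4)[OF PC[OF ij(1)] PC[OF ij(2)] True] by (auto simp: admissible_def Q_def)
          then have eq: "Q i \<inter> E j = E j" by auto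
          have "0 < measure M (P i)" "0 < measure M (Q i)" "measure M (Q i) \<le> q * measure M (P i)"
            using pos PC[OF ij(1)] d by (auto simp: Q_def)
          then have "1 / measure M (P i) \<le> q / measure M (Q i)" by (simp add: field_simps)
          then have "?c i * ?c j * (1 / measure M (P i)) \<le> ?c i * ?c j * (q / measure M (Q i))"
            using c ij by (intro mult_left_mono) auto
          then show ?thesis using True by (simp add: eq mult_ac)
        qed (use nn in simp)
      qed
      also have "\<dots> = q * Y" by (simp add: Y_def sum_distrib_left)
      finally have s2: "(\<Sum>i\<in>J. \<Sum>j\<in>J. ?c i * ?c j * ?D i j) \<le> q * Y" .
      \<comment> \<open>The weight \<open>1/s\<close> balances the two terms: the dilates contribute
        at most \<open>I / s = s\<close> times the right-hand sum, and the disjoint sets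
        \<open>E j\<close> exactly \<open>s\<close> times it.\<close>
      have "2 * Y \<le> (1/s) * (\<Sum>i\<in>J. \<Sum>j\<in>J. (?c i / measure M (Q i)) * (?c j / measure M (Q j)) * measure M (Q i \<inter> Q j))
             + (\<Sum>i\<in>J. \<Sum>j\<in>J. a i * a j * measure M (E i \<inter> E j)) / (1/s)"
        unfolding Y_def using s by (intro gram_Cauchy_Schwarz fin Qfm Efm) auto
      also have "(\<Sum>i\<in>J. \<Sum>j\<in>J. (?c i / measure M (Q i)) * (?c j / measure M (Q j)) * measure M (Q i \<inter> Q j)) = overlap_form M J Q ?c"
        by (simp add: overlap_form_def overlap_def)
      also have "(\<Sum>i\<in>J. \<Sum>j\<in>J. a i * a j * measure M (E i \<inter> E j)) = ?G J E a"
        by (rule sum_indicator_disjoint[OF ad])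
      finally have s3: "2 * Y \<le> (1/s) * overlap_form M J Q ?c + ?G J E a / (1/s)" .
      have "1/s * overlap_form M J Q ?c \<le> 1/s * (I * ?G J E a)"
        using IV[OF adQ card] s by (intro mult_left_mono) auto
      also have "\<dots> = s * ?G J E a" using s by (simp add: power2_eq_square)
      finally have "2 * Y \<le> 2 * s * ?G J E a" using s3 by (simp add: mult.commute[of s])
      then have "q * (2 * Y) \<le> q * (2 * s * ?G J E a)" using q by (rule mult_left_mono)
      with s1 s2 show "overlap_form M J P ?c \<le> (2 * q * s + x0) * ?G J E a"
        by (simp add: algebra_simps)
    qed
    then have "I \<le> 2 * q * s + x0" unfolding I_def by (rule cInf_lower[OF _ bdd])
    also have "\<dots> \<le> 2 * q * s + x0 * s" using x0 s q by (simp add: mult_le_cancel_left1)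
    also have "\<dots> < s * s" using s q mult_strict_right_mono[of "2 * q + x0" s s] by (simp add: distrib_right)
    finally show False using s by (simp add: power2_eq_square)
  qed
  then have "I \<le> (2 * q + x0 + 1)\<^sup>2" by (rule sqrt_le_D)
  then have "I * ?G J0 E0 a0 \<le> (2 * q + x0 + 1)\<^sup>2 * ?G J0 E0 a0" using Gnn by (intro mult_right_mono)
  then show "overlap_form M J0 P0 (\<lambda>i. a0 i * measure M (E0 i)) \<le> (2 * q + x0 + 1)\<^sup>2 * ?G J0 E0 a0"
    using IV[OF ad0] n_def by force
qed

section \<open>The one-dimensional Hardy-Littlewood bound\<close>

definition intervals :: "real set set" where "intervals = {{a..b} | a b. a < b}"

text \<open>Of two intervals that meet, the shorter lies in the threefold dilate of the longer. So
  \<open>q = 3\<close>, nothing remains for \<open>X\<close>, and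
  \<open>7 = 2 * 3 + 0 + 1\<close>.\<close>

lemma dual_bounded_intervals: "dual_bounded lborel intervals 7"
proof -
  have "dual_bounded lborel intervals (2 * 3 + 0 + 1)"
  proof (rule dual_bounded_self_improve[where X="\<lambda>_ _. 0" and
        sm="\<lambda>P R. P \<inter> R \<noteq> {} \<and> measure lborel R \<le> measure lborel P"])
    show "intervals \<subseteq> fmeasurable lborel" by (auto simp: intervals_def fmeasurable_def emeasure_lborel_Icc_eq)
    show "\<And>P. P \<in> intervals \<Longrightarrow> 0 < measure lborel P" by (auto simp: intervals_def)
    fix P assume "P \<in> intervals"
    then obtain a b where P: "P = {a..b}" "a < b" by (auto simp: intervals_def)
    have "{2*a-b..2*b-a} \<in> intervals" using P by (auto simp: intervals_def)
    moreover have "R \<subseteq> {2*a-b..2*b-a}" if "R \<in> intervals" "P \<inter> R \<noteq> {} \<and> measure lborel R \<le> measure lborel P" for R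
      using that P by (auto simp: intervals_def)
    ultimately show "\<exists>D\<in>intervals. P \<subseteq> D \<and> measure lborel D \<le> 3 * measure lborel P \<and>
       (\<forall>R\<in>intervals. P \<inter> R \<noteq> {} \<and> measure lborel R \<le> measure lborel P \<longrightarrow> R \<subseteq> D)"
      using P by (intro bexI[of _ "{2*a-b..2*b-a}"]) auto
  next
    fix P R assume PR: "P \<in> intervals" "R \<in> intervals"
    then have "P \<in> fmeasurable lborel" "R \<in> fmeasurable lborel" "0 < measure lborel P" "0 < measure lborel R"
      by (auto simp: intervals_def fmeasurable_def emeasure_lborel_Icc_eq)
    note k = overlap_le_inverse_max[OF this]
    show "overlap lborel P R \<le> (if P \<inter> R \<noteq> {} \<and> measure lborel R \<le> measure lborel P then 1 / measure lborel P else 0) +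
       (if R \<inter> P \<noteq> {} \<and> measure lborel P \<le> measure lborel R then 1 / measure lborel R else 0) + 0"
    proof (cases "P \<inter> R = {}")
      case True then show ?thesis by (simp add: overlap_def)
    next
      case False
      have "0 \<le> 1 / measure lborel P" "0 \<le> 1 / measure lborel R" by simp_all
      moreover have "measure lborel R \<le> measure lborel P \<or> measure lborel P \<le> measure lborel R" by linarith
      ultimately show ?thesis using k False unfolding Int_commute[of R P] by (smt (verit))
    qed
  qed auto
  then show ?thesis by simp
qed

subsection \<open>The strong maximal operator\<close>

definition rects :: "(real \<times> real) set set" where
  "rects = {{l..r} \<times> {b..t} | l r b t. l < r \<and> b < t}"

lemma rectsI: "l < r \<Longrightarrow> b < t \<Longrightarrow> {l..r} \<times> {b..t} \<in> rects"
  unfolding rects_def by blast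

lemma measure_lborel_rect:
  fixes l r b t :: real assumes "l \<le> r" "b \<le> t"
  shows "measure lborel ({l..r} \<times> {b..t}) = (r - l) * (t - b)"
    and "{l..r} \<times> {b..t} \<in> fmeasurable lborel"
proof -
  have *: "{l..r} \<times> {b..t} = cbox (l,b) (r,t)" by (simp add: cbox_Pair_eq)
  have "emeasure lborel ({l..r} \<times> {b..t}) = ennreal (r - l) * ennreal (t - b)"
    unfolding lborel_prod[symmetric] using assms by (subst lborel.emeasure_pair_measure_Times) auto
  then have **: "emeasure lborel ({l..r} \<times> {b..t}) = ennreal ((r - l) * (t - b))"
    using assms by (simp add: ennreal_mult)
  then show "measure lborel ({l..r} \<times> {b..t}) = (r - l) * (t - b)"
    using assms by (simp add: measure_def)
  show "{l..r} \<times> {b..t} \<in> fmeasurable lborel" unfolding * by simp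
qed

lemma measurable_slices:
  fixes E :: "(real \<times> real) set"
  assumes E: "E \<in> sets borel"
  shows "(\<lambda>x. (x, y)) -` E \<in> sets borel" "Pair x -` E \<in> sets borel"
proof -
  have "(\<lambda>x. (x, y)) \<in> borel_measurable borel" "Pair x \<in> borel_measurable borel"
    by (intro borel_measurable_continuous_onI continuous_intros)+
  from this[THEN measurable_sets, OF E] show "(\<lambda>x. (x, y)) -` E \<in> sets borel" "Pair x -` E \<in> sets borel"
    by auto
qed

lemma nn_integral_slices:
  fixes E :: "(real \<times> real) set"
  assumes E: "E \<in> sets borel" and sub: "E \<subseteq> {l..r} \<times> {b..t}"
  defines "u \<equiv> \<lambda>y. measure lborel ((\<lambda>x. (x, y)) -` E)" and "v \<equiv> \<lambda>x. measure lborel (Pair x -` E)"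
  shows "u \<in> borel_measurable borel" "v \<in> borel_measurable borel"
    "(\<integral>\<^sup>+y. ennreal (u y) \<partial>lborel) = ennreal (measure lborel E)"
    "(\<integral>\<^sup>+x. ennreal (v x) \<partial>lborel) = ennreal (measure lborel E)"
proof -
  have E': "E \<in> sets (lborel \<Otimes>\<^sub>M lborel)" proof -
    have "sets (lborel \<Otimes>\<^sub>M lborel) = sets (lborel :: (real \<times> real) measure)" by (simp only: lborel_prod)
    then show ?thesis using E by simp
  qed
  have fmE: "emeasure lborel E = ennreal (measure lborel E)"
  proof -
    have "bounded E" using sub by (rule bounded_subset[rotated]) (intro bounded_Times bounded_closed_interval)
    then have "emeasure lborel E < \<infinity>" by (rule emeasure_bounded_finite)
    then show ?thesis by (simp add: emeasure_eq_ennreal_measure)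
  qed
  have u: "ennreal (u y) = emeasure lborel ((\<lambda>x. (x, y)) -` E)" for y
  proof -
    have "bounded ((\<lambda>x. (x, y)) -` E)" using sub by (intro bounded_subset[OF bounded_closed_interval[of l r]]) auto
    then have "emeasure lborel ((\<lambda>x. (x, y)) -` E) < \<infinity>" by (rule emeasure_bounded_finite)
    then show ?thesis by (simp add: emeasure_eq_ennreal_measure u_def)
  qed
  have v: "ennreal (v x) = emeasure lborel (Pair x -` E)" for x
  proof -
    have "bounded (Pair x -` E)" using sub by (intro bounded_subset[OF bounded_closed_interval[of b t]]) auto
    then have "emeasure lborel (Pair x -` E) < \<infinity>" by (rule emeasure_bounded_finite)
    then show ?thesis by (simp add: emeasure_eq_ennreal_measure v_def)
  qed
  have "(\<lambda>y. emeasure lborel ((\<lambda>x. (x, y)) -` E)) \<in> borel_measurable lborel"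
    using lborel_pair.measurable_emeasure_Pair2[OF E'] by simp
  then have "(\<lambda>y. enn2real (ennreal (u y))) \<in> borel_measurable lborel" unfolding u by measurable
  then show "u \<in> borel_measurable borel" by (simp add: u_def)
  have "(\<lambda>x. emeasure lborel (Pair x -` E)) \<in> borel_measurable lborel"
    using lborel.measurable_emeasure_Pair[OF E'] by simp
  then have "(\<lambda>x. enn2real (ennreal (v x))) \<in> borel_measurable lborel" unfolding v by measurable
  then show "v \<in> borel_measurable borel" by (simp add: v_def)
  show "(\<integral>\<^sup>+y. ennreal (u y) \<partial>lborel) = ennreal (measure lborel E)"
    unfolding u fmE[symmetric] using lborel_pair.emeasure_pair_measure_alt2[OF E'] by (simp add: lborel_prod)
  show "(\<integral>\<^sup>+x. ennreal (v x) \<partial>lborel) = ennreal (measure lborel E)"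
    unfolding v fmE[symmetric] using lborel.emeasure_pair_measure_alt[OF E'] by (simp add: lborel_prod)
qed

text \<open>The tripled intervals with the sets \<open>S i\<close> form an admissible family. The
  constant is \<open>441 = 9 * 7\<^sup>2\<close>, where 9 comes from dividing by the original
  instead of the tripled lengths.\<close>

lemma dual_bounded_intervals_triple:
  fixes l r a :: "nat \<Rightarrow> real"
  assumes lr: "\<And>i. i \<in> J \<Longrightarrow> l i < r i" and fin: "finite J" and disj: "disjoint_family_on S J"
    and S: "\<And>i. i \<in> J \<Longrightarrow> S i \<in> sets borel \<and> S i \<subseteq> {l i..r i} \<and> 0 \<le> a i"
  shows "(\<integral>\<^sup>+x. ennreal ((\<Sum>i\<in>J. a i * measure lborel (S i) / (r i - l i) * indicat_real {2 * l i - r i..2 * r i - l i} x)\<^sup>2) \<partial>lborel)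
     \<le> ennreal (441 * (\<Sum>i\<in>J. (a i)\<^sup>2 * measure lborel (S i)))"
proof -
  define T where "T i = {2 * l i - r i..2 * r i - l i}" for i
  define c where "c i = a i * measure lborel (S i)" for i
  define z where "z i = c i / (r i - l i)" for i
  have T: "T i \<in> fmeasurable lborel" for i by (auto simp: T_def fmeasurable_def emeasure_lborel_Icc_eq)
  have mT: "measure lborel (T i) = 3 * (r i - l i)" if "i \<in> J" for i
    using lr[OF that] by (simp add: T_def)
  have ad: "admissible lborel intervals J T S a"
  proof -
    have "T i \<in> intervals" if "i \<in> J" for i using lr[OF that] by (auto simp: T_def intervals_def)
    moreover have "S i \<subseteq> T i" if "i \<in> J" for i using S[OF that] lr[OF that] by (auto simp: T_def)
    ultimately show ?thesis using fin disj S by (auto simp: admissible_def)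
  qed
  let ?h = "\<lambda>x. (\<Sum>i\<in>J. z i * indicat_real (T i) x) * (\<Sum>i\<in>J. z i * indicat_real (T i) x)"
  note I = indicator_sums_integral[where A=T and B=T and x=z and y=z and M=lborel, OF fin fin T T]
  have e1: "(\<integral>\<^sup>+x. ennreal (?h x) \<partial>lborel) = ennreal (\<integral>x. ?h x \<partial>lborel)"
    using I(1) by (intro nn_integral_eq_integral) auto
  have "(\<integral>x. ?h x \<partial>lborel) = 9 * overlap_form lborel J T c"
  proof -
    have "(\<integral>x. ?h x \<partial>lborel) = (\<Sum>i\<in>J. \<Sum>j\<in>J. z i * z j * measure lborel (T i \<inter> T j))" by (rule I(2))
    also have "\<dots> = (\<Sum>i\<in>J. \<Sum>j\<in>J. 9 * (c i * c j * overlap lborel (T i) (T j)))"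
    proof (intro sum.cong refl)
      fix i j assume "i \<in> J" "j \<in> J"
      then have "0 < r i - l i" "0 < r j - l j" "measure lborel (T i) = 3 * (r i - l i)" "measure lborel (T j) = 3 * (r j - l j)"
        using lr mT by auto
      then show "z i * z j * measure lborel (T i \<inter> T j) = 9 * (c i * c j * overlap lborel (T i) (T j))"
        by (simp only: z_def overlap_def) (simp add: divide_simps, simp add: algebra_simps)
    qed
    finally show ?thesis by (simp add: overlap_form_def sum_distrib_left)
  qed
  also have "\<dots> \<le> 9 * (7\<^sup>2 * (\<Sum>i\<in>J. (a i)\<^sup>2 * measure lborel (S i)))"
    using dual_boundedD[OF dual_bounded_intervals ad] by (simp add: c_def[abs_def])
  finally have "(\<integral>x. ?h x \<partial>lborel) \<le> 441 * (\<Sum>i\<in>J. (a i)\<^sup>2 * measure lborel (S i))" by simp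
  then have "(\<integral>\<^sup>+x. ennreal (?h x) \<partial>lborel) \<le> ennreal (441 * (\<Sum>i\<in>J. (a i)\<^sup>2 * measure lborel (S i)))"
    unfolding e1 by (rule ennreal_leI)
  then show ?thesis unfolding z_def c_def T_def power2_eq_square .
qed

text \<open>The \<open>i\<close>-th rectangle is wide and the \<open>j\<close>-th one is tall, so one can pass from \<open>E i\<close> to \<open>E j\<close> by a
  horizontal and a vertical move. This turns the sum into an inner product of two functions which are
  bounded by the one-dimensional result, one on horizontal and the other on vertical lines.\<close>
lemma crossing_bound:
  fixes l r b t a :: "nat \<Rightarrow> real"
  assumes fin: "finite J" and disj: "disjoint_family_on E J"
    and E: "\<And>i. i \<in> J \<Longrightarrow> l i < r i \<and> b i < t i \<and> E i \<in> sets borel \<and> E i \<subseteq> {l i..r i} \<times> {b i..t i} \<and> 0 \<le> a i"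
    and cr: "\<And>i j. i \<in> J \<Longrightarrow> j \<in> J \<Longrightarrow> cr i j \<Longrightarrow>
       {l j..r j} \<subseteq> {2 * l i - r i..2 * r i - l i} \<and> {b i..t i} \<subseteq> {2 * b j - t j..2 * t j - b j}"
  shows "(\<Sum>i\<in>J. \<Sum>j\<in>J. (a i * measure lborel (E i)) * (a j * measure lborel (E j)) *
            (if cr i j then 1 / ((r i - l i) * (t j - b j)) else 0))
         \<le> 441 * (\<Sum>i\<in>J. (a i)\<^sup>2 * measure lborel (E i))"
proof -
  define E' where "E' i = (if i \<in> J then E i else {})" for i
  have E'b: "E' i \<in> sets borel" "E' i \<subseteq> {l i..r i} \<times> {b i..t i}" for i
    using E by (auto simp: E'_def)
  define u where "u i y = measure lborel ((\<lambda>x. (x, y)) -` E' i)" for i y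
  define v where "v i x = measure lborel (Pair x -` E' i)" for i x
  define e where "e i = measure lborel (E' i)" for i
  note sl = nn_integral_slices[OF E'b, folded u_def v_def e_def]
  have [measurable]: "u i \<in> borel_measurable borel" "v i \<in> borel_measurable borel" for i
    using sl(1,2)[of i] by (simp_all add: u_def[abs_def] v_def[abs_def])
  have uv0: "0 \<le> u i y" "0 \<le> v i x" "0 \<le> e i" for i x y by (simp_all add: u_def v_def e_def)
  \<comment> \<open>For fixed \<open>y\<close> this is a function on the horizontal line at height
    \<open>y\<close>, built from the slices of the sets \<open>E' i\<close> there; \<open>G\<close>
    does the same on vertical lines.\<close>
  define F where "F x y = (\<Sum>i\<in>J. a i * u i y / (r i - l i) * indicat_real {2 * l i - r i..2 * r i - l i} x)" for x y
  define G where "G x y = (\<Sum>j\<in>J. a j * v j x / (t j - b j) * indicat_real {2 * b j - t j..2 * t j - b j} y)" for x y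
  define k where "k i j = (if cr i j then a i * a j / ((r i - l i) * (t j - b j)) else 0)" for i j
  have k0: "0 \<le> k i j" if "i \<in> J" "j \<in> J" for i j
    using E[OF that(1)] E[OF that(2)] by (simp add: k_def)
  let ?g = "\<Sum>i\<in>J. (a i)\<^sup>2 * e i"
  \<comment> \<open>A nonzero product forces \<open>y\<close> into the vertical side of the
    \<open>i\<close>-th rectangle and \<open>x\<close> into the horizontal side of the
    \<open>j\<close>-th one. By \<open>cr\<close> both indicators on the right then equal 1.\<close>
  have FGk: "(\<Sum>i\<in>J. \<Sum>j\<in>J. k i j * (u i y * v j x)) \<le> F x y * G x y" for x y
    unfolding F_def G_def sum_product
  proof (intro sum_mono)
    fix i j assume ij: "i \<in> J" "j \<in> J"
    have pos: "0 < r i - l i" "0 < t j - b j" "0 \<le> a i" "0 \<le> a j" using E ij by auto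
    show "k i j * (u i y * v j x) \<le> a i * u i y / (r i - l i) * indicat_real {2 * l i - r i..2 * r i - l i} x *
         (a j * v j x / (t j - b j) * indicat_real {2 * b j - t j..2 * t j - b j} y)" (is "_ \<le> ?R")
    proof (cases "cr i j \<and> u i y \<noteq> 0 \<and> v j x \<noteq> 0")
      case True
      have "(\<lambda>x. (x, y)) -` E' i \<noteq> {}" "Pair x -` E' j \<noteq> {}" using True by (auto simp: u_def v_def)
      then have "y \<in> {b i..t i}" "x \<in> {l j..r j}" using E'b[of i] E'b[of j] by auto
      then have "y \<in> {2 * b j - t j..2 * t j - b j}" "x \<in> {2 * l i - r i..2 * r i - l i}"
        using cr[OF ij] True by auto
      then show ?thesis using True by (simp add: k_def mult_ac)
    next
      case False
      have "0 \<le> ?R" using pos uv0 by (intro mult_nonneg_nonneg divide_nonneg_pos) auto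
      then show ?thesis using False by (auto simp: k_def)
    qed
  qed
  have FG2: "F x y * G x y \<le> (F x y)\<^sup>2 / 2 + (G x y)\<^sup>2 / 2" for x y
    using sum_squares_bound[of "F x y" "G x y"] by simp
  have Fint: "(\<integral>\<^sup>+x. ennreal ((F x y)\<^sup>2) \<partial>lborel) \<le> ennreal (441 * (\<Sum>i\<in>J. (a i)\<^sup>2 * u i y))" for y
    unfolding F_def u_def
  proof (rule dual_bounded_intervals_triple[OF _ fin])
    show "disjoint_family_on (\<lambda>i. (\<lambda>x. (x, y)) -` E' i) J"
      using disj by (auto simp: disjoint_family_on_def E'_def)
    show "(\<lambda>x. (x, y)) -` E' i \<in> sets borel \<and> (\<lambda>x. (x, y)) -` E' i \<subseteq> {l i..r i} \<and> 0 \<le> a i" if "i \<in> J" for i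
      using E[OF that] E'b[of i] measurable_slices(1)[OF E'b(1)] by auto
  qed (use E in auto)
  have Gint: "(\<integral>\<^sup>+y. ennreal ((G x y)\<^sup>2) \<partial>lborel) \<le> ennreal (441 * (\<Sum>i\<in>J. (a i)\<^sup>2 * v i x))" for x
    unfolding G_def v_def
  proof (rule dual_bounded_intervals_triple[OF _ fin])
    show "disjoint_family_on (\<lambda>i. Pair x -` E' i) J"
      using disj by (auto simp: disjoint_family_on_def E'_def)
    show "Pair x -` E' i \<in> sets borel \<and> Pair x -` E' i \<subseteq> {b i..t i} \<and> 0 \<le> a i" if "i \<in> J" for i
      using E[OF that] E'b[of i] measurable_slices(2)[OF E'b(1)] by auto
  qed (use E in auto)
  have sumu: "(\<integral>\<^sup>+y. ennreal (441 * (\<Sum>i\<in>J. (a i)\<^sup>2 * u i y)) \<partial>lborel) = ennreal (441 * ?g)"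
    by (simp add: ennreal_mult' nn_integral_cmult sl(3) uv0 sum_nonneg flip: sum_ennreal)
      (simp add: ennreal_mult' nn_integral_cmult nn_integral_sum sl(3) uv0)
  have sumv: "(\<integral>\<^sup>+x. ennreal (441 * (\<Sum>i\<in>J. (a i)\<^sup>2 * v i x)) \<partial>lborel) = ennreal (441 * ?g)"
    by (simp add: ennreal_mult' nn_integral_cmult sl(4) uv0 sum_nonneg flip: sum_ennreal)
      (simp add: ennreal_mult' nn_integral_cmult nn_integral_sum sl(4) uv0)
  have Fm: "(\<lambda>(x,y). ennreal ((F x y)\<^sup>2)) \<in> borel_measurable (lborel \<Otimes>\<^sub>M lborel)"
    unfolding F_def by measurable
  have Gm: "(\<lambda>(x,y). ennreal ((G x y)\<^sup>2)) \<in> borel_measurable (lborel \<Otimes>\<^sub>M lborel)"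
    unfolding G_def by measurable
  have Fm': "(\<lambda>y. ennreal ((F x y)\<^sup>2)) \<in> borel_measurable lborel" for x
    unfolding F_def by measurable
  have Gm': "(\<lambda>y. ennreal ((G x y)\<^sup>2)) \<in> borel_measurable lborel" for x
    unfolding G_def by measurable
  have FF: "(\<integral>\<^sup>+x. \<integral>\<^sup>+y. ennreal ((F x y)\<^sup>2) \<partial>lborel \<partial>lborel) \<le> ennreal (441 * ?g)"
    unfolding sumu[symmetric] using lborel_pair.Fubini[OF Fm] nn_integral_mono[where M=lborel, of "\<lambda>y. \<integral>\<^sup>+x. ennreal ((F x y)\<^sup>2) \<partial>lborel", OF Fint] by simp
  have GG: "(\<integral>\<^sup>+x. \<integral>\<^sup>+y. ennreal ((G x y)\<^sup>2) \<partial>lborel \<partial>lborel) \<le> ennreal (441 * ?g)"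
    unfolding sumv[symmetric] by (intro nn_integral_mono Gint)
  \<comment> \<open>Each area is the integral of slice lengths, over \<open>y\<close> for
    \<open>E' i\<close> and over \<open>x\<close> for \<open>E' j\<close>. The product of two areas
    thus becomes a single integral over the plane.\<close>
  have "ennreal (\<Sum>i\<in>J. \<Sum>j\<in>J. k i j * (e i * e j)) = (\<Sum>i\<in>J. \<Sum>j\<in>J. ennreal (k i j) * (ennreal (e i) * ennreal (e j)))"
    using k0 uv0 by (simp add: ennreal_mult' sum_nonneg flip: sum_ennreal)
  also have "\<dots> = (\<Sum>i\<in>J. \<Sum>j\<in>J. (\<integral>\<^sup>+x. \<integral>\<^sup>+y. ennreal (k i j) * (ennreal (u i y) * ennreal (v j x)) \<partial>lborel \<partial>lborel))"
    by (intro sum.cong refl) (simp add: nn_integral_cmult nn_integral_multc sl(3,4))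
  also have "\<dots> = (\<integral>\<^sup>+x. \<integral>\<^sup>+y. (\<Sum>i\<in>J. \<Sum>j\<in>J. ennreal (k i j) * (ennreal (u i y) * ennreal (v j x))) \<partial>lborel \<partial>lborel)"
    by (simp add: nn_integral_sum)
  also have "\<dots> = (\<integral>\<^sup>+x. \<integral>\<^sup>+y. ennreal (\<Sum>i\<in>J. \<Sum>j\<in>J. k i j * (u i y * v j x)) \<partial>lborel \<partial>lborel)"
    using k0 uv0 by (simp add: ennreal_mult' sum_nonneg flip: sum_ennreal)
  also have "\<dots> \<le> (\<integral>\<^sup>+x. \<integral>\<^sup>+y. ennreal (1/2) * ennreal ((F x y)\<^sup>2) + ennreal (1/2) * ennreal ((G x y)\<^sup>2) \<partial>lborel \<partial>lborel)"
  proof (intro nn_integral_mono)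
    fix x y
    have "ennreal (\<Sum>i\<in>J. \<Sum>j\<in>J. k i j * (u i y * v j x)) \<le> ennreal ((1/2) * (F x y)\<^sup>2 + (1/2) * (G x y)\<^sup>2)"
      using order_trans[OF FGk FG2, of y x] by (intro ennreal_leI) simp
    also have "\<dots> = ennreal (1/2) * ennreal ((F x y)\<^sup>2) + ennreal (1/2) * ennreal ((G x y)\<^sup>2)"
      by (subst ennreal_plus, simp, simp, subst ennreal_mult, simp, simp, subst ennreal_mult, simp, simp, rule refl)
    finally show "ennreal (\<Sum>i\<in>J. \<Sum>j\<in>J. k i j * (u i y * v j x)) \<le> ennreal (1/2) * ennreal ((F x y)\<^sup>2) + ennreal (1/2) * ennreal ((G x y)\<^sup>2)"
      .
  qed
  also have "\<dots> = ennreal (1/2) * (\<integral>\<^sup>+x. \<integral>\<^sup>+y. ennreal ((F x y)\<^sup>2) \<partial>lborel \<partial>lborel) + ennreal (1/2) * (\<integral>\<^sup>+x. \<integral>\<^sup>+y. ennreal ((G x y)\<^sup>2) \<partial>lborel \<partial>lborel)"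
    using Fm Gm Fm' Gm' by (simp add: nn_integral_add nn_integral_cmult lborel.borel_measurable_nn_integral)
  also have "\<dots> \<le> ennreal (1/2) * ennreal (441 * ?g) + ennreal (1/2) * ennreal (441 * ?g)"
    using FF GG by (intro add_mono mult_left_mono) auto
  also have "\<dots> = ennreal (441 * ?g)"
    unfolding distrib_right[symmetric] by (subst ennreal_plus[symmetric]) auto
  finally have "(\<Sum>i\<in>J. \<Sum>j\<in>J. k i j * (e i * e j)) \<le> 441 * ?g"
    using uv0 by (subst (asm) ennreal_le_iff) (auto intro!: sum_nonneg)
  moreover have "(\<Sum>i\<in>J. \<Sum>j\<in>J. k i j * (e i * e j)) = (\<Sum>i\<in>J. \<Sum>j\<in>J. (a i * measure lborel (E i)) * (a j * measure lborel (E j)) *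
            (if cr i j then 1 / ((r i - l i) * (t j - b j)) else 0))"
    by (intro sum.cong refl) (simp add: k_def e_def E'_def mult_ac)
  moreover have "?g = (\<Sum>i\<in>J. (a i)\<^sup>2 * measure lborel (E i))"
    by (intro sum.cong refl) (simp add: e_def E'_def)
  ultimately show ?thesis by simp
qed


text \<open>Of two rectangles that meet, either one dominates in both side lengths or they cross. In
  the first case the dominating one, tripled in each direction, contains the other, so
  \<open>q = 9\<close>; the two crossing types give \<open>2 * 441 = 882\<close>, and
  \<open>2 * 9 + 882 + 1 = 901\<close>.\<close>

lemma dual_bounded_rects: "dual_bounded lborel rects 901"
proof -
  define sm where "sm P R \<longleftrightarrow> P \<inter> R \<noteq> {} \<and> measure lborel (fst ` R) \<le> measure lborel (fst ` P)
      \<and> measure lborel (snd ` R) \<le> measure lborel (snd ` P)" for P R :: "(real \<times> real) set"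
  define cr where "cr P R \<longleftrightarrow> P \<inter> R \<noteq> {} \<and> measure lborel (fst ` R) \<le> measure lborel (fst ` P)
      \<and> measure lborel (snd ` P) \<le> measure lborel (snd ` R)" for P R :: "(real \<times> real) set"
  define X0 where "X0 P R = (if cr P R then 1 / (measure lborel (fst ` P) * measure lborel (snd ` R)) else 0)"
    for P R :: "(real \<times> real) set"
  have "dual_bounded lborel rects (2 * 9 + 882 + 1)"
  proof (rule dual_bounded_self_improve[where sm=sm and X="\<lambda>P R. X0 P R + X0 R P"])
    show "rects \<subseteq> fmeasurable lborel" by (auto simp: rects_def measure_lborel_rect)
    show "\<And>P. P \<in> rects \<Longrightarrow> 0 < measure lborel P" by (auto simp: rects_def measure_lborel_rect)
  next
    fix P :: "(real \<times> real) set" assume "P \<in> rects"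
    then obtain l r b t where P: "P = {l..r} \<times> {b..t}" and lr: "l < r" "b < t" by (auto simp: rects_def)
    define D where "D = {2*l-r..2*r-l} \<times> {2*b-t..2*t-b}"
    have "D \<in> rects" using lr unfolding D_def by (intro rectsI) auto
    moreover have "P \<subseteq> D" using lr by (auto simp: P D_def)
    moreover have "measure lborel D \<le> 9 * measure lborel P"
      using lr by (simp add: P D_def measure_lborel_rect algebra_simps)
    moreover have "R \<subseteq> D" if "R \<in> rects" "sm P R" for R
    proof -
      obtain l' r' b' t' where R: "R = {l'..r'} \<times> {b'..t'}" and lr': "l' < r'" "b' < t'" using \<open>R \<in> rects\<close> by (auto simp: rects_def)
      obtain x y where xy: "(x, y) \<in> P \<inter> R" using \<open>sm P R\<close> by (auto simp: sm_def)
      have "r' - l' \<le> r - l" "t' - b' \<le> t - b"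
        using \<open>sm P R\<close> lr lr' by (auto simp: sm_def P R fst_image_times snd_image_times)
      then show ?thesis using xy lr lr' by (auto simp: P R D_def)
    qed
    ultimately show "\<exists>D\<in>rects. P \<subseteq> D \<and> measure lborel D \<le> 9 * measure lborel P \<and> (\<forall>R\<in>rects. sm P R \<longrightarrow> R \<subseteq> D)"
      by blast
  next
    fix P R :: "(real \<times> real) set" assume PR: "P \<in> rects" "R \<in> rects"
    obtain l r b t where P: "P = {l..r} \<times> {b..t}" and lr: "l < r" "b < t" using PR by (auto simp: rects_def)
    obtain l' r' b' t' where R: "R = {l'..r'} \<times> {b'..t'}" and lr': "l' < r'" "b' < t'" using PR by (auto simp: rects_def)
    have nn: "0 \<le> (if sm P R then 1 / measure lborel P else 0)" "0 \<le> (if sm R P then 1 / measure lborel R else 0)"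
        "0 \<le> X0 P R" "0 \<le> X0 R P" by (auto simp: X0_def)
    have m: "measure lborel (fst ` P) = r - l" "measure lborel (fst ` R) = r' - l'"
      "measure lborel (snd ` P) = t - b" "measure lborel (snd ` R) = t' - b'"
      using lr lr' by (auto simp: P R fst_image_times snd_image_times)
    have I: "{l..r} \<in> fmeasurable lborel" "{l'..r'} \<in> fmeasurable lborel" "{b..t} \<in> fmeasurable lborel" "{b'..t'} \<in> fmeasurable lborel"
      by (auto simp: fmeasurable_def emeasure_lborel_Icc_eq)
    have kx: "overlap lborel {l..r} {l'..r'} \<le> 1 / (r - l)" "overlap lborel {l..r} {l'..r'} \<le> 1 / (r' - l')"
      using overlap_le_inverse_max[OF I(1,2)] lr lr' by auto
    have ky: "overlap lborel {b..t} {b'..t'} \<le> 1 / (t - b)" "overlap lborel {b..t} {b'..t'} \<le> 1 / (t' - b')"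
      using overlap_le_inverse_max[OF I(3,4)] lr lr' by auto
    show "overlap lborel P R \<le> (if sm P R then 1 / measure lborel P else 0) + (if sm R P then 1 / measure lborel R else 0) + (X0 P R + X0 R P)"
    proof (cases "P \<inter> R = {}")
      case True
      then have "overlap lborel P R = 0" by (simp add: overlap_def)
      then show ?thesis using nn by linarith
    next
      case False
      have PRm: "measure lborel (P \<inter> R) = measure lborel ({l..r} \<inter> {l'..r'}) * measure lborel ({b..t} \<inter> {b'..t'})"
      proof -
        obtain x y where "(x, y) \<in> P \<inter> R" using False by auto
        then have "max l l' \<le> min r r'" "max b b' \<le> min t t'" by (auto simp: P R)
        then show ?thesis by (simp add: P R Times_Int_Times measure_lborel_rect)
      qed
      \<comment> \<open>The overlap is multiplicative on products. In each case below, each of its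
        two factors is bounded by the inverse of the longer side in that coordinate.\<close>
      have eq: "overlap lborel P R = overlap lborel {l..r} {l'..r'} * overlap lborel {b..t} {b'..t'}"
        using lr lr' unfolding overlap_def PRm by (simp add: P R measure_lborel_rect)
      have pos: "0 \<le> 1 / (r - l)" "0 \<le> 1 / (r' - l')" "0 \<le> 1 / (t - b)" "0 \<le> 1 / (t' - b')" using lr lr' by auto
      consider "r' - l' \<le> r - l" "t' - b' \<le> t - b" | "r - l \<le> r' - l'" "t - b \<le> t' - b'"
        | "r' - l' \<le> r - l" "t - b \<le> t' - b'" | "r - l \<le> r' - l'" "t' - b' \<le> t - b" by linarith
      then show ?thesis
      proof cases
        case 1
        have "overlap lborel P R \<le> 1 / (r - l) * (1 / (t - b))" unfolding eq using kx ky pos by (intro mult_mono) auto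
        also have "\<dots> = (if sm P R then 1 / measure lborel P else 0)"
          using 1 False lr by (simp add: sm_def m, simp add: P measure_lborel_rect)
        finally show ?thesis using nn by linarith
      next
        case 2
        have "overlap lborel P R \<le> 1 / (r' - l') * (1 / (t' - b'))" unfolding eq using kx ky pos by (intro mult_mono) auto
        also have "\<dots> = (if sm R P then 1 / measure lborel R else 0)"
          using 2 False lr' by (simp add: sm_def m Int_commute, simp add: R measure_lborel_rect)
        finally show ?thesis using nn by linarith
      next
        case 3
        have "overlap lborel P R \<le> 1 / (r - l) * (1 / (t' - b'))" unfolding eq using kx ky pos by (intro mult_mono) auto
        also have "\<dots> = X0 P R" using 3 False by (simp add: X0_def cr_def m)
        finally show ?thesis using nn by linarith
      next
        case 4
        have "overlap lborel P R \<le> 1 / (r' - l') * (1 / (t - b))" unfolding eq using kx ky pos by (intro mult_mono) auto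
        also have "\<dots> = X0 R P" using 4 False by (simp add: X0_def cr_def m Int_commute)
        finally show ?thesis using nn by linarith
      qed
    qed
  next
    fix J P E a assume ad: "admissible (lborel :: (real \<times> real) measure) rects J P E a"
    have "\<forall>i\<in>J. \<exists>l r b t. P i = {l..r} \<times> {b..t} \<and> l < r \<and> b < t" using ad by (auto simp: admissible_def rects_def)
    then obtain l r b t where P: "\<And>i. i \<in> J \<Longrightarrow> P i = {l i..r i} \<times> {b i..t i} \<and> l i < r i \<and> b i < t i" by metis
    have m: "measure lborel (fst ` P i) = r i - l i" "measure lborel (snd ` P i) = t i - b i" if "i \<in> J" for i
      using P[OF that] by (auto simp: fst_image_times snd_image_times)
    let ?c = "\<lambda>i. a i * measure lborel (E i)"
    have c1: "(\<Sum>i\<in>J. \<Sum>j\<in>J. ?c i * ?c j * (if cr (P i) (P j) then 1 / ((r i - l i) * (t j - b j)) else 0))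
        \<le> 441 * (\<Sum>i\<in>J. (a i)\<^sup>2 * measure lborel (E i))"
    proof (rule crossing_bound)
      show "finite J" "disjoint_family_on E J" using ad by (auto simp: admissible_def)
      show "l i < r i \<and> b i < t i \<and> E i \<in> sets borel \<and> E i \<subseteq> {l i..r i} \<times> {b i..t i} \<and> 0 \<le> a i" if "i \<in> J" for i
        using P[OF that] ad that by (auto simp: admissible_def)
      show "{l j..r j} \<subseteq> {2 * l i - r i..2 * r i - l i} \<and> {b i..t i} \<subseteq> {2 * b j - t j..2 * t j - b j}"
        if ij: "i \<in> J" "j \<in> J" and "cr (P i) (P j)" for i j
      proof -
        have "P i \<inter> P j \<noteq> {}" using that by (simp add: cr_def)
        then obtain x y where "(x, y) \<in> P i \<inter> P j" by fastforce
        then have "x \<in> {l i..r i}" "x \<in> {l j..r j}" "y \<in> {b i..t i}" "y \<in> {b j..t j}" using P ij by auto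
        moreover have "r j - l j \<le> r i - l i" "t i - b i \<le> t j - b j" using that m by (auto simp: cr_def)
        ultimately show ?thesis by auto
      qed
    qed
    have c2: "(\<Sum>i\<in>J. \<Sum>j\<in>J. ?c i * ?c j * (if cr (P i) (P j) then 1 / ((r i - l i) * (t j - b j)) else 0))
       = (\<Sum>i\<in>J. \<Sum>j\<in>J. ?c i * ?c j * X0 (P i) (P j))"
      by (intro sum.cong refl) (simp add: X0_def m)
    have c3: "(\<Sum>i\<in>J. \<Sum>j\<in>J. ?c i * ?c j * X0 (P j) (P i)) = (\<Sum>i\<in>J. \<Sum>j\<in>J. ?c i * ?c j * X0 (P i) (P j))"
      by (subst sum.swap) (simp add: mult.commute)
    show "(\<Sum>i\<in>J. \<Sum>j\<in>J. ?c i * ?c j * (X0 (P i) (P j) + X0 (P j) (P i))) \<le> 882 * (\<Sum>i\<in>J. (a i)\<^sup>2 * measure lborel (E i))"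
      using c1 c2 c3 by (simp add: distrib_left sum.distrib)
  qed auto
  then show ?thesis by simp
qed

subsection \<open>Parallelograms of a given slope\<close>

text \<open>The measurable inverse \<open>S\<close> carries the arbitrary sets \<open>E i\<close>
  over to \<open>N\<close>, so that whole admissible families correspond to each other with equal
  measures.\<close>

lemma dual_bounded_vimage:
  assumes T: "T \<in> M \<rightarrow>\<^sub>M N" and S: "S \<in> N \<rightarrow>\<^sub>M M" and inv: "\<And>x. S (T x) = x" "\<And>y. T (S y) = y"
    and distr: "distr M N T = N" and sp: "space M = UNIV" "space N = UNIV"
    and C: "\<C> \<subseteq> sets N" and bd: "dual_bounded N \<C> A"
  shows "dual_bounded M ((\<lambda>P. T -` P) ` \<C>) A"
  unfolding dual_bounded_def
proof (intro conjI allI impI)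
  show "0 \<le> A" using bd by (simp add: dual_bounded_def)
  fix J P E a assume ad: "admissible M ((\<lambda>P. T -` P) ` \<C>) J P E a"
  have m: "measure M (T -` X) = measure N X" if "X \<in> sets N" for X
    using measure_distr[OF T that] distr sp by simp
  define P' where "P' i = S -` P i" for i
  define E' where "E' i = S -` E i" for i
  have P: "P i = T -` P' i \<and> P' i \<in> \<C>" if "i \<in> J" for i
  proof -
    obtain Q where Q: "P i = T -` Q" "Q \<in> \<C>" using ad \<open>i \<in> J\<close> by (auto simp: admissible_def)
    have "P' i = Q" unfolding P'_def Q(1) using inv(2) by (simp add: vimage_def)
    then show ?thesis using Q by simp
  qed
  have E: "E i = T -` E' i \<and> E' i \<in> sets N \<and> E' i \<subseteq> P' i" if "i \<in> J" for i
  proof -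
    have "E i \<in> sets M" "E i \<subseteq> P i" using ad that by (auto simp: admissible_def)
    moreover have "T -` E' i = E i" unfolding E'_def using inv(1) by (simp add: vimage_def)
    ultimately show ?thesis using measurable_sets[OF S, of "E i"] sp by (auto simp: E'_def P'_def)
  qed
  have ad': "admissible N \<C> J P' E' a"
    unfolding admissible_def
  proof (intro conjI ballI)
    show "finite J" using ad by (simp add: admissible_def)
    show "disjoint_family_on E' J" using ad by (auto simp: admissible_def disjoint_family_on_def E'_def)
    fix i assume i: "i \<in> J"
    show "P' i \<in> \<C>" using P[OF i] by blast
    show "E' i \<in> sets N" "E' i \<subseteq> P' i" using E[OF i] by blast+
    show "0 \<le> a i" using ad i by (simp add: admissible_def)
  qed
  have PN: "P' i \<in> sets N" if "i \<in> J" for i using P[OF that] C by auto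
  have mP: "measure M (P i) = measure N (P' i)" "measure M (E i) = measure N (E' i)" if "i \<in> J" for i
  proof -
    show "measure M (P i) = measure N (P' i)" using P[OF that] m[OF PN[OF that]] by (simp only:)
    show "measure M (E i) = measure N (E' i)" using E[OF that] m[of "E' i"] by (simp only:)
  qed
  have mPP: "measure M (P i \<inter> P j) = measure N (P' i \<inter> P' j)" if "i \<in> J" "j \<in> J" for i j
  proof -
    have "P i \<inter> P j = T -` (P' i \<inter> P' j)" using P[OF that(1)] P[OF that(2)] by (simp only: vimage_Int)
    moreover have "P' i \<inter> P' j \<in> sets N" using PN that by (intro sets.Int)
    ultimately show ?thesis using m by (simp only:)
  qed
  have "overlap_form M J P (\<lambda>i. a i * measure M (E i)) = overlap_form N J P' (\<lambda>i. a i * measure N (E' i))"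
    unfolding overlap_form_def by (intro sum.cong refl) (simp add: overlap_def mP mPP)
  also have "\<dots> \<le> A\<^sup>2 * (\<Sum>i\<in>J. (a i)\<^sup>2 * measure N (E' i))" by (rule dual_boundedD[OF bd ad'])
  also have "(\<Sum>i\<in>J. (a i)\<^sup>2 * measure N (E' i)) = (\<Sum>i\<in>J. (a i)\<^sup>2 * measure M (E i))"
    by (intro sum.cong refl) (simp add: mP)
  finally show "overlap_form M J P (\<lambda>i. a i * measure M (E i)) \<le> A\<^sup>2 * (\<Sum>i\<in>J. (a i)\<^sup>2 * measure M (E i))" .
qed

definition shear :: "real \<Rightarrow> real \<times> real \<Rightarrow> real \<times> real" where
  "shear m z = (fst z, snd z - m * fst z)"

lemma borel_measurable_shear [measurable]: "shear m \<in> borel \<rightarrow>\<^sub>M borel"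
  unfolding shear_def[abs_def] by (intro borel_measurable_continuous_onI continuous_intros)

text \<open>Cavalieri's principle: on each vertical line the shear is a translation.\<close>

lemma distr_shear: "distr lborel lborel (shear m) = lborel"
proof (rule measure_eqI)
  fix A assume "A \<in> sets (distr lborel lborel (shear m))"
  then have A: "A \<in> sets borel" by simp
  have sh: "shear m -` A \<in> sets borel" using measurable_sets[OF borel_measurable_shear A] by simp
  have sets: "X \<in> sets borel \<Longrightarrow> X \<in> sets (lborel \<Otimes>\<^sub>M lborel)" for X :: "(real \<times> real) set"
  proof -
    assume X: "X \<in> sets borel"
    have "sets (lborel \<Otimes>\<^sub>M lborel) = sets (lborel :: (real \<times> real) measure)" by (simp only: lborel_prod)
    then show ?thesis using X by simp
  qed
  have slice: "emeasure lborel (Pair x -` (shear m -` A)) = emeasure lborel (Pair x -` A)" for x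
  proof -
    have B: "Pair x -` A \<in> sets borel" using measurable_slices(2)[OF A] .
    have "Pair x -` (shear m -` A) = (+) (- m * x) -` (Pair x -` A)" by (auto simp: shear_def add.commute)
    also have "emeasure lborel \<dots> = emeasure (distr lborel borel ((+) (- m * x))) (Pair x -` A)"
      using B by (subst emeasure_distr) auto
    finally show ?thesis unfolding lborel_distr_plus .
  qed
  have "emeasure lborel (shear m -` A) = emeasure lborel A"
    using lborel.emeasure_pair_measure_alt[OF sets[OF sh]] lborel.emeasure_pair_measure_alt[OF sets[OF A]]
    by (simp add: slice lborel_prod)
  then show "emeasure (distr lborel lborel (shear m)) A = emeasure lborel A"
    using A by (subst emeasure_distr) auto
qed simp

text \<open>Two sides are vertical instead of perpendicular to the slope: the area is then
  independent of \<open>m\<close>, a shear maps the set to an axis-parallel rectangle, and every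
  nonempty vertical slice has length \<open>t - b\<close>.\<close>

definition parallelogram :: "real \<Rightarrow> real \<Rightarrow> real \<Rightarrow> real \<Rightarrow> real \<Rightarrow> (real \<times> real) set" where
  "parallelogram m l r b t = {(x, y). l \<le> x \<and> x \<le> r \<and> b \<le> y - m * x \<and> y - m * x \<le> t}"

definition parallelograms :: "real set \<Rightarrow> (real \<times> real) set set" where
  "parallelograms \<Sigma> = {parallelogram m l r b t | m l r b t. m \<in> \<Sigma> \<and> l < r \<and> b < t}"

lemma parsI: "m \<in> \<Sigma> \<Longrightarrow> l < r \<Longrightarrow> b < t \<Longrightarrow> parallelogram m l r b t \<in> parallelograms \<Sigma>"
  unfolding parallelograms_def by blast

lemma parallelogram_eq_vimage: "parallelogram m l r b t = shear m -` ({l..r} \<times> {b..t})"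
  by (auto simp: parallelogram_def shear_def)

lemma measure_parallelogram:
  assumes "l \<le> r" "b \<le> t"
  shows "measure lborel (parallelogram m l r b t) = (r - l) * (t - b)" "parallelogram m l r b t \<in> fmeasurable lborel"
proof -
  have R: "{l..r} \<times> {b..t} \<in> sets lborel" using measure_lborel_rect(2)[OF assms] by auto
  have "emeasure lborel (parallelogram m l r b t) = emeasure (distr lborel lborel (shear m)) ({l..r} \<times> {b..t})"
    using R by (subst emeasure_distr) (auto simp: parallelogram_eq_vimage)
  then have e: "emeasure lborel (parallelogram m l r b t) = emeasure lborel ({l..r} \<times> {b..t})" by (simp add: distr_shear)
  then show "measure lborel (parallelogram m l r b t) = (r - l) * (t - b)"
    using measure_lborel_rect(1)[OF assms] by (simp add: measure_def)
  have "parallelogram m l r b t \<in> sets lborel" using measurable_sets[OF borel_measurable_shear, of "{l..r} \<times> {b..t}"] R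
    by (simp add: parallelogram_eq_vimage)
  then show "parallelogram m l r b t \<in> fmeasurable lborel"
    using e measure_lborel_rect(2)[OF assms] by (simp add: fmeasurable_def)
qed

lemma parallelograms_fmeasurable: "parallelograms \<Sigma> \<subseteq> fmeasurable lborel"
  by (auto simp: parallelograms_def measure_parallelogram)

lemma dual_bounded_single_slope: "dual_bounded lborel (parallelograms {m}) 901"
proof -
  have "dual_bounded lborel ((\<lambda>P. shear m -` P) ` rects) 901"
  proof (rule dual_bounded_vimage[where S="shear (- m)" and N=lborel])
    show "rects \<subseteq> sets lborel"
      using measure_lborel_rect(2) by (auto simp: rects_def simp del: sets_lborel intro!: fmeasurableD)
  qed (auto simp: shear_def dual_bounded_rects distr_shear)
  moreover have "parallelograms {m} \<subseteq> (\<lambda>P. shear m -` P) ` rects"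
    by (auto simp: parallelograms_def parallelogram_eq_vimage intro!: imageI rectsI)
  ultimately show ?thesis by (rule dual_bounded_mono) simp
qed

text \<open>A parallelogram of slope \<open>n\<close>, of three times the length, that contains a vertical neighborhood of
  \<open>parallelogram m l r b t\<close> of radius comparable to its own height \<open>(t - b) + |m - n| (r - l)\<close>.\<close>
definition widen :: "real \<Rightarrow> real \<Rightarrow> real \<Rightarrow> real \<Rightarrow> real \<Rightarrow> real \<Rightarrow> (real \<times> real) set" where
  "widen m n l r b t = (let H = (t - b) + \<bar>m - n\<bar> * (r - l) in
     parallelogram n (2 * l - r) (2 * r - l) (b + (m - n) * l - 3 * H) (t + (m - n) * l + 3 * H))"

lemma widen_in_parallelograms: "l < r \<Longrightarrow> b < t \<Longrightarrow> n \<in> \<Sigma> \<Longrightarrow> widen m n l r b t \<in> parallelograms \<Sigma>"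
proof -
  assume a: "l < r" "b < t" "n \<in> \<Sigma>"
  have "0 \<le> \<bar>m - n\<bar> * (r - l)" using a by simp
  then show ?thesis unfolding widen_def Let_def using a by (intro parsI) (assumption, simp, smt (verit))
qed

lemma measure_widen_le:
  assumes "l < r" "b < t"
  shows "measure lborel (widen m n l r b t) \<le> 21 * (r - l) * ((t - b) + \<bar>m - n\<bar> * (r - l))"
    and "0 < measure lborel (widen m n l r b t)" "widen m n l r b t \<in> fmeasurable lborel"
proof -
  define H where "H = (t - b) + \<bar>m - n\<bar> * (r - l)"
  have nn: "0 \<le> \<bar>m - n\<bar> * (r - l)" using assms by simp
  then have H: "t - b \<le> H" "0 < H" using assms unfolding H_def by linarith+
  have eq: "measure lborel (widen m n l r b t) = (3 * (r - l)) * ((t - b) + 6 * H)"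
    unfolding widen_def Let_def H_def[symmetric] using assms H by (subst measure_parallelogram) auto
  have "(3 * (r - l)) * ((t - b) + 6 * H) \<le> (3 * (r - l)) * (7 * H)" using assms H by (intro mult_left_mono) auto
  then show "measure lborel (widen m n l r b t) \<le> 21 * (r - l) * ((t - b) + \<bar>m - n\<bar> * (r - l))"
    unfolding eq H_def[symmetric] by (simp only: mult_ac)
  show "0 < measure lborel (widen m n l r b t)" unfolding eq using assms H by (intro mult_pos_pos) auto
  show "widen m n l r b t \<in> fmeasurable lborel"
    unfolding widen_def Let_def H_def[symmetric] using assms H by (intro measure_parallelogram) auto
qed

text \<open>The margin \<open>3 * H\<close> in \<open>widen\<close> splits into two parts: over the
  length \<open>r - l\<close> the two slopes drift apart by at most \<open>H\<close>, and
  \<open>2 * H\<close> are left for the displacement from a point of the parallelogram.\<close>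

lemma widen_mem:
  assumes lr: "l < r" "b < t" and z: "(x0, y0) \<in> parallelogram m l r b t"
    and xy: "\<bar>x - x0\<bar> \<le> r - l" "\<bar>(y - n * x) - (y0 - n * x0)\<bar> \<le> 2 * ((t - b) + \<bar>m - n\<bar> * (r - l))"
  shows "(x, y) \<in> widen m n l r b t"
proof -
  define H where "H = (t - b) + \<bar>m - n\<bar> * (r - l)"
  have z': "l \<le> x0" "x0 \<le> r" "b \<le> y0 - m * x0" "y0 - m * x0 \<le> t" using z by (auto simp: parallelogram_def)
  have "\<bar>(m - n) * (x0 - l)\<bar> \<le> \<bar>m - n\<bar> * (r - l)"
    unfolding abs_mult using z' by (intro mult_left_mono) auto
  then have "\<bar>(m - n) * (x0 - l)\<bar> \<le> H" using lr by (simp add: H_def)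
  moreover have "(m - n) * (x0 - l) = (y0 - n * x0) - (y0 - m * x0) - (m - n) * l" by (simp add: algebra_simps)
  ultimately have "b + (m - n) * l - H \<le> y0 - n * x0" "y0 - n * x0 \<le> t + (m - n) * l + H" using z' by linarith+
  then show ?thesis using xy z' unfolding widen_def Let_def H_def[symmetric] by (auto simp: parallelogram_def)
qed

lemma parallelogram_subset_widen:
  assumes "l < r" "b < t" shows "parallelogram m l r b t \<subseteq> widen m n l r b t"
proof (rule subsetI, clarify)
  fix x y assume "(x, y) \<in> parallelogram m l r b t"
  moreover have "0 \<le> \<bar>m - n\<bar> * (r - l)" using assms by simp
  ultimately show "(x, y) \<in> widen m n l r b t" using assms by (intro widen_mem) auto
qed

text \<open>At a common point of the two infinite strips, \<open>x\<close> is confined to an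
  interval of length \<open>((t - b) + (t' - b')) / \<bar>m - m'\<bar>\<close>, so the intersection
  lies in a parallelogram cut from the first strip.\<close>

lemma measure_strips_Int_le1:
  assumes "l < r" "b < t" "b' < t'" "m \<noteq> m'"
  shows "measure lborel (parallelogram m l r b t \<inter> parallelogram m' l' r' b' t') \<le> (t - b) * (((t - b) + (t' - b')) / \<bar>m - m'\<bar>)"
proof -
  define w where "w = (if m < m' then (b - t') / (m' - m) else (t - b') / (m' - m))"
  define w' where "w' = (if m < m' then (t - b') / (m' - m) else (b - t') / (m' - m))"
  have ww: "w' - w = ((t - b) + (t' - b')) / \<bar>m - m'\<bar>" "w \<le> w'"
  proof -
    show *: "w' - w = ((t - b) + (t' - b')) / \<bar>m - m'\<bar>"
      using assms by (auto simp: w_def w'_def abs_if field_simps)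
    have "0 \<le> ((t - b) + (t' - b')) / \<bar>m - m'\<bar>" using assms by simp
    then show "w \<le> w'" using * by linarith
  qed
  have "parallelogram m l r b t \<inter> parallelogram m' l' r' b' t' \<subseteq> parallelogram m w w' b t"
  proof (clarsimp simp: parallelogram_def)
    fix x y assume h: "b \<le> y - m * x" "y - m * x \<le> t" "b' \<le> y - m' * x" "y - m' * x \<le> t'"
    have "b - t' \<le> (m' - m) * x" "(m' - m) * x \<le> t - b'" using h by (auto simp: algebra_simps)
    then show "w \<le> x \<and> x \<le> w'" using assms by (auto simp: w_def w'_def field_simps)
  qed
  moreover have "parallelogram m l r b t \<inter> parallelogram m' l' r' b' t' \<in> sets lborel"
  proof -
    have "parallelogram m' l' r' b' t' \<in> sets lborel"
    proof -
      have "{l'..r'} \<times> {b'..t'} = cbox (l',b') (r',t')" by (simp add: cbox_Pair_eq)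
      then have "{l'..r'} \<times> {b'..t'} \<in> sets borel" by simp
      then show ?thesis using measurable_sets[OF borel_measurable_shear, of "{l'..r'} \<times> {b'..t'}"] by (simp add: parallelogram_eq_vimage)
    qed
    then show ?thesis using measure_parallelogram(2)[of l r b t m] assms by (auto intro!: sets.Int)
  qed
  ultimately have "measure lborel (parallelogram m l r b t \<inter> parallelogram m' l' r' b' t') \<le> measure lborel (parallelogram m w w' b t)"
    using measure_parallelogram(2)[OF ww(2), of b t m] assms by (intro measure_mono_fmeasurable) auto
  then show ?thesis using ww assms by (subst (asm) measure_parallelogram) (auto simp: mult.commute)
qed

text \<open>The preceding bound can be applied from either strip. From the thinner one, the sum of
  the heights is at most twice the larger height.\<close>

lemma measure_strips_Int_le:
  assumes "l < r" "b < t" "l' < r'" "b' < t'" "m \<noteq> m'"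
  shows "measure lborel (parallelogram m l r b t \<inter> parallelogram m' l' r' b' t') \<le> 2 * (t - b) * (t' - b') / \<bar>m - m'\<bar>"
proof -
  let ?M = "measure lborel (parallelogram m l r b t \<inter> parallelogram m' l' r' b' t')"
  have 1: "?M \<le> (t - b) * (((t - b) + (t' - b')) / \<bar>m - m'\<bar>)" using assms by (intro measure_strips_Int_le1)
  have 2: "?M \<le> (t' - b') * (((t - b) + (t' - b')) / \<bar>m - m'\<bar>)"
    using measure_strips_Int_le1[of l' r' b' t' b t m' m l r] assms by (simp add: Int_commute abs_minus_commute add.commute)
  show ?thesis
  proof (cases "t - b \<le> t' - b'")
    case True
    have "(t - b) * (((t - b) + (t' - b')) / \<bar>m - m'\<bar>) \<le> (t - b) * ((2 * (t' - b')) / \<bar>m - m'\<bar>)"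
      using True assms by (intro mult_left_mono divide_right_mono) auto
    also have "(t - b) * ((2 * (t' - b')) / \<bar>m - m'\<bar>) = 2 * (t - b) * (t' - b') / \<bar>m - m'\<bar>" by (simp add: algebra_simps)
    finally show ?thesis using 1 by linarith
  next
    case False
    have "(t' - b') * (((t - b) + (t' - b')) / \<bar>m - m'\<bar>) \<le> (t' - b') * ((2 * (t - b)) / \<bar>m - m'\<bar>)"
      using False assms by (intro mult_left_mono divide_right_mono) auto
    also have "(t' - b') * ((2 * (t - b)) / \<bar>m - m'\<bar>) = 2 * (t - b) * (t' - b') / \<bar>m - m'\<bar>" by (simp add: mult.commute)
    finally show ?thesis using 2 by linarith
  qed
qed


text \<open>This compares the vertical slices: where the slice on the left is nonempty, it has length at most
  \<open>t - b\<close>, and the one on the right has length at least \<open>H\<close>.\<close>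
lemma measure_thick_Int_le:
  fixes l r b t l' r' b' t' m n m' :: real
  assumes lr: "l < r" "b < t" and lr': "l' < r'" "b' < t'"
  defines "H \<equiv> (t - b) + \<bar>m - n\<bar> * (r - l)"
  assumes H: "H \<le> t' - b'"
  shows "measure lborel (parallelogram m l r b t \<inter> parallelogram m' l' r' b' t') * H
    \<le> measure lborel (widen m n l r b t \<inter> parallelogram m' l' r' b' t') * (t - b)"
proof -
  let ?P = "parallelogram m l r b t" and ?R = "parallelogram m' l' r' b' t'" and ?D = "widen m n l r b t"
  have nn: "0 \<le> \<bar>m - n\<bar> * (r - l)" using lr by simp
  then have H0: "t - b \<le> H" "0 < H" using lr unfolding H_def by linarith+
  have fm: "?P \<inter> ?R \<in> fmeasurable lborel" "?D \<inter> ?R \<in> fmeasurable lborel"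
    using measure_parallelogram(2) measure_widen_le(3) lr lr' by (auto intro!: fmeasurable.Int)
  have sets: "X \<in> fmeasurable lborel \<Longrightarrow> X \<in> sets (lborel \<Otimes>\<^sub>M lborel)" for X :: "(real \<times> real) set"
    by (simp add: lborel_prod fmeasurableD del: sets_lborel)
  have alt: "emeasure lborel X = (\<integral>\<^sup>+x. emeasure lborel (Pair x -` X) \<partial>lborel)"
      if "X \<in> fmeasurable lborel" for X :: "(real \<times> real) set"
    using lborel.emeasure_pair_measure_alt[OF sets[OF that]] by (simp add: lborel_prod)
  have meas: "(\<lambda>x. emeasure lborel (Pair x -` X)) \<in> borel_measurable lborel"
      if "X \<in> fmeasurable lborel" for X :: "(real \<times> real) set"
    using lborel.measurable_emeasure_Pair[OF sets[OF that]] by simp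
  have slice: "emeasure lborel (Pair x -` (?P \<inter> ?R)) * ennreal H \<le> emeasure lborel (Pair x -` (?D \<inter> ?R)) * ennreal (t - b)" for x
  proof (cases "Pair x -` (?P \<inter> ?R) = {}")
    case True
    then show ?thesis by simp
  next
    case False
    then obtain y where y: "(x, y) \<in> ?P" "(x, y) \<in> ?R" by auto
    have "Pair x -` (?P \<inter> ?R) \<subseteq> {b + m * x..t + m * x}" by (auto simp: parallelogram_def)
    then have "emeasure lborel (Pair x -` (?P \<inter> ?R)) \<le> emeasure lborel {b + m * x..t + m * x}"
      by (rule emeasure_mono) simp
    also have "\<dots> = ennreal (t - b)" using lr by simp
    finally have 1: "emeasure lborel (Pair x -` (?P \<inter> ?R)) \<le> ennreal (t - b)" .
    \<comment> \<open>The slice of the second set has length at least \<open>H\<close>, so its part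
      within distance \<open>H\<close> of the common height \<open>y\<close> still has length at
      least \<open>H\<close>.\<close>
    define lo where "lo = max (b' + m' * x) (y - H)"
    define hi where "hi = min (t' + m' * x) (y + H)"
    have yR: "b' + m' * x \<le> y" "y \<le> t' + m' * x" "l' \<le> x" "x \<le> r'" using y by (auto simp: parallelogram_def)
    have len: "H \<le> hi - lo" using yR H H0 unfolding lo_def hi_def by (auto simp: max_def min_def)
    have sub: "{lo..hi} \<subseteq> Pair x -` (?D \<inter> ?R)"
    proof
      fix z assume z: "z \<in> {lo..hi}"
      then have "(x, z) \<in> ?R" using yR by (auto simp: parallelogram_def lo_def hi_def)
      moreover have "(x, z) \<in> ?D"
      proof (rule widen_mem[OF lr y(1)])
        show "\<bar>x - x\<bar> \<le> r - l" using lr by simp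
        have "\<bar>z - y\<bar> \<le> H" using z by (auto simp: lo_def hi_def)
        then show "\<bar>z - n * x - (y - n * x)\<bar> \<le> 2 * (t - b + \<bar>m - n\<bar> * (r - l))"
          unfolding H_def[symmetric] using H0 by simp
      qed
      ultimately show "z \<in> Pair x -` (?D \<inter> ?R)" by simp
    qed
    have DR: "Pair x -` (?D \<inter> ?R) \<in> sets lborel"
      using measurable_slices(2)[of "?D \<inter> ?R" x] fm(2) by (simp add: fmeasurable_def del: vimage_Int)
    have "ennreal H \<le> ennreal (hi - lo)" using len by (rule ennreal_leI)
    also have "\<dots> = emeasure lborel {lo..hi}" using len H0 by simp
    also have "\<dots> \<le> emeasure lborel (Pair x -` (?D \<inter> ?R))" using sub DR by (rule emeasure_mono)
    finally have 2: "ennreal H \<le> emeasure lborel (Pair x -` (?D \<inter> ?R))" .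
    have "emeasure lborel (Pair x -` (?P \<inter> ?R)) * ennreal H \<le> ennreal (t - b) * emeasure lborel (Pair x -` (?D \<inter> ?R))"
      using 1 2 by (intro mult_mono) auto
    then show ?thesis by (simp add: mult.commute)
  qed
  have "emeasure lborel (?P \<inter> ?R) * ennreal H \<le> emeasure lborel (?D \<inter> ?R) * ennreal (t - b)"
    unfolding alt[OF fm(1)] alt[OF fm(2)]
    by (subst (1 2) nn_integral_multc[symmetric]) (intro meas fm nn_integral_mono slice)+
  then have "ennreal (measure lborel (?P \<inter> ?R) * H) \<le> ennreal (measure lborel (?D \<inter> ?R) * (t - b))"
    using fm H0 lr by (simp add: ennreal_mult emeasure_eq_measure2)
  then show ?thesis using lr by (subst (asm) ennreal_le_iff) auto
qed

text \<open>With \<open>H\<close> as in \<open>widen\<close>, the widened set has area at most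
  \<open>21 * (r - l) * H\<close>, while the intersection grows at least by the factor
  \<open>H / (4 * (C + 1) * (t - b))\<close>; hence \<open>84 = 21 * 4\<close>. The growth relies on
  the second parallelogram being at least as long as the first.\<close>

lemma overlap_le_overlap_widen:
  assumes lr: "l < r" "b < t" and lr': "l' < r'" "b' < t'" and L: "r - l \<le> r' - l'"
    and C: "0 \<le> C" "\<bar>m - n\<bar> \<le> C * \<bar>m - m'\<bar>"
  shows "overlap lborel (parallelogram m l r b t) (parallelogram m' l' r' b' t')
     \<le> 84 * (C + 1) * overlap lborel (widen m n l r b t) (parallelogram m' l' r' b' t')"
proof -
  let ?P = "parallelogram m l r b t" and ?R = "parallelogram m' l' r' b' t'" and ?D = "widen m n l r b t"
  define H where "H = (t - b) + \<bar>m - n\<bar> * (r - l)"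
  have nn: "0 \<le> \<bar>m - n\<bar> * (r - l)" using lr by simp
  then have H0: "t - b \<le> H" "0 < H" using lr unfolding H_def by linarith+
  have fm: "?D \<inter> ?R \<in> fmeasurable lborel" "?P \<in> fmeasurable lborel" "?R \<in> fmeasurable lborel"
    using measure_parallelogram(2) measure_widen_le(3) lr lr' by (auto intro!: fmeasurable.Int)
  let ?x = "measure lborel (?P \<inter> ?R)" and ?y = "measure lborel (?D \<inter> ?R)"
  have key: "?x * H \<le> 4 * (C + 1) * ?y * (t - b)"
  proof -
    \<comment> \<open>Either \<open>H\<close> is comparable to the height of the first set, or the
      second set is thick and the slices can be compared, or the tilt dominates both heights and the
      transversality of the slopes \<open>m\<close> and \<open>m'\<close> decides.\<close>
    consider "\<bar>m - n\<bar> * (r - l) \<le> t - b" | "?P \<inter> ?R = {}" | "H \<le> t' - b'"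
      | "t - b < \<bar>m - n\<bar> * (r - l)" "?P \<inter> ?R \<noteq> {}" "t' - b' < H" by linarith
    then show ?thesis
    proof cases
      case 1
      have "?x \<le> ?y" using fm parallelogram_subset_widen[OF lr, of m n]
        by (intro measure_mono_fmeasurable) (auto intro!: sets.Int dest: fmeasurableD)
      moreover have "H \<le> 2 * (t - b)" using 1 by (simp add: H_def)
      ultimately have "?x * H \<le> ?y * (2 * (t - b))" using H0 by (intro mult_mono) auto
      also have "\<dots> = 2 * (?y * (t - b))" by simp
      also have "\<dots> \<le> 4 * (C + 1) * (?y * (t - b))" using C lr by (intro mult_right_mono) auto
      finally show ?thesis by (simp add: mult.assoc)
    next
      case 2
      then show ?thesis using C lr by simp
    next
      case 3
      have "?x * H \<le> ?y * (t - b)"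
        using measure_thick_Int_le[OF lr lr', of m n m'] 3 by (simp add: H_def)
      also have "\<dots> \<le> 4 * (C + 1) * (?y * (t - b))"
        using C lr mult_right_mono[of 1 "4 * (C + 1)" "?y * (t - b)"] by simp
      finally show ?thesis by (simp add: mult.assoc)
    next
      case 4
      define \<alpha> where "\<alpha> = \<bar>m - m'\<bar>"
      define \<beta> where "\<beta> = \<bar>m - n\<bar>"
      have "0 < \<beta>"
      proof (rule ccontr)
        assume "\<not> 0 < \<beta>"
        then have "\<beta> = 0" by (simp add: \<beta>_def)
        then show False using 4(1) lr by (simp add: \<beta>_def)
      qed
      moreover have \<beta>\<alpha>: "\<beta> \<le> C * \<alpha>" using C by (simp add: \<alpha>_def \<beta>_def)
      ultimately have "0 < C * \<alpha>" by linarith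
      then have pos: "0 < \<alpha>" "0 < C" "0 < \<beta>" using C \<open>0 < \<beta>\<close> by (auto simp: zero_less_mult_iff \<alpha>_def)
      obtain x0 y0 where z0: "(x0, y0) \<in> ?P" "(x0, y0) \<in> ?R" using 4(2) by fastforce
      \<comment> \<open>A length over which lines of slopes \<open>m'\<close> and \<open>n\<close>
        diverge by at most \<open>\<beta> * (r - l) \<le> H\<close>, because
        \<open>\<bar>m' - n\<bar> \<le> (C + 1) * \<alpha>\<close>.\<close>
      define \<tau> where "\<tau> = \<beta> * (r - l) / ((C + 1) * \<alpha>)"
      have \<tau>: "0 < \<tau>" "\<tau> \<le> r - l" "(C + 1) * \<alpha> * \<tau> = \<beta> * (r - l)"
      proof -
        show "0 < \<tau>" using pos lr by (auto simp: \<tau>_def)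
        have "\<beta> \<le> (C + 1) * \<alpha>" using \<beta>\<alpha> pos by (simp add: algebra_simps)
        then have "\<beta> * (r - l) \<le> ((C + 1) * \<alpha>) * (r - l)" using lr by (intro mult_right_mono) auto
        then show "\<tau> \<le> r - l" unfolding \<tau>_def using pos by (subst divide_le_eq) (auto simp: mult_ac)
        show "(C + 1) * \<alpha> * \<tau> = \<beta> * (r - l)" using pos by (simp add: \<tau>_def)
      qed
      \<comment> \<open>If both ends are clipped, the interval is all of \<open>{l'..r'}\<close>, of
        length at least \<open>r - l\<close>; otherwise one full half of length \<tau>
        remains.\<close>
      define lo where "lo = max l' (x0 - \<tau>)"
      define hi where "hi = min r' (x0 + \<tau>)"
      have x0: "l' \<le> x0" "x0 \<le> r'" "b' \<le> y0 - m' * x0" "y0 - m' * x0 \<le> t'" using z0(2) by (auto simp: parallelogram_def)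
      have len: "\<tau> \<le> hi - lo" using x0 \<tau> L unfolding lo_def hi_def by (auto simp: max_def min_def)
      have mn': "\<bar>m' - n\<bar> \<le> (C + 1) * \<alpha>" using \<beta>\<alpha> by (simp add: \<alpha>_def \<beta>_def algebra_simps)
      have "parallelogram m' lo hi b' t' \<subseteq> ?D \<inter> ?R"
      proof (rule subsetI, clarify)
        fix x y assume xy: "(x, y) \<in> parallelogram m' lo hi b' t'"
        then have R: "(x, y) \<in> ?R" and x: "\<bar>x - x0\<bar> \<le> \<tau>" by (auto simp: parallelogram_def lo_def hi_def)
        have "(x, y) \<in> ?D"
        proof (rule widen_mem[OF lr z0(1)])
          show "\<bar>x - x0\<bar> \<le> r - l" using x \<tau> by simp
          have "\<bar>(m' - n) * (x - x0)\<bar> \<le> (C + 1) * \<alpha> * \<tau>"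
            unfolding abs_mult using mn' x by (intro mult_mono) auto
          then have a: "\<bar>(m' - n) * (x - x0)\<bar> \<le> H" using \<tau> lr by (simp add: H_def \<beta>_def)
          have "\<bar>(y - m' * x) - (y0 - m' * x0)\<bar> \<le> t' - b'" using R x0 by (auto simp: parallelogram_def)
          moreover have "(y - n * x) - (y0 - n * x0) = (y - m' * x) - (y0 - m' * x0) + (m' - n) * (x - x0)"
            by (simp add: algebra_simps)
          ultimately show "\<bar>y - n * x - (y0 - n * x0)\<bar> \<le> 2 * (t - b + \<bar>m - n\<bar> * (r - l))"
            using a 4(3) unfolding H_def[symmetric] by linarith
        qed
        then show "(x, y) \<in> ?D \<inter> ?R" using R by simp
      qed
      then have "measure lborel (parallelogram m' lo hi b' t') \<le> ?y"
        using fm len \<tau> lr' by (intro measure_mono_fmeasurable) (auto intro!: fmeasurableD measure_parallelogram simp del: sets_lborel)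
      then have y: "\<tau> * (t' - b') \<le> ?y"
      proof -
        assume "measure lborel (parallelogram m' lo hi b' t') \<le> ?y"
        then have "(hi - lo) * (t' - b') \<le> ?y" using len \<tau> lr' by (subst (asm) measure_parallelogram) auto
        moreover have "\<tau> * (t' - b') \<le> (hi - lo) * (t' - b')" using lr' by (intro mult_right_mono len) simp
        ultimately show ?thesis by linarith
      qed
      \<comment> \<open>The small intersection of transversal strips meets the lower bound
        \<open>\<tau> * (t' - b')\<close> for the enlarged one; the unknown height
        \<open>t' - b'\<close> cancels in the comparison.\<close>
      have "?x \<le> 2 * (t - b) * (t' - b') / \<alpha>"
        unfolding \<alpha>_def using lr lr' pos by (intro measure_strips_Int_le) (auto simp: \<alpha>_def)
      then have "?x * H \<le> 2 * (t - b) * (t' - b') / \<alpha> * H" using H0 by (intro mult_right_mono) auto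
      also have "\<dots> \<le> 2 * (t - b) * (t' - b') / \<alpha> * (2 * (\<beta> * (r - l)))"
      proof (intro mult_left_mono)
        show "H \<le> 2 * (\<beta> * (r - l))" unfolding H_def \<beta>_def using 4(1) by linarith
        show "0 \<le> 2 * (t - b) * (t' - b') / \<alpha>" using lr lr' pos by simp
      qed
      also have "\<dots> = 4 * (C + 1) * (\<tau> * (t' - b')) * (t - b)"
        unfolding \<tau>(3)[symmetric] using pos by (simp, simp add: algebra_simps)
      also have "\<dots> \<le> 4 * (C + 1) * ?y * (t - b)"
        using y C lr by (intro mult_right_mono mult_left_mono) auto
      finally show ?thesis .
    qed
  qed
  have D: "measure lborel ?D \<le> 21 * (r - l) * H" "0 < measure lborel ?D"
    using measure_widen_le[OF lr] by (auto simp: H_def)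
  have "?x * measure lborel ?D \<le> ?x * (21 * (r - l) * H)" using D by (intro mult_left_mono) auto
  also have "\<dots> = 21 * (r - l) * (?x * H)" by simp
  also have "\<dots> \<le> 21 * (r - l) * (4 * (C + 1) * ?y * (t - b))" using key lr by (intro mult_left_mono) auto
  also have "\<dots> = 84 * (C + 1) * ?y * measure lborel ?P" using lr by (simp add: measure_parallelogram, simp add: algebra_simps)
  finally have *: "?x * measure lborel ?D \<le> 84 * (C + 1) * ?y * measure lborel ?P" .
  have P: "0 < measure lborel ?P" "0 < measure lborel ?R" using lr lr' by (auto simp: measure_parallelogram)
  have "?x / measure lborel ?P \<le> 84 * (C + 1) * ?y / measure lborel ?D"
    using * P D by (simp only: pos_divide_le_eq pos_le_divide_eq times_divide_eq_left)
  then have "?x / measure lborel ?P / measure lborel ?R \<le> 84 * (C + 1) * ?y / measure lborel ?D / measure lborel ?R"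
    using P by (intro divide_right_mono) auto
  then show ?thesis by (simp add: overlap_def)
qed

subsection \<open>Almost orthogonality\<close>

text \<open>\<open>p\<close> labels the pieces, and \<open>e1\<close>, \<open>e2\<close> are two
  candidates for the replacing slope, such as the end points of a gap. Cauchy-Schwarz bounds the
  off-diagonal sum by the form of the replacements, which is controlled by \<open>A0\<close>, and by
  the form \<open>Q\<close> under estimation, which is absorbed. The added constant is
  \<open>4 * 84 * (C + 1) * A0\<close>.\<close>

lemma dual_bounded_almost_orthogonal:
  fixes \<sigma> e1 e2 :: "'d \<Rightarrow> real" and p :: "'d \<Rightarrow> 'l"
  assumes A0: "0 < A0" "dual_bounded lborel (parallelograms \<Sigma>0) A0"
    and S: "\<And>l. dual_bounded lborel (parallelograms (\<sigma> ` {u\<in>X. p u = l})) S"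
    and e: "\<And>u. u \<in> X \<Longrightarrow> e1 u \<in> \<Sigma>0 \<and> e2 u \<in> \<Sigma>0"
    and C: "0 \<le> C"
    and sep: "\<And>u v. u \<in> X \<Longrightarrow> v \<in> X \<Longrightarrow> p u \<noteq> p v \<Longrightarrow>
       \<bar>\<sigma> u - e1 u\<bar> \<le> C * \<bar>\<sigma> u - \<sigma> v\<bar> \<or> \<bar>\<sigma> u - e2 u\<bar> \<le> C * \<bar>\<sigma> u - \<sigma> v\<bar>"
  shows "dual_bounded lborel (parallelograms (\<sigma> ` X)) (S + 336 * (C + 1) * A0)"
  unfolding dual_bounded_def
proof (intro conjI allI impI)
  have S0: "0 \<le> S" using S by (auto simp: dual_bounded_def)
  define K where "K = 84 * (C + 1)"
  have K: "0 < K" using C by (simp add: K_def)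
  \<comment> \<open>Chosen so that the last inequality closes: with \<open>k = K * A0\<close> one
    has \<open>\<rho>\<^sup>2 (\<rho> - 2 k) - (S\<^sup>2 \<rho> + 2 k \<rho>\<^sup>2) = 4 k S
    \<rho>\<close>, which is nonnegative.\<close>
  define \<rho> where "\<rho> = S + 4 * K * A0"
  have \<rho>_eq: "S + 336 * (C + 1) * A0 = \<rho>" by (simp add: \<rho>_def K_def)
  have k: "0 < K * A0" using K A0 by simp
  have \<rho>: "0 < \<rho>" "S \<le> \<rho>" using S0 k unfolding \<rho>_def by linarith+
  show "0 \<le> S + 336 * (C + 1) * A0" unfolding \<rho>_eq using \<rho> by simp
  fix J P E a assume ad: "admissible lborel (parallelograms (\<sigma> ` X)) J P E a"
  have fin: "finite J" using ad by (simp add: admissible_def)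
  have "\<forall>i\<in>J. \<exists>u l r b t. P i = parallelogram (\<sigma> u) l r b t \<and> u \<in> X \<and> l < r \<and> b < t"
    using ad by (fastforce simp: admissible_def parallelograms_def)
  then obtain u l r b t where P: "\<And>i. i \<in> J \<Longrightarrow> P i = parallelogram (\<sigma> (u i)) (l i) (r i) (b i) (t i)"
      and uX: "\<And>i. i \<in> J \<Longrightarrow> u i \<in> X" and lr: "\<And>i. i \<in> J \<Longrightarrow> l i < r i" "\<And>i. i \<in> J \<Longrightarrow> b i < t i"
    unfolding bchoice_iff by blast
  define D1 where "D1 i = widen (\<sigma> (u i)) (e1 (u i)) (l i) (r i) (b i) (t i)" for i
  define D2 where "D2 i = widen (\<sigma> (u i)) (e2 (u i)) (l i) (r i) (b i) (t i)" for i
  let ?c = "\<lambda>i. a i * measure lborel (E i)"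
  let ?G = "\<lambda>J. \<Sum>i\<in>J. (a i)\<^sup>2 * measure lborel (E i)"
  define Q where "Q = overlap_form lborel J P ?c"
  have c: "0 \<le> ?c i" if "i \<in> J" for i using ad that by (auto simp: admissible_def)
  have G0: "0 \<le> ?G J" by (intro sum_nonneg) auto
  have D: "D1 i \<in> parallelograms \<Sigma>0" "D2 i \<in> parallelograms \<Sigma>0" "P i \<subseteq> D1 i" "P i \<subseteq> D2 i" if "i \<in> J" for i
    using lr[OF that] e[OF uX[OF that]] P[OF that]
    by (simp_all add: D1_def D2_def widen_in_parallelograms parallelogram_subset_widen)
  have adD: "admissible lborel (parallelograms \<Sigma>0) J D1 E a" "admissible lborel (parallelograms \<Sigma>0) J D2 E a"
    using ad D unfolding admissible_def by (blast intro: order_trans)+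
  have fm: "P i \<in> fmeasurable lborel" "D1 i \<in> fmeasurable lborel" "D2 i \<in> fmeasurable lborel" if "i \<in> J" for i
    using D[OF that] parallelograms_fmeasurable[of \<Sigma>0] parallelograms_fmeasurable[of "\<sigma> ` X"] ad that by (auto simp: admissible_def)
  have half: "overlap lborel (P i) (P j) \<le> K * (overlap lborel (D1 i) (P j) + overlap lborel (D2 i) (P j))"
    if ij: "i \<in> J" "j \<in> J" and pij: "p (u i) \<noteq> p (u j)" and L: "r i - l i \<le> r j - l j" for i j
  proof -
    have "overlap lborel (P i) (P j) \<le> K * overlap lborel (D1 i) (P j) \<or> overlap lborel (P i) (P j) \<le> K * overlap lborel (D2 i) (P j)"
      using sep[OF uX[OF ij(1)] uX[OF ij(2)] pij] unfolding D1_def D2_def K_def P[OF ij(1)] P[OF ij(2)]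
      using overlap_le_overlap_widen[OF lr(1)[OF ij(1)] lr(2)[OF ij(1)] lr(1)[OF ij(2)] lr(2)[OF ij(2)] L C] by blast
    moreover have "0 \<le> K * overlap lborel (D1 i) (P j)" "0 \<le> K * overlap lborel (D2 i) (P j)" using K by simp_all
    ultimately show ?thesis unfolding distrib_left by linarith
  qed
  define Z where "Z i j = overlap lborel (D1 i) (P j) + overlap lborel (D2 i) (P j)" for i j
  have Z0: "0 \<le> Z i j" for i j by (simp add: Z_def)
  \<comment> \<open>Whichever set is shorter gets replaced, hence both orders of the pair.
    \<open>Z\<close> adds up both candidates, since \<open>sep\<close> leaves open which of them
    serves.\<close>
  have overlapZ: "overlap lborel (P i) (P j) \<le> (if p (u i) = p (u j) then overlap lborel (P i) (P j) else 0) + K * (Z i j + Z j i)"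
    if ij: "i \<in> J" "j \<in> J" for i j
  proof (cases "p (u i) = p (u j)")
    case True
    then show ?thesis using K Z0 by simp
  next
    case False
    have nn: "0 \<le> K * Z i j" "0 \<le> K * Z j i" using K Z0 by simp_all
    show ?thesis
    proof (cases "r i - l i \<le> r j - l j")
      case True
      then show ?thesis using half[OF ij False] False nn unfolding Z_def[symmetric] distrib_left by simp
    next
      case F: False
      then show ?thesis using half[OF ij(2,1)] False nn overlap_sym[of lborel "P i" "P j"]
        unfolding Z_def[symmetric] distrib_left by simp
    qed
  qed
  define T where "T = (\<Sum>i\<in>J. \<Sum>j\<in>J. ?c i * ?c j * Z i j)"
  define W where "W = (\<Sum>i\<in>J. \<Sum>j\<in>J. ?c i * ?c j * (if p (u i) = p (u j) then overlap lborel (P i) (P j) else 0))"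
  have Tsw: "(\<Sum>i\<in>J. \<Sum>j\<in>J. ?c i * ?c j * Z j i) = T"
    unfolding T_def by (subst sum.swap) (simp add: mult.commute)
  have "Q \<le> (\<Sum>i\<in>J. \<Sum>j\<in>J. ?c i * ?c j * ((if p (u i) = p (u j) then overlap lborel (P i) (P j) else 0) + K * (Z i j + Z j i)))"
    unfolding Q_def overlap_form_def using c by (intro sum_mono mult_left_mono overlapZ) auto
  also have "\<dots> = (\<Sum>i\<in>J. \<Sum>j\<in>J. ?c i * ?c j * (if p (u i) = p (u j) then overlap lborel (P i) (P j) else 0)
       + K * (?c i * ?c j * Z i j) + K * (?c i * ?c j * Z j i))"
    by (intro sum.cong refl) (simp only: distrib_left mult_ac add_ac)
  also have "\<dots> = W + K * T + K * (\<Sum>i\<in>J. \<Sum>j\<in>J. ?c i * ?c j * Z j i)"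
    by (simp only: sum.distrib W_def T_def sum_distrib_left)
  finally have Q1: "Q \<le> W + 2 * (K * T)" unfolding Tsw by simp
  \<comment> \<open>Pairs with equal labels form diagonal blocks. The blocks partition
    \<open>J\<close>, so the bounds of the pieces add up without a loss depending on their
    number.\<close>
  have W: "W \<le> S\<^sup>2 * ?G J"
  proof -
    define J' where "J' l = {i\<in>J. p (u i) = l}" for l
    define h where "h i = (\<Sum>j\<in>J' (p (u i)). ?c i * ?c j * overlap lborel (P i) (P j))" for i
    have "W = (\<Sum>i\<in>J. h i)"
      unfolding W_def h_def J'_def
      by (rule sum.cong[OF refl], subst sum.inter_filter[OF fin], rule sum.cong) auto
    also have "\<dots> = (\<Sum>l\<in>(\<lambda>i. p (u i)) ` J. \<Sum>i\<in>J' l. h i)"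
      unfolding J'_def using fin by (intro sum.group[symmetric]) auto
    also have "\<dots> = (\<Sum>l\<in>(\<lambda>i. p (u i)) ` J. overlap_form lborel (J' l) P ?c)"
      unfolding overlap_form_def h_def by (intro sum.cong refl) (auto simp: J'_def)
    also have "\<dots> \<le> (\<Sum>l\<in>(\<lambda>i. p (u i)) ` J. S\<^sup>2 * ?G (J' l))"
    proof (intro sum_mono)
      fix l'
      have "admissible lborel (parallelograms (\<sigma> ` {u\<in>X. p u = l'})) (J' l') P E a"
        using ad by (rule admissible_subset) (use P uX lr in \<open>auto simp: J'_def intro!: parsI\<close>)
      then show "overlap_form lborel (J' l') P ?c \<le> S\<^sup>2 * ?G (J' l')" by (rule dual_boundedD[OF S])
    qed
    also have "\<dots> = S\<^sup>2 * (\<Sum>l\<in>(\<lambda>i. p (u i)) ` J. ?G (J' l))" by (simp only: sum_distrib_left)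
    also have "(\<Sum>l\<in>(\<lambda>i. p (u i)) ` J. ?G (J' l)) = ?G J"
      unfolding J'_def using fin by (intro sum.group) auto
    finally show ?thesis .
  qed
  \<comment> \<open>With this weight the two terms of Cauchy-Schwarz agree in the critical case
    \<open>Q = \<rho>\<^sup>2 * ?G J\<close>.\<close>
  define s where "s = \<rho> / A0"
  have s: "0 < s" using \<rho> A0 by (simp add: s_def)
  have "2 * T = 2 * (\<Sum>i\<in>J. \<Sum>j\<in>J. ?c i * ?c j * overlap lborel (D1 i) (P j))
      + 2 * (\<Sum>i\<in>J. \<Sum>j\<in>J. ?c i * ?c j * overlap lborel (D2 i) (P j))"
    unfolding T_def Z_def by (simp only: distrib_left sum.distrib)
  also have "\<dots> \<le> (s * overlap_form lborel J D1 ?c + Q / s) + (s * overlap_form lborel J D2 ?c + Q / s)"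
    unfolding Q_def by (intro add_mono overlap_Cauchy_Schwarz fin fm s)
  also have "\<dots> \<le> (s * (A0\<^sup>2 * ?G J) + Q / s) + (s * (A0\<^sup>2 * ?G J) + Q / s)"
    using dual_boundedD[OF A0(2) adD(1)] dual_boundedD[OF A0(2) adD(2)] s
    by (intro add_mono mult_left_mono order_refl) auto
  also have "\<dots> = 2 * (\<rho> * A0 * ?G J + A0 * Q / \<rho>)"
    using A0 \<rho> by (simp add: s_def power2_eq_square)
  finally have "T \<le> \<rho> * A0 * ?G J + A0 * Q / \<rho>" by simp
  then have "K * T \<le> K * (\<rho> * A0 * ?G J + A0 * Q / \<rho>)" using K by (intro mult_left_mono) auto
  then have "Q \<le> S\<^sup>2 * ?G J + 2 * (K * (\<rho> * A0 * ?G J + A0 * Q / \<rho>))" using Q1 W by linarith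
  then have "Q * \<rho> \<le> (S\<^sup>2 * ?G J + 2 * (K * (\<rho> * A0 * ?G J + A0 * Q / \<rho>))) * \<rho>" using \<rho> by (intro mult_right_mono) auto
  also have "\<dots> = (S\<^sup>2 * \<rho> + 2 * (K * A0) * \<rho>\<^sup>2) * ?G J + 2 * (K * A0) * Q"
    using \<rho> by (simp add: field_simps power2_eq_square)
  finally have "Q * (\<rho> - 2 * (K * A0)) \<le> (S\<^sup>2 * \<rho> + 2 * (K * A0) * \<rho>\<^sup>2) * ?G J" by (simp add: algebra_simps)
  also have "\<dots> \<le> (\<rho>\<^sup>2 * (\<rho> - 2 * (K * A0))) * ?G J"
  proof (intro mult_right_mono G0)
    have "\<rho>\<^sup>2 * (\<rho> - 2 * (K * A0)) - (S\<^sup>2 * \<rho> + 2 * (K * A0) * \<rho>\<^sup>2) = \<rho> * (4 * (S * (K * A0)))"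
      by (simp add: \<rho>_def power2_eq_square algebra_simps)
    moreover have "0 \<le> \<rho> * (4 * (S * (K * A0)))" using \<rho> S0 k by simp
    ultimately show "S\<^sup>2 * \<rho> + 2 * (K * A0) * \<rho>\<^sup>2 \<le> \<rho>\<^sup>2 * (\<rho> - 2 * (K * A0))" by linarith
  qed
  finally have "Q * (\<rho> - 2 * (K * A0)) \<le> (\<rho>\<^sup>2 * ?G J) * (\<rho> - 2 * (K * A0))" by (simp add: mult_ac)
  moreover have "0 < \<rho> - 2 * (K * A0)" using S0 k unfolding \<rho>_def by linarith
  ultimately have "Q \<le> \<rho>\<^sup>2 * ?G J" by (rule mult_right_le_imp_le)
  then show "overlap_form lborel J P ?c \<le> (S + 336 * (C + 1) * A0)\<^sup>2 * ?G J"
    unfolding \<rho>_eq Q_def .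
qed

subsection \<open>Arcs and gaps of the unit circle\<close>

lemma direction_nth [simp]: "direction \<theta> $ 1 = cos \<theta>" "direction \<theta> $ 2 = sin \<theta>"
  by (simp_all add: direction_def)

lemma vec2_eq_iff: "x = y \<longleftrightarrow> x $ 1 = y $ 1 \<and> x $ 2 = y $ 2" for x y :: "real^2"
  by (simp add: vec_eq_iff forall_2)

lemma inner_vec2: "x \<bullet> y = x $ 1 * y $ 1 + x $ 2 * y $ 2" for x y :: "real^2"
  by (simp add: inner_vec_def sum_2)

lemma norm_vec2_square: "(norm x)\<^sup>2 = (x $ 1)\<^sup>2 + (x $ 2)\<^sup>2" for x :: "real^2"
  unfolding power2_norm_eq_inner inner_vec2 by (simp add: power2_eq_square)

lemma norm_vec2_eq_1_iff: "norm x = 1 \<longleftrightarrow> (x $ 1)\<^sup>2 + (x $ 2)\<^sup>2 = 1" for x :: "real^2"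
  unfolding norm_vec2_square[symmetric] by (simp add: power2_eq_1_iff) (smt (verit) norm_ge_zero)

lemma norm_direction [simp]: "norm (direction \<theta>) = 1"
  by (simp add: norm_vec2_eq_1_iff)

lemma direction_inner: "direction s \<bullet> direction t = cos (s - t)"
  by (simp add: inner_vec2 cos_diff)

lemma direction_add_2pi [simp]: "direction (\<theta> + 2 * pi) = direction \<theta>"
  by (simp add: vec2_eq_iff)

lemma direction_eq_shift: "direction s = direction t \<Longrightarrow> direction (s + z) = direction (t + z)"
  by (simp add: vec2_eq_iff cos_add sin_add)

lemma direction_add_2pi_int: "direction (\<theta> + 2 * pi * of_int k) = direction \<theta>"
  using cos_int_2pin[of k] sin_int_2pin[of k] by (simp add: vec2_eq_iff cos_add sin_add)

lemma obtain_direction: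
  fixes v :: "real^2" assumes "norm v = 1"
  obtains s where "\<alpha> \<le> s" "s < \<alpha> + 2 * pi" "v = direction s"
proof -
  have "(v $ 1)\<^sup>2 + (v $ 2)\<^sup>2 = 1" using assms by (simp add: norm_vec2_eq_1_iff)
  then obtain \<theta> where "v $ 1 = cos \<theta>" "v $ 2 = sin \<theta>" using sincos_total_2pi by metis
  then have \<theta>: "v = direction \<theta>" by (simp add: vec2_eq_iff)
  define k where "k = \<lfloor>(\<theta> - \<alpha>) / (2 * pi)\<rfloor>"
  define s where "s = \<theta> + 2 * pi * of_int (- k)"
  have "of_int k \<le> (\<theta> - \<alpha>) / (2 * pi)" "(\<theta> - \<alpha>) / (2 * pi) < of_int k + 1" unfolding k_def by linarith+
  then have "of_int k * (2 * pi) \<le> \<theta> - \<alpha>" "\<theta> - \<alpha> < (of_int k + 1) * (2 * pi)"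
    by (simp_all add: pos_le_divide_eq pos_divide_less_eq)
  then have "\<alpha> \<le> s" "s < \<alpha> + 2 * pi" by (simp_all add: s_def algebra_simps)
  moreover have "v = direction s" using \<theta> direction_add_2pi_int[of \<theta> "- k"] by (simp only: s_def)
  ultimately show ?thesis using that by blast
qed

lemma dist_direction: "0 \<le> y \<Longrightarrow> y \<le> 2 * pi \<Longrightarrow> dist (direction t) (direction (t + y)) = 2 * sin (y / 2)"
proof -
  assume y: "0 \<le> y" "y \<le> 2 * pi"
  have "(dist (direction t) (direction (t + y)))\<^sup>2 = 2 - 2 * cos y"
    unfolding dist_norm power2_norm_eq_inner
    by (simp add: inner_diff_left inner_diff_right direction_inner)
  also have "\<dots> = (2 * sin (y / 2))\<^sup>2"
    using cos_double_sin[of "y / 2"] by (simp add: power_mult_distrib)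
  finally have sq: "(dist (direction t) (direction (t + y)))\<^sup>2 = (2 * sin (y / 2))\<^sup>2" .
  show ?thesis by (rule power2_eq_imp_eq[OF sq]) (use y in \<open>auto intro!: sin_ge_zero\<close>)
qed

text \<open>The sine rises up to \<open>pi / 2\<close> and falls afterwards, so on a subinterval its
  minimum is at an end.\<close>

lemma sin_ge_min_endpoints:
  assumes "0 \<le> x" "x \<le> y" "y \<le> z" "z \<le> pi"
  shows "sin x \<le> sin y \<or> sin z \<le> sin y"
proof (cases "y \<le> pi / 2")
  case True
  then have "sin x \<le> sin y" using assms pi_gt_zero by (intro sin_monotone_2pi_le) linarith+
  then show ?thesis ..
next
  case False
  then have "sin (pi - z) \<le> sin (pi - y)" using assms pi_gt_zero by (intro sin_monotone_2pi_le) linarith+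
  then show ?thesis by simp
qed

lemma dist_direction_ge_min_endpoints:
  assumes "0 \<le> x" "x \<le> y" "y \<le> z" "z \<le> 2 * pi"
  shows "dist (direction t) (direction (t + x)) \<le> dist (direction t) (direction (t + y)) \<or>
         dist (direction t) (direction (t + z)) \<le> dist (direction t) (direction (t + y))"
proof -
  have d: "dist (direction t) (direction (t + x)) = 2 * sin (x / 2)" "dist (direction t) (direction (t + y)) = 2 * sin (y / 2)"
    "dist (direction t) (direction (t + z)) = 2 * sin (z / 2)"
    using assms by (intro dist_direction; linarith)+
  have "sin (x / 2) \<le> sin (y / 2) \<or> sin (z / 2) \<le> sin (y / 2)"
    using assms by (intro sin_ge_min_endpoints) linarith+
  then show ?thesis unfolding d by linarith
qed

lemma arc_interiorE:
  assumes "arc_interior A a b"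
  obtains \<alpha> \<beta> where "\<alpha> < \<beta>" "\<beta> < \<alpha> + 2 * pi" "{a, b} = {direction \<alpha>, direction \<beta>}"
    "A = direction ` {\<alpha><..<\<beta>}"
  using assms unfolding arc_interior_def by (elim exE conjE) (rule that)

text \<open>Seen from \<open>u\<close>, the complement of the arc is an interval of angles bounded
  by the two end points, and over such an interval the chord length is smallest at an end.\<close>

lemma dist_arc_endpoint_le:
  assumes A: "arc_interior A a b" and u: "u \<in> A" and v: "norm v = 1" "v \<notin> A"
  shows "dist u a \<le> dist u v \<or> dist u b \<le> dist u v"
proof -
  obtain \<alpha> \<beta> where ab: "\<alpha> < \<beta>" "\<beta> < \<alpha> + 2 * pi" "{a, b} = {direction \<alpha>, direction \<beta>}"
      and A: "A = direction ` {\<alpha><..<\<beta>}" by (rule arc_interiorE[OF A])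
  obtain t where t: "\<alpha> < t" "t < \<beta>" "u = direction t" using u unfolding A by (auto simp only: image_iff greaterThanLessThan_iff)
  obtain s0 where s0: "\<alpha> \<le> s0" "s0 < \<alpha> + 2 * pi" "v = direction s0" by (rule obtain_direction[OF v(1), of \<alpha>])
  \<comment> \<open>The complement is parametrized by \<open>{\<beta>..\<alpha> + 2 * pi}\<close>,
    so the angle \<alpha> gives way to its other representative.\<close>
  define s where "s = (if s0 = \<alpha> then \<alpha> + 2 * pi else s0)"
  have s: "\<beta> \<le> s" "s \<le> \<alpha> + 2 * pi" "v = direction s"
  proof -
    have "direction s0 \<notin> direction ` {\<alpha><..<\<beta>}" using v(2) A s0 by simp
    then have "s0 \<notin> {\<alpha><..<\<beta>}" by blast
    then show "\<beta> \<le> s" "s \<le> \<alpha> + 2 * pi" "v = direction s" using s0 ab by (auto simp: s_def)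
  qed
  have "dist u (direction \<beta>) \<le> dist u v \<or> dist u (direction (\<alpha> + 2 * pi)) \<le> dist u v"
    using dist_direction_ge_min_endpoints[of "\<beta> - t" "s - t" "\<alpha> + 2 * pi - t" t] s t ab by simp
  then have "dist u (direction \<beta>) \<le> dist u v \<or> dist u (direction \<alpha>) \<le> dist u v" by simp
  moreover have "direction \<alpha> = a \<or> direction \<alpha> = b" "direction \<beta> = a \<or> direction \<beta> = b" using ab(3) by blast+
  ultimately show ?thesis by (elim disjE) simp_all
qed

text \<open>In angles counted from \<open>t\<close>, a neighbor is the first or the last point of
  \<Omega> on the way round the circle. This turns statements on neighbors into order
  arguments.\<close>

lemma neighboring_direction:
  assumes "neighboring \<Omega> (direction t) x"
  obtains y where "0 < y" "y < 2 * pi" "x = direction (t + y)"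
    "(\<forall>z. 0 < z \<and> z < y \<longrightarrow> direction (t + z) \<notin> \<Omega>) \<or> (\<forall>z. y < z \<and> z < 2 * pi \<longrightarrow> direction (t + z) \<notin> \<Omega>)"
proof -
  obtain A where A: "arc_interior A (direction t) x" "A \<inter> \<Omega> = {}" using assms by (auto simp: neighboring_def)
  obtain \<alpha> \<beta> where ab: "\<alpha> < \<beta>" "\<beta> < \<alpha> + 2 * pi" "{direction t, x} = {direction \<alpha>, direction \<beta>}"
      and Aeq: "A = direction ` {\<alpha><..<\<beta>}" by (rule arc_interiorE[OF A(1)])
  have free: "direction s \<notin> \<Omega>" if "\<alpha> < s" "s < \<beta>" for s
  proof -
    have "direction s \<in> A" unfolding Aeq using that by simp
    then show ?thesis using A(2) by blast
  qed
  consider "direction t = direction \<alpha>" "x = direction \<beta>" | "direction t = direction \<beta>" "x = direction \<alpha>"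
    using ab(3) unfolding doubleton_eq_iff by blast
  then show ?thesis
  proof cases
    case 1
    note sh = direction_eq_shift[OF 1(1)]
    show ?thesis
    proof (rule that[of "\<beta> - \<alpha>"])
      show "x = direction (t + (\<beta> - \<alpha>))" using sh[of "\<beta> - \<alpha>"] 1 by simp
      show "(\<forall>z. 0 < z \<and> z < \<beta> - \<alpha> \<longrightarrow> direction (t + z) \<notin> \<Omega>) \<or> (\<forall>z. \<beta> - \<alpha> < z \<and> z < 2 * pi \<longrightarrow> direction (t + z) \<notin> \<Omega>)"
        using free sh by simp
    qed (use ab in auto)
  next
    case 2
    note sh = direction_eq_shift[OF 2(1)]
    show ?thesis
    proof (rule that[of "2 * pi - (\<beta> - \<alpha>)"])
      have "direction (t + (2 * pi - (\<beta> - \<alpha>))) = direction (\<alpha> + 2 * pi)" unfolding sh by (simp add: algebra_simps)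
      then show "x = direction (t + (2 * pi - (\<beta> - \<alpha>)))" using 2 by simp
      have "direction (t + z) \<notin> \<Omega>" if "2 * pi - (\<beta> - \<alpha>) < z" "z < 2 * pi" for z
        using free[of "\<beta> + z - 2 * pi"] that direction_add_2pi[of "\<beta> + z - 2 * pi"] unfolding sh by simp
      then show "(\<forall>z. 0 < z \<and> z < 2 * pi - (\<beta> - \<alpha>) \<longrightarrow> direction (t + z) \<notin> \<Omega>) \<or>
          (\<forall>z. 2 * pi - (\<beta> - \<alpha>) < z \<and> z < 2 * pi \<longrightarrow> direction (t + z) \<notin> \<Omega>)" by blast
    qed (use ab in auto)
  qed
qed

text \<open>Two distinct neighbors are the first and the last point on the way round from
  \<open>v\<close>. Every other point lies between them in angle, where the chord length is at least
  the smaller of its end values.\<close>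

lemma dist_two_neighbors_le:
  assumes n1: "neighboring \<Omega> v v1" and n2: "neighboring \<Omega> v v2" and ne: "v1 \<noteq> v2"
    and v: "norm v = 1" and s: "s \<in> \<Omega>" "norm s = 1" "s \<noteq> v"
  shows "dist v v1 \<le> dist v s \<or> dist v v2 \<le> dist v s"
proof -
  obtain t where t: "v = direction t" by (rule obtain_direction[OF v, of 0])
  obtain y1 where y1: "0 < y1" "y1 < 2 * pi" "v1 = direction (t + y1)"
    "(\<forall>z. 0 < z \<and> z < y1 \<longrightarrow> direction (t + z) \<notin> \<Omega>) \<or> (\<forall>z. y1 < z \<and> z < 2 * pi \<longrightarrow> direction (t + z) \<notin> \<Omega>)"
    by (rule neighboring_direction[OF n1[unfolded t]])
  obtain y2 where y2: "0 < y2" "y2 < 2 * pi" "v2 = direction (t + y2)"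
    "(\<forall>z. 0 < z \<and> z < y2 \<longrightarrow> direction (t + z) \<notin> \<Omega>) \<or> (\<forall>z. y2 < z \<and> z < 2 * pi \<longrightarrow> direction (t + z) \<notin> \<Omega>)"
    by (rule neighboring_direction[OF n2[unfolded t]])
  obtain s0 where s0: "t \<le> s0" "s0 < t + 2 * pi" "s = direction s0" by (rule obtain_direction[OF s(2), of t])
  define y where "y = s0 - t"
  have y: "0 < y" "y < 2 * pi" "s = direction (t + y)" using s0 s(3) t by (auto simp: y_def less_le)
  have mem: "direction (t + y1) \<in> \<Omega>" "direction (t + y2) \<in> \<Omega>" "direction (t + y) \<in> \<Omega>"
    using n1 n2 y1 y2 y s by (auto simp: neighboring_def)
  have "y1 \<noteq> y2" using y1 y2 ne by auto
  then have "(y1 \<le> y \<and> y \<le> y2) \<or> (y2 \<le> y \<and> y \<le> y1)"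
  proof -
    have c1: "y1 \<le> y \<and> y1 \<le> y2 \<or> y \<le> y1 \<and> y2 \<le> y1"
      using y1(4)
    proof
      assume "\<forall>z. 0 < z \<and> z < y1 \<longrightarrow> direction (t + z) \<notin> \<Omega>"
      then have "\<not> y < y1" "\<not> y2 < y1" using mem y y2 by blast+
      then show ?thesis by linarith
    next
      assume "\<forall>z. y1 < z \<and> z < 2 * pi \<longrightarrow> direction (t + z) \<notin> \<Omega>"
      then have "\<not> y1 < y" "\<not> y1 < y2" using mem y y2 by blast+
      then show ?thesis by linarith
    qed
    have c2: "y2 \<le> y \<and> y2 \<le> y1 \<or> y \<le> y2 \<and> y1 \<le> y2"
      using y2(4)
    proof
      assume "\<forall>z. 0 < z \<and> z < y2 \<longrightarrow> direction (t + z) \<notin> \<Omega>"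
      then have "\<not> y < y2" "\<not> y1 < y2" using mem y y1 by blast+
      then show ?thesis by linarith
    next
      assume "\<forall>z. y2 < z \<and> z < 2 * pi \<longrightarrow> direction (t + z) \<notin> \<Omega>"
      then have "\<not> y2 < y" "\<not> y2 < y1" using mem y y1 by blast+
      then show ?thesis by linarith
    qed
    show ?thesis using c1 c2 \<open>y1 \<noteq> y2\<close> by linarith
  qed
  then show ?thesis
    using dist_direction_ge_min_endpoints[of y1 y y2 t] dist_direction_ge_min_endpoints[of y2 y y1 t] y1 y2 y t by auto
qed

text \<open>An arc is cut out of the circle by a half-plane: \<open>n\<close> is the direction of
  its midpoint and \<open>k\<close> the cosine of half its angle, negative beyond a half circle. The
  boundary line meets the circle in just the end points, so questions on arcs become questions on
  half-planes.\<close>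

lemma arc_interior_cap:
  assumes "arc_interior A a b"
  obtains n k where "A = {x. norm x = 1 \<and> n \<bullet> x > k}" "{x. norm x = 1 \<and> n \<bullet> x = k} = {a, b}"
proof -
  obtain \<alpha> \<beta> where ab: "\<alpha> < \<beta>" "\<beta> < \<alpha> + 2 * pi" "{a, b} = {direction \<alpha>, direction \<beta>}"
      and A: "A = direction ` {\<alpha><..<\<beta>}" by (rule arc_interiorE[OF assms])
  define \<mu> where "\<mu> = (\<alpha> + \<beta>) / 2"
  define h where "h = (\<beta> - \<alpha>) / 2"
  have h: "0 < h" "h < pi" "\<alpha> = \<mu> - h" "\<beta> = \<mu> + h"
  proof -
    show "0 < h" using ab(1) by (simp add: h_def)
    show "h < pi" using ab(2) by (simp add: h_def)
    show "\<alpha> = \<mu> - h" "\<beta> = \<mu> + h" by (simp_all add: \<mu>_def h_def field_simps)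
  qed
  have inner: "direction \<mu> \<bullet> direction s = cos \<bar>s - \<mu>\<bar>" for s
    using cos_minus[of "\<mu> - s"] by (simp add: direction_inner)
  have gt: "direction \<mu> \<bullet> direction s > cos h \<longleftrightarrow> \<bar>s - \<mu>\<bar> < h" if "\<bar>s - \<mu>\<bar> \<le> pi" for s
    unfolding inner by (rule cos_mono_less_eq) (use that h in linarith)+
  have eq: "direction \<mu> \<bullet> direction s = cos h \<longleftrightarrow> \<bar>s - \<mu>\<bar> = h" if "\<bar>s - \<mu>\<bar> \<le> pi" for s
    unfolding inner
  proof
    assume c: "cos \<bar>s - \<mu>\<bar> = cos h"
    show "\<bar>s - \<mu>\<bar> = h" by (rule cos_inj_pi[OF _ _ _ _ c]) (use that h in linarith)+
  qed simp
  have ang: "\<exists>s. \<bar>s - \<mu>\<bar> \<le> pi \<and> x = direction s" if x1: "norm x = 1" for x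
  proof -
    obtain s where "\<mu> - pi \<le> s" "s < \<mu> - pi + 2 * pi" "x = direction s" by (rule obtain_direction[OF x1, of "\<mu> - pi"])
    moreover from this have "\<bar>s - \<mu>\<bar> \<le> pi" by linarith
    ultimately show ?thesis by blast
  qed
  show ?thesis
  proof (rule that[of "cos h" "direction \<mu>"])
    show "A = {x. norm x = 1 \<and> direction \<mu> \<bullet> x > cos h}"
    proof (intro equalityI subsetI)
      fix x assume "x \<in> A"
      then obtain s where "\<alpha> < s" "s < \<beta>" "x = direction s" using A by auto
      moreover from this have "\<bar>s - \<mu>\<bar> < h" "\<bar>s - \<mu>\<bar> \<le> pi" using h by linarith+
      ultimately show "x \<in> {x. norm x = 1 \<and> direction \<mu> \<bullet> x > cos h}" using gt[of s] by simp
    next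
      fix x assume "x \<in> {x. norm x = 1 \<and> direction \<mu> \<bullet> x > cos h}"
      moreover from this obtain s where s: "\<bar>s - \<mu>\<bar> \<le> pi" "x = direction s" using ang by auto
      ultimately have "\<bar>s - \<mu>\<bar> < h" using gt[OF s(1)] by simp
      then have "\<alpha> < s" "s < \<beta>" using h by linarith+
      then show "x \<in> A" using A s by auto
    qed
    show "{x. norm x = 1 \<and> direction \<mu> \<bullet> x = cos h} = {a, b}"
      unfolding ab(3)
    proof (intro equalityI subsetI)
      fix x assume "x \<in> {x. norm x = 1 \<and> direction \<mu> \<bullet> x = cos h}"
      moreover from this obtain s where s: "\<bar>s - \<mu>\<bar> \<le> pi" "x = direction s" using ang by auto
      ultimately have "\<bar>s - \<mu>\<bar> = h" using eq[OF s(1)] by simp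
      then have "s = \<alpha> \<or> s = \<beta>" using h by linarith
      then show "x \<in> {direction \<alpha>, direction \<beta>}" using s by auto
    next
      fix x assume x: "x \<in> {direction \<alpha>, direction \<beta>}"
      have "\<bar>\<alpha> - \<mu>\<bar> = h" "\<bar>\<beta> - \<mu>\<bar> = h" "h \<le> pi" using h by linarith+
      then show "x \<in> {x. norm x = 1 \<and> direction \<mu> \<bullet> x = cos h}"
        using eq[of \<alpha>] eq[of \<beta>] x by auto
    qed
  qed
qed

section \<open>Topology of arcs, and gaps under refinement\<close>

lemma continuous_on_direction: "continuous_on S direction"
proof -
  have eq: "(\<lambda>\<theta>. cos \<theta> *\<^sub>R axis 1 1 + sin \<theta> *\<^sub>R axis 2 1) = direction"
    by (auto simp: fun_eq_iff vec2_eq_iff axis_def)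
  have "continuous_on S (\<lambda>\<theta>. cos \<theta> *\<^sub>R axis 1 1 + sin \<theta> *\<^sub>R axis 2 1 :: real^2)"
    by (intro continuous_intros)
  then show ?thesis unfolding eq .
qed

lemma arc_interior_topology:
  assumes "arc_interior A a b"
  shows "connected A" "A \<noteq> {}" "A \<subseteq> sphere 0 1" "a \<in> closure A" "b \<in> closure A" "norm a = 1" "norm b = 1"
proof -
  obtain \<alpha> \<beta> where ab: "\<alpha> < \<beta>" "\<beta> < \<alpha> + 2 * pi" "{a, b} = {direction \<alpha>, direction \<beta>}"
      and A: "A = direction ` {\<alpha><..<\<beta>}" by (rule arc_interiorE[OF assms])
  show "connected A" unfolding A by (intro connected_continuous_image continuous_on_direction) simp
  show "A \<noteq> {}" using ab A by simp
  show "A \<subseteq> sphere 0 1" using A by auto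
  have "direction ` closure {\<alpha><..<\<beta>} \<subseteq> closure A"
    unfolding A by (intro image_closure_subset continuous_on_direction closed_closure closure_subset)
  then have cl: "direction \<alpha> \<in> closure A" "direction \<beta> \<in> closure A" using ab by auto
  have "a \<in> {direction \<alpha>, direction \<beta>}" "b \<in> {direction \<alpha>, direction \<beta>}" using ab(3) by blast+
  then show "a \<in> closure A" "b \<in> closure A" "norm a = 1" "norm b = 1" using cl by auto
qed

text \<open>Without \<open>a\<close> and \<open>b\<close>, the set avoids the line through them and
  stays on one side of it.\<close>

lemma connected_subset_arc:
  assumes A: "arc_interior A a b" and X: "connected X" "X \<subseteq> sphere 0 1" "a \<notin> X" "b \<notin> X" "X \<inter> A \<noteq> {}"
  shows "X \<subseteq> A"
proof -
  obtain n k where nk: "A = {x. norm x = 1 \<and> n \<bullet> x > k}" "{x. norm x = 1 \<and> n \<bullet> x = k} = {a, b}"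
    by (rule arc_interior_cap[OF A])
  let ?U = "{x. n \<bullet> x > k}" and ?V = "{x. n \<bullet> x < k}"
  have "n \<bullet> x \<noteq> k" if "x \<in> X" for x
  proof
    assume "n \<bullet> x = k"
    moreover have "norm x = 1" using X(2) that by auto
    ultimately have "x \<in> {a, b}" unfolding nk(2)[symmetric] by simp
    then show False using X(3,4) that by auto
  qed
  then have "X \<subseteq> ?U \<union> ?V" by fastforce
  then have "?U \<inter> X = {} \<or> ?V \<inter> X = {}"
    by (intro connectedD[OF X(1)]) (auto simp: open_halfspace_gt open_halfspace_lt)
  moreover have "?U \<inter> X \<noteq> {}" using X(5) nk(1) by auto
  ultimately have "?V \<inter> X = {}" by blast
  then show ?thesis using \<open>X \<subseteq> ?U \<union> ?V\<close> X(2) nk(1) by auto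
qed

lemma gapsE:
  assumes "A \<in> gaps \<Omega>"
  obtains a b where "a \<in> \<Omega>" "b \<in> \<Omega>" "a \<noteq> b" "arc_interior A a b" "A \<inter> \<Omega> = {}"
  using assms unfolding gaps_def by (elim CollectE bexE conjE) (rule that)

text \<open>The end points of \<open>A\<close> belong to the larger set too, so the connected set
  \<open>B\<close> cannot pass them.\<close>

lemma gap_subset_gap:
  assumes A: "A \<in> gaps \<Omega>" and B: "B \<in> gaps \<Omega>'" "\<Omega> \<subseteq> \<Omega>'" "B \<inter> A \<noteq> {}"
  shows "B \<subseteq> A"
proof -
  obtain a b where a: "a \<in> \<Omega>" "b \<in> \<Omega>" "a \<noteq> b" "arc_interior A a b" "A \<inter> \<Omega> = {}" using A by (rule gapsE)
  obtain c d where c: "c \<in> \<Omega>'" "d \<in> \<Omega>'" "c \<noteq> d" "arc_interior B c d" "B \<inter> \<Omega>' = {}" using B(1) by (rule gapsE)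
  show ?thesis
  proof (rule connected_subset_arc[OF a(4)])
    show "a \<notin> B" "b \<notin> B" using a(1,2) c(5) B(2) by blast+
  qed (use arc_interior_topology[OF c(4)] B(3) in simp_all)
qed

lemma gaps_disjoint: "A \<in> gaps \<Omega> \<Longrightarrow> B \<in> gaps \<Omega> \<Longrightarrow> B \<inter> A \<noteq> {} \<Longrightarrow> A = B"
  using gap_subset_gap[of A \<Omega> B \<Omega>] gap_subset_gap[of B \<Omega> A \<Omega>] by (simp add: Int_commute equalityI)

text \<open>If both end points of \<open>G\<close> are old, \<open>G\<close> is already a gap of
  \<Omega>. Otherwise an end point is a new point inside some gap \<open>A\<close>, which is
  relatively open in the circle and therefore meets \<open>G\<close>.\<close>

lemma refined_gap_subset:
  assumes T: "\<And>A. A \<in> gaps \<Omega> \<Longrightarrow> T A \<subseteq> A"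
    and G: "G \<in> gaps (\<Omega> \<union> (\<Union>A\<in>gaps \<Omega>. T A))" (is "G \<in> gaps ?\<Omega>'")
  shows "\<exists>A\<in>gaps \<Omega>. G \<subseteq> A"
proof -
  obtain c d where cd: "c \<in> ?\<Omega>'" "d \<in> ?\<Omega>'" "c \<noteq> d" "arc_interior G c d" "G \<inter> ?\<Omega>' = {}" using G by (rule gapsE)
  note topG = arc_interior_topology[OF cd(4)]
  have meet: "G \<inter> A \<noteq> {}" if A: "A \<in> gaps \<Omega>" "x \<in> A" "x \<in> closure G" for A x
  proof -
    obtain a b where ab: "a \<in> \<Omega>" "b \<in> \<Omega>" "a \<noteq> b" "arc_interior A a b" "A \<inter> \<Omega> = {}" using A(1) by (rule gapsE)
    obtain n k where nk: "A = {x. norm x = 1 \<and> n \<bullet> x > k}" "{x. norm x = 1 \<and> n \<bullet> x = k} = {a, b}"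
      by (rule arc_interior_cap[OF ab(4)])
    have "open {x. n \<bullet> x > k}" by (simp add: open_halfspace_gt)
    moreover have "x \<in> {x. n \<bullet> x > k}" using A nk by auto
    ultimately have "{x. n \<bullet> x > k} \<inter> G \<noteq> {}" using A(3) using open_Int_closure_eq_empty[of "{x. n \<bullet> x > k}" G] by blast
    then obtain z where "z \<in> G" "n \<bullet> z > k" by auto
    moreover from this have "norm z = 1" using topG(3) by auto
    ultimately show ?thesis using nk by auto
  qed
  show ?thesis
  proof (cases "c \<in> \<Omega> \<and> d \<in> \<Omega>")
    case True
    moreover have "G \<inter> \<Omega> = {}" using cd(5) by blast
    ultimately have "G \<in> gaps \<Omega>" unfolding gaps_def using cd(3,4) by blast
    then show ?thesis by blast
  next
    case False
    then obtain x where x0: "x \<in> closure G" "x \<in> ?\<Omega>'" "x \<notin> \<Omega>"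
    proof (cases "c \<in> \<Omega>")
      case True
      then have "d \<notin> \<Omega>" using False by simp
      then show ?thesis using that[OF topG(5) cd(2)] by simp
    next
      case False
      then show ?thesis using that[OF topG(4) cd(1)] by simp
    qed
    then obtain A where x: "x \<in> closure G" "A \<in> gaps \<Omega>" "x \<in> T A" by blast
    then have "G \<inter> A \<noteq> {}" using T[OF x(2)] by (intro meet[OF x(2) _ x(1)]) blast
    then have "G \<subseteq> A" using gap_subset_gap[OF x(2) G] by blast
    then show ?thesis using x(2) by blast
  qed
qed

text \<open>This ties the new gaps to one 1-lacunary set with two points added, whose bound does not
  depend on the level. The end points of \<open>G\<close> lie in the closure of \<open>A\<close>,
  and as gaps are disjoint, the refined set has no other points there than those of
  \<open>T A\<close> and \<open>a\<close>, \<open>b\<close>.\<close>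

lemma refined_gap:
  assumes T: "\<And>A. A \<in> gaps \<Omega> \<Longrightarrow> T A \<subseteq> A"
    and G: "G \<in> gaps (\<Omega> \<union> (\<Union>A\<in>gaps \<Omega>. T A))" (is "G \<in> gaps ?\<Omega>'")
    and A: "A \<in> gaps \<Omega>" "G \<subseteq> A" and ab: "a \<in> \<Omega>" "b \<in> \<Omega>" "arc_interior A a b"
  shows "G \<in> gaps (T A \<union> {a, b})"
proof -
  obtain c d where cd: "c \<in> ?\<Omega>'" "d \<in> ?\<Omega>'" "c \<noteq> d" "arc_interior G c d" "G \<inter> ?\<Omega>' = {}" using G by (rule gapsE)
  note topG = arc_interior_topology[OF cd(4)]
  have free: "A \<inter> \<Omega> = {}" using A(1) by (auto elim: gapsE)
  have endp: "x \<in> T A \<union> {a, b}" if x: "x \<in> ?\<Omega>'" "x \<in> closure G" "norm x = 1" for x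
  proof -
    obtain n k where nk: "A = {x. norm x = 1 \<and> n \<bullet> x > k}" "{x. norm x = 1 \<and> n \<bullet> x = k} = {a, b}"
      by (rule arc_interior_cap[OF ab(3)])
    have "closure G \<subseteq> {x. n \<bullet> x \<ge> k}"
      using A(2) nk by (intro closure_minimal closed_halfspace_ge) auto
    then have ge: "n \<bullet> x \<ge> k" using x(2) by blast
    have "x \<in> A \<or> x \<in> {a, b}"
    proof (cases "n \<bullet> x = k")
      case True
      then show ?thesis unfolding nk(2)[symmetric] using x(3) by simp
    next
      case False
      then show ?thesis using nk(1) ge x(3) by simp
    qed
    then show ?thesis
    proof
      assume "x \<in> A"
      then obtain B where B: "B \<in> gaps \<Omega>" "x \<in> T B" using x(1) free by auto
      then have "A = B" using \<open>x \<in> A\<close> T[OF B(1)] by (intro gaps_disjoint[OF A(1) B(1)]) auto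
      then show ?thesis using B by simp
    qed auto
  qed
  have "c \<in> T A \<union> {a, b}" "d \<in> T A \<union> {a, b}"
    by (rule endp[OF cd(1) topG(4,6)], rule endp[OF cd(2) topG(5,7)])
  moreover have "T A \<union> {a, b} \<subseteq> ?\<Omega>'" using ab(1,2) A(1) by blast
  then have "G \<inter> (T A \<union> {a, b}) = {}" using cd(5) by blast
  ultimately show ?thesis unfolding gaps_def using cd(3,4) by blast
qed

subsection \<open>Lacunary sets\<close>

text \<open>A chart assigns slopes to directions. Only those of the quarter circle \<open>Q\<close> are faithful, the others
  are sent to three exceptional values, so that \<open>\<sigma>\<close> is still Lipschitz from every point of \<open>Q\<close>.\<close>
definition chart :: "(real^2 \<Rightarrow> real) \<Rightarrow> (real^2) set \<Rightarrow> bool" where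
  "chart \<sigma> Q \<longleftrightarrow> Q \<subseteq> sphere 0 1 \<and> \<sigma> ` (sphere 0 1 - Q) \<subseteq> {-1, 0, 1} \<and>
     (\<forall>u\<in>Q. \<forall>e\<in>sphere 0 1. \<bar>\<sigma> u - \<sigma> e\<bar> \<le> 10 * dist u e) \<and>
     (\<forall>u\<in>Q. \<forall>v\<in>Q. dist u v \<le> 2 * \<bar>\<sigma> u - \<sigma> v\<bar>)"

lemma chart_le: "chart \<sigma> Q \<Longrightarrow> u \<in> Q \<Longrightarrow> norm e = 1 \<Longrightarrow> \<bar>\<sigma> u - \<sigma> e\<bar> \<le> 10 * dist u e"
  by (simp add: chart_def)

lemma chart_ge: "chart \<sigma> Q \<Longrightarrow> u \<in> Q \<Longrightarrow> v \<in> Q \<Longrightarrow> dist u v \<le> 2 * \<bar>\<sigma> u - \<sigma> v\<bar>"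
  by (simp add: chart_def)

lemma chart_norm: "chart \<sigma> Q \<Longrightarrow> u \<in> Q \<Longrightarrow> norm u = 1"
  by (auto simp: chart_def)

text \<open>The upper Lipschitz constant 10 and the lower one 2 multiply. The upper estimate holds
  for every unit vector \<open>e\<close>, in particular for end points of gaps that lie outside
  \<open>Q\<close>.\<close>

lemma chart_compare:
  assumes "chart \<sigma> Q" "u \<in> Q" "v \<in> Q" "norm e = 1" "dist u e \<le> c * dist u v" "0 \<le> c"
  shows "\<bar>\<sigma> u - \<sigma> e\<bar> \<le> 20 * c * \<bar>\<sigma> u - \<sigma> v\<bar>"
proof -
  have "\<bar>\<sigma> u - \<sigma> e\<bar> \<le> 10 * dist u e" using assms by (intro chart_le)
  also have "\<dots> \<le> 10 * (c * dist u v)" using assms by simp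
  also have "\<dots> \<le> 10 * (c * (2 * \<bar>\<sigma> u - \<sigma> v\<bar>))"
    using assms by (intro mult_left_mono chart_ge) auto
  finally show ?thesis by simp
qed

section \<open>The slope as a chart on the right quarter circle\<close>

definition slope :: "real^2 \<Rightarrow> real" where
  "slope u = (if 0 < u $ 1 then max (-1) (min 1 (u $ 2 / u $ 1)) else 0)"

definition right_quarter :: "(real^2) set" where
  "right_quarter = {u. norm u = 1 \<and> \<bar>u $ 2\<bar> \<le> u $ 1}"

lemma right_quarter_nth1: assumes "u \<in> right_quarter" shows "7/10 \<le> u $ 1" "slope u = u $ 2 / u $ 1"
proof -
  have u: "(u $ 1)\<^sup>2 + (u $ 2)\<^sup>2 = 1" "\<bar>u $ 2\<bar> \<le> u $ 1"
    using assms by (auto simp: right_quarter_def norm_vec2_eq_1_iff)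
  have "(u $ 2)\<^sup>2 \<le> (u $ 1)\<^sup>2" using u(2) by (intro iffD1[OF abs_le_square_iff]) linarith
  then have "(7/10)\<^sup>2 \<le> (u $ 1)\<^sup>2" using u by (simp add: power2_eq_square)
  then show *: "7/10 \<le> u $ 1" by (rule power2_le_imp_le) (use u in linarith)
  have "-1 \<le> u $ 2 / u $ 1" "u $ 2 / u $ 1 \<le> 1" using * u by (auto simp: field_simps)
  then show "slope u = u $ 2 / u $ 1" using * by (simp add: slope_def)
qed

text \<open>The exceptional values are the clamping bounds -1 and 1, and 0 where the first
  coordinate is not positive. Clamping does not increase the distance to a slope in
  \<open>{-1..1}\<close>, which keeps the upper estimate valid outside the quarter.\<close>

lemma chart_slope: "chart slope right_quarter"
  unfolding chart_def
proof (intro conjI ballI)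
  show "right_quarter \<subseteq> sphere 0 1" by (auto simp: right_quarter_def)
  show "slope ` (sphere 0 1 - right_quarter) \<subseteq> {-1, 0, 1}"
  proof (rule image_subsetI)
    fix u :: "real^2" assume "u \<in> sphere 0 1 - right_quarter"
    then have lt: "u $ 1 < \<bar>u $ 2\<bar>" by (auto simp: right_quarter_def)
    show "slope u \<in> {-1, 0, 1}"
    proof (cases "0 < u $ 1")
      case True
      then have "1 \<le> u $ 2 / u $ 1 \<or> u $ 2 / u $ 1 \<le> -1" using lt by (auto simp: field_simps)
      then show ?thesis by (auto simp: slope_def)
    qed (simp add: slope_def)
  qed
next
  fix u e assume u: "u \<in> right_quarter" and e: "e \<in> sphere (0 :: real^2) 1"
  have d: "\<bar>u $ 1 - e $ 1\<bar> \<le> dist u e" "\<bar>u $ 2 - e $ 2\<bar> \<le> dist u e"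
    using component_le_norm_cart[of "u - e" 1] component_le_norm_cart[of "u - e" 2] by (simp_all add: dist_norm)
  have u1: "7/10 \<le> u $ 1" "slope u = u $ 2 / u $ 1" "\<bar>u $ 2\<bar> \<le> u $ 1" "-1 \<le> slope u" "slope u \<le> 1"
    using right_quarter_nth1[OF u] u by (auto simp: right_quarter_def slope_def)
  have e1: "-1 \<le> slope e" "slope e \<le> 1" by (auto simp: slope_def)
  show "\<bar>slope u - slope e\<bar> \<le> 10 * dist u e"
  proof (cases "1/2 \<le> e $ 1")
    case True
    have clamp: "\<bar>s - max (-1) (min 1 z)\<bar> \<le> \<bar>s - z\<bar>" if "-1 \<le> s" "s \<le> 1" for s z :: real
      using that by (auto simp: max_def min_def)
    have "slope e = max (-1) (min 1 (e $ 2 / e $ 1))" using True by (simp add: slope_def)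
    then have "\<bar>slope u - slope e\<bar> \<le> \<bar>slope u - e $ 2 / e $ 1\<bar>"
      using clamp[OF u1(4,5)] by simp
    also have "\<dots> = \<bar>u $ 2 * (e $ 1 - u $ 1) - u $ 1 * (e $ 2 - u $ 2)\<bar> / (u $ 1 * e $ 1)"
    proof -
      have "slope u - e $ 2 / e $ 1 = (u $ 2 * (e $ 1 - u $ 1) - u $ 1 * (e $ 2 - u $ 2)) / (u $ 1 * e $ 1)"
        using True u1 by (simp add: field_simps)
      then show ?thesis using True u1 by (simp add: abs_mult)
    qed
    also have "\<dots> \<le> (u $ 1 * dist u e + u $ 1 * dist u e) / (u $ 1 * e $ 1)"
    proof (intro divide_right_mono)
      have "\<bar>u $ 2 * (e $ 1 - u $ 1)\<bar> \<le> u $ 1 * dist u e"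
        unfolding abs_mult using u1 d by (intro mult_mono) (auto simp: abs_minus_commute)
      moreover have "\<bar>u $ 1 * (e $ 2 - u $ 2)\<bar> \<le> u $ 1 * dist u e"
        unfolding abs_mult using u1 d by (intro mult_mono) (auto simp: abs_minus_commute)
      ultimately show "\<bar>u $ 2 * (e $ 1 - u $ 1) - u $ 1 * (e $ 2 - u $ 2)\<bar> \<le> u $ 1 * dist u e + u $ 1 * dist u e"
        by linarith
    qed (use True u1 in auto)
    also have "\<dots> = 2 * dist u e / e $ 1" using u1 True by (simp add: field_simps)
    also have "\<dots> \<le> 10 * dist u e"
    proof -
      have "2 * dist u e \<le> 10 * dist u e * e $ 1" using True mult_left_mono[of 1 "5 * e $ 1" "2 * dist u e"] by simp
      then show ?thesis using True by (simp add: divide_le_eq)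
    qed
    finally show ?thesis .
  next
    case False
    \<comment> \<open>Slopes never differ by more than 2, so a distance of at least 1/5 leads to the
      constant 10.\<close>
    then have "2/10 \<le> dist u e" using d(1) u1(1) by linarith
    then show ?thesis using u1(4,5) e1 by linarith
  qed
next
  fix u v assume u: "u \<in> right_quarter" and v: "v \<in> right_quarter"
  have u1: "7/10 \<le> u $ 1" "slope u = u $ 2 / u $ 1" "\<bar>u $ 2\<bar> \<le> u $ 1" "(u $ 1)\<^sup>2 + (u $ 2)\<^sup>2 = 1"
    using right_quarter_nth1[OF u] u by (auto simp: right_quarter_def norm_vec2_eq_1_iff)
  have v1: "7/10 \<le> v $ 1" "slope v = v $ 2 / v $ 1" "\<bar>v $ 2\<bar> \<le> v $ 1" "(v $ 1)\<^sup>2 + (v $ 2)\<^sup>2 = 1"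
    using right_quarter_nth1[OF v] v by (auto simp: right_quarter_def norm_vec2_eq_1_iff)
  \<comment> \<open>\<open>c\<close> is the cosine and \<open>x\<close> below the signed sine of the
    angle between \<open>u\<close> and \<open>v\<close>. Within the quarter this angle is at most a
    right one, hence \<open>c\<^sup>2 \<le> c\<close>.\<close>
  define c where "c = u \<bullet> v"
  define x where "x = u $ 2 * v $ 1 - v $ 2 * u $ 1"
  have "\<bar>u $ 2 * v $ 2\<bar> \<le> u $ 1 * v $ 1" unfolding abs_mult using u1 v1 by (intro mult_mono) auto
  then have c0: "0 \<le> c" by (simp add: c_def inner_vec2)
  have cx: "c\<^sup>2 + x\<^sup>2 = 1"
  proof -
    have "c\<^sup>2 + x\<^sup>2 = ((u $ 1)\<^sup>2 + (u $ 2)\<^sup>2) * ((v $ 1)\<^sup>2 + (v $ 2)\<^sup>2)"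
      by (simp add: c_def x_def inner_vec2 power2_eq_square algebra_simps)
    then show ?thesis using u1 v1 by simp
  qed
  have "c\<^sup>2 \<le> 1" using cx zero_le_power2[of x] by linarith
  then have c1: "c \<le> 1" by (intro power2_le_imp_le[of c 1]) auto
  have "(dist u v)\<^sup>2 = 2 - 2 * c"
    using u v unfolding dist_norm power2_norm_eq_inner
    by (simp add: inner_diff_left inner_diff_right c_def inner_commute right_quarter_def norm_eq_1)
  also have "\<dots> \<le> 2 * x\<^sup>2"
  proof -
    have "c * c \<le> c" using c0 c1 mult_left_mono[of c 1 c] by simp
    then show ?thesis using cx by (simp add: power2_eq_square)
  qed
  also have "\<dots> \<le> (2 * \<bar>x\<bar>)\<^sup>2" by (simp add: power2_eq_square)
  finally have "dist u v \<le> 2 * \<bar>x\<bar>" by (rule power2_le_imp_le) simp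
  also have "\<bar>x\<bar> \<le> \<bar>slope u - slope v\<bar>"
  proof -
    have "x = (slope u - slope v) * (u $ 1 * v $ 1)" using u1 v1 by (simp add: x_def field_simps)
    then have "\<bar>x\<bar> = \<bar>slope u - slope v\<bar> * (u $ 1 * v $ 1)" using u1 v1 by (simp add: abs_mult)
    moreover have "u $ 1 * v $ 1 \<le> 1"
      using component_le_norm_cart[of u 1] component_le_norm_cart[of v 1] u v u1 v1
      by (intro mult_le_one) (auto simp: right_quarter_def)
    ultimately show ?thesis using mult_left_mono[of "u $ 1 * v $ 1" 1 "\<bar>slope u - slope v\<bar>"] by simp
  qed
  finally show "dist u v \<le> 2 * \<bar>slope u - slope v\<bar>" by simp
qed

lemma chart_isometry:
  assumes "chart \<sigma> Q" "\<And>u. norm (\<tau> u) = norm u" "\<And>u v. dist (\<tau> u) (\<tau> v) = dist u v"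
  shows "chart (\<lambda>u. \<sigma> (\<tau> u)) {u. norm u = 1 \<and> \<tau> u \<in> Q}"
  unfolding chart_def
proof (intro conjI ballI)
  show "(\<lambda>u. \<sigma> (\<tau> u)) ` (sphere 0 1 - {u. norm u = 1 \<and> \<tau> u \<in> Q}) \<subseteq> {-1, 0, 1}"
  proof (rule image_subsetI)
    fix u assume "u \<in> sphere 0 1 - {u. norm u = 1 \<and> \<tau> u \<in> Q}"
    then have "\<tau> u \<in> sphere 0 1 - Q" using assms(2) by simp
    then show "\<sigma> (\<tau> u) \<in> {-1, 0, 1}" using assms(1) unfolding chart_def by blast
  qed
next
  fix u e :: "real^2" assume "u \<in> {u. norm u = 1 \<and> \<tau> u \<in> Q}" "e \<in> sphere 0 1"
  then show "\<bar>\<sigma> (\<tau> u) - \<sigma> (\<tau> e)\<bar> \<le> 10 * dist u e"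
    using chart_le[OF assms(1), of "\<tau> u" "\<tau> e"] assms(2,3) by simp
next
  fix u v :: "real^2" assume "u \<in> {u. norm u = 1 \<and> \<tau> u \<in> Q}" "v \<in> {u. norm u = 1 \<and> \<tau> u \<in> Q}"
  then show "dist u v \<le> 2 * \<bar>\<sigma> (\<tau> u) - \<sigma> (\<tau> v)\<bar>"
    using chart_ge[OF assms(1), of "\<tau> u" "\<tau> v"] assms(3) by simp
qed auto

section \<open>Bounds for slopes of lacunary sets\<close>

lemma parallelograms_mono: "\<Sigma> \<subseteq> \<Sigma>' \<Longrightarrow> parallelograms \<Sigma> \<subseteq> parallelograms \<Sigma>'"
  unfolding parallelograms_def by blast

lemma dual_bounded_parallelograms_mono:
  "dual_bounded lborel (parallelograms \<Sigma>') A \<Longrightarrow> \<Sigma> \<subseteq> \<Sigma>' \<Longrightarrow> A \<le> B \<Longrightarrow> dual_bounded lborel (parallelograms \<Sigma>) B"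
  using dual_bounded_mono parallelograms_mono by blast

lemma dual_bounded_parallelograms_subset_single:
  "\<Sigma> \<subseteq> {m} \<Longrightarrow> 901 \<le> A \<Longrightarrow> dual_bounded lborel (parallelograms \<Sigma>) A"
  using dual_bounded_parallelograms_mono[OF dual_bounded_single_slope] by blast

lemma dual_bounded_parallelograms_insert:
  assumes "dual_bounded lborel (parallelograms \<Sigma>) A" "901 \<le> A"
  shows "dual_bounded lborel (parallelograms (insert m \<Sigma>)) (2 * A)"
proof -
  have "parallelograms (insert m \<Sigma>) = parallelograms {m} \<union> parallelograms \<Sigma>" unfolding parallelograms_def by blast
  moreover have "dual_bounded lborel (parallelograms {m} \<union> parallelograms \<Sigma>) (2 * A)"
  proof (rule dual_bounded_Un)
    show "dual_bounded lborel (parallelograms {m}) A" using assms(2) by (intro dual_bounded_parallelograms_subset_single[of _ m]) auto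
  qed (use assms parallelograms_fmeasurable in auto)
  ultimately show ?thesis by simp
qed

text \<open>The second factor is the bound for the inner points of a 1-lacunary set, with
  \<open>C = 40\<close> and both input bounds 901. The factor \<open>128 = 2 ^ 7\<close> pays for
  seven further slopes: -1, 0, 1, those of the first and the last point, and those of two added
  points, later the ends of the surrounding gap.\<close>

definition lacunary_const :: real where "lacunary_const = 128 * (901 + 336 * 41 * 901)"

text \<open>Every point \<open>v\<^sub>k\<close> which is neither the first nor the last one satisfies \<open>|v\<^sub>k - v\<^sub>\<infinity>| \<le> 2 |v\<^sub>k - s|\<close> for
  all other points \<open>s\<close>, because its two neighbors do. Each of the remaining points and exceptional
  slopes doubles the bound.\<close>
lemma one_lacunary_bounded:
  assumes ch: "chart \<sigma> Q" and lac: "one_lacunary S"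
  shows "dual_bounded lborel (parallelograms (\<sigma> ` (S \<union> {a, b}))) lacunary_const"
proof -
  obtain v L w where Ssph: "S \<subseteq> sphere 0 1" and inj: "inj_on v {k. enat k < L}" and S: "S = v ` {k. enat k < L}"
    and nb: "\<And>k. enat (Suc k) < L \<Longrightarrow> neighboring S (v k) (v (Suc k))"
    and w: "norm w = 1" "\<And>k. enat (Suc k) < L \<Longrightarrow> 1/2 * norm (v k - v (Suc k)) < norm (v (Suc k) - w) \<and>
            norm (v (Suc k) - w) < norm (v k - v (Suc k))"
    using lac unfolding one_lacunary_def by auto
  define I where "I = v ` {k. 0 < k \<and> enat (Suc k) < L}"
  have IS: "I \<subseteq> S"
  proof
    fix x assume "x \<in> I"
    then obtain k where k: "x = v k" "enat (Suc k) < L" by (auto simp: I_def)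
    have "enat k < enat (Suc k)" by simp
    also note k(2)
    finally show "x \<in> S" using k(1) by (auto simp: S)
  qed
  have sep: "dist u w \<le> 2 * dist u s" if u: "u \<in> I" and s: "s \<in> S" "s \<noteq> u" for u s
  proof -
    obtain j where j: "u = v (Suc j)" "enat (Suc (Suc j)) < L"
      using u unfolding I_def by (auto elim!: gr0_implies_Suc[THEN exE])
    have jj: "enat (Suc j) < L" "enat j < L"
    proof -
      have "enat (Suc j) < enat (Suc (Suc j))" "enat j < enat (Suc (Suc j))" by simp_all
      then show "enat (Suc j) < L" "enat j < L" using order.strict_trans[OF _ j(2)] by blast+
    qed
    have "v j \<noteq> v (Suc (Suc j))" using inj j(2) jj by (auto dest: inj_onD)
    moreover have "neighboring S u (v j)"
      using nb[OF jj(1)] unfolding j(1) neighboring_def arc_interior_def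
      by (simp only: insert_commute[of "v (Suc j)" "v j"] eq_commute[of "v (Suc j)" "v j"]) blast
    moreover have "neighboring S u (v (Suc (Suc j)))" using nb[OF j(2)] j(1) by simp
    moreover have "norm u = 1" "norm s = 1" using u s IS Ssph by auto
    ultimately have "dist u (v j) \<le> dist u s \<or> dist u (v (Suc (Suc j))) \<le> dist u s"
      using s by (intro dist_two_neighbors_le) auto
    \<comment> \<open>For the preceding point the upper lacunarity condition suffices as it stands;
      for the following point it is combined with the triangle inequality, at the cost of the factor
      2.\<close>
    moreover have "dist u w \<le> dist u (v j)"
      using w(2)[OF jj(1)] j(1) by (simp add: dist_norm norm_minus_commute)
    moreover have "dist u w \<le> 2 * dist u (v (Suc (Suc j)))"
      using w(2)[OF j(2)] j(1) dist_triangle[of u w "v (Suc (Suc j))"] by (simp add: dist_norm norm_minus_commute)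
    moreover have "0 \<le> dist u (v j)" "0 \<le> dist u s" by simp_all
    ultimately show ?thesis by linarith
  qed
  have sep': "\<bar>\<sigma> u - \<sigma> w\<bar> \<le> 40 * \<bar>\<sigma> u - \<sigma> s\<bar>"
    if u: "u \<in> I \<inter> Q" "s \<in> I \<inter> Q" "u \<noteq> s" for u s
  proof -
    have "dist u w \<le> 2 * dist u s" by (rule sep) (use u IS in auto)
    then have "\<bar>\<sigma> u - \<sigma> w\<bar> \<le> 20 * 2 * \<bar>\<sigma> u - \<sigma> s\<bar>"
      using u w(1) by (intro chart_compare[OF ch]) auto
    then show ?thesis by simp
  qed
  have "dual_bounded lborel (parallelograms (\<sigma> ` (I \<inter> Q))) (901 + 336 * (40 + 1) * 901)"
  proof (rule dual_bounded_almost_orthogonal[where X="I \<inter> Q" and p="\<lambda>u. u" and ?e1.0="\<lambda>_. \<sigma> w" and ?e2.0="\<lambda>_. \<sigma> w" and ?\<Sigma>0.0="{\<sigma> w}" and \<sigma>=\<sigma>])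
    show "dual_bounded lborel (parallelograms {\<sigma> w}) 901" by (rule dual_bounded_single_slope)
    show "dual_bounded lborel (parallelograms (\<sigma> ` {u \<in> I \<inter> Q. u = l})) 901" for l
      by (rule dual_bounded_parallelograms_subset_single[of _ "\<sigma> l"]) auto
  qed (use sep' in simp_all)
  then have *: "dual_bounded lborel (parallelograms (\<sigma> ` (I \<inter> Q))) (901 + 336 * 41 * 901)" by simp
  \<comment> \<open>The index of the last point. For an empty or infinite sequence there is none,
    and the arbitrary index chosen instead merely adds a slope.\<close>
  define l where "l = (SOME k. enat k < L \<and> \<not> enat (Suc k) < L)"
  have "\<sigma> ` (S \<union> {a, b}) \<subseteq> insert (\<sigma> a) (insert (\<sigma> b) (insert (-1) (insert 0 (insert 1 (insert (\<sigma> (v 0))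
     (insert (\<sigma> (v l)) (\<sigma> ` (I \<inter> Q))))))))" (is "_ \<subseteq> ?R")
  proof (rule image_subsetI)
    fix x assume x: "x \<in> S \<union> {a, b}"
    show "\<sigma> x \<in> ?R"
    proof (cases "x \<in> S")
      case True
      note 3 = this
      from 3 obtain k where k: "x = v k" "enat k < L" unfolding S by (elim imageE CollectE) (rule that)
      show ?thesis
      proof (cases "enat (Suc k) < L")
        case True
        show ?thesis
        proof (cases "k = 0")
          case False
          then have "x \<in> I" using k True by (auto simp: I_def)
          moreover have "\<sigma> x \<in> {-1, 0, 1}" if "x \<notin> Q"
          proof -
            have "x \<in> sphere 0 1 - Q" using 3 Ssph that by blast
            then show ?thesis using ch unfolding chart_def by blast
          qed
          ultimately show ?thesis by (cases "x \<in> Q") auto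
        qed (use k in simp)
      next
        case False
        have "enat l < L \<and> \<not> enat (Suc l) < L" unfolding l_def by (rule someI[of _ k]) (use k False in simp)
        then have "k = l" using k False by (cases L) auto
        then show ?thesis using k by simp
      qed
    next
      case False
      then have "x = a \<or> x = b" using x by simp
      then show ?thesis by (elim disjE) simp_all
    qed
  qed
  note sub = this
  have db: "dual_bounded lborel (parallelograms ?R) (2 * (2 * (2 * (2 * (2 * (2 * (2 * (901 + 336 * 41 * 901))))))))"
    by (intro dual_bounded_parallelograms_insert *) simp_all
  show ?thesis by (rule dual_bounded_parallelograms_mono[OF db sub]) (simp add: lacunary_const_def)
qed

text \<open>The pieces are the single points of \<Theta> and the sets \<open>X G\<close>. For
  \<open>u\<close> in \<open>X G\<close>, every point of another piece lies outside the gap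
  \<open>G\<close>, so one end point of \<open>G\<close> is at least as close to \<open>u\<close>. A
  point of \<Theta> is its own candidate. The 20 is that of \<open>chart_compare\<close>.\<close>

lemma gap_insertion:
  assumes ch: "chart \<sigma> Q" and \<Theta>: "dual_bounded lborel (parallelograms (\<sigma> ` \<Theta>)) A0" "0 < A0"
    and G: "\<G> \<subseteq> gaps \<Theta>" and S: "901 \<le> S"
    and X: "\<And>G. G \<in> \<G> \<Longrightarrow> X G \<subseteq> G" "\<And>G. G \<in> \<G> \<Longrightarrow> dual_bounded lborel (parallelograms (\<sigma> ` (X G \<inter> Q))) S"
  shows "dual_bounded lborel (parallelograms (\<sigma> ` ((\<Theta> \<union> (\<Union>G\<in>\<G>. X G)) \<inter> Q))) (S + 336 * (20 + 1) * A0)"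
proof -
  have "\<forall>G\<in>\<G>. \<exists>a b. a \<in> \<Theta> \<and> b \<in> \<Theta> \<and> arc_interior G a b \<and> G \<inter> \<Theta> = {}"
    using G unfolding gaps_def by blast
  then obtain a b where ab: "\<And>G. G \<in> \<G> \<Longrightarrow> a G \<in> \<Theta> \<and> b G \<in> \<Theta> \<and> arc_interior G (a G) (b G) \<and> G \<inter> \<Theta> = {}"
    unfolding bchoice_iff by blast
  define g where "g u = (SOME G. G \<in> \<G> \<and> u \<in> X G)" for u
  have g: "g u \<in> \<G> \<and> u \<in> X (g u)" if u: "u \<in> (\<Theta> \<union> (\<Union>G\<in>\<G>. X G)) \<inter> Q" "u \<notin> \<Theta>" for u
  proof -
    have "\<exists>G. G \<in> \<G> \<and> u \<in> X G" using u by blast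
    then show ?thesis unfolding g_def by (rule someI_ex)
  qed
  define p where "p u = (if u \<in> \<Theta> then Inl u else Inr (g u))" for u
  show ?thesis
  proof (rule dual_bounded_almost_orthogonal[OF \<Theta>(2) \<Theta>(1), where p=p and
      ?e1.0="\<lambda>u. \<sigma> (if u \<in> \<Theta> then u else a (g u))" and ?e2.0="\<lambda>u. \<sigma> (if u \<in> \<Theta> then u else b (g u))"])
    fix l
    show "dual_bounded lborel (parallelograms (\<sigma> ` {u \<in> (\<Theta> \<union> (\<Union>G\<in>\<G>. X G)) \<inter> Q. p u = l})) S" (is "dual_bounded lborel (parallelograms (\<sigma> ` ?Y)) S")
    proof (cases l)
      case (Inl x)
      then have "\<sigma> ` ?Y \<subseteq> {\<sigma> x}" by (auto simp: p_def split: if_splits)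
      then show ?thesis using S by (rule dual_bounded_parallelograms_subset_single)
    next
      case (Inr G)
      have Y: "g u = G \<and> u \<in> X G \<and> u \<in> Q \<and> G \<in> \<G>" if "u \<in> ?Y" for u
      proof -
        have "u \<notin> \<Theta>" "g u = G" using that Inr by (auto simp: p_def split: if_splits)
        then show ?thesis using g[of u] that by auto
      qed
      show ?thesis
      proof (cases "?Y = {}")
        \<comment> \<open>A label outside \<G> has an empty piece, and no bound for \<open>X\<close>
          is available there.\<close>
        case True
        then have "\<sigma> ` ?Y \<subseteq> {0}" by blast
        then show ?thesis using S by (rule dual_bounded_parallelograms_subset_single)
      next
        case False
        then have "G \<in> \<G>" using Y by blast
        then show ?thesis by (rule dual_bounded_parallelograms_mono[OF X(2)]) (use Y in blast, simp)
      qed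
    qed
  next
    fix u assume u: "u \<in> (\<Theta> \<union> (\<Union>G\<in>\<G>. X G)) \<inter> Q"
    show "\<sigma> (if u \<in> \<Theta> then u else a (g u)) \<in> \<sigma> ` \<Theta> \<and> \<sigma> (if u \<in> \<Theta> then u else b (g u)) \<in> \<sigma> ` \<Theta>"
      using g[OF u] ab by auto
  next
    fix u v assume u: "u \<in> (\<Theta> \<union> (\<Union>G\<in>\<G>. X G)) \<inter> Q" and v: "v \<in> (\<Theta> \<union> (\<Union>G\<in>\<G>. X G)) \<inter> Q" and p: "p u \<noteq> p v"
    show "\<bar>\<sigma> u - \<sigma> (if u \<in> \<Theta> then u else a (g u))\<bar> \<le> 20 * \<bar>\<sigma> u - \<sigma> v\<bar> \<or>
          \<bar>\<sigma> u - \<sigma> (if u \<in> \<Theta> then u else b (g u))\<bar> \<le> 20 * \<bar>\<sigma> u - \<sigma> v\<bar>"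
    proof (cases "u \<in> \<Theta>")
      case False
      have gu: "g u \<in> \<G>" "u \<in> X (g u)" using g[OF u False] by auto
      have uG: "u \<in> g u" using X(1)[OF gu(1)] gu(2) by blast
      have "v \<notin> g u"
      proof
        assume vG: "v \<in> g u"
        then have "v \<notin> \<Theta>" using ab[OF gu(1)] by blast
        then have gv: "g v \<in> \<G>" "v \<in> X (g v)" using g[OF v] by auto
        then have "v \<in> g v" using X(1) by blast
        then have "g u = g v" using vG G gu(1) gv(1) by (intro gaps_disjoint[of _ \<Theta>]) auto
        then show False using p False \<open>v \<notin> \<Theta>\<close> by (simp add: p_def)
      qed
      moreover have arc: "arc_interior (g u) (a (g u)) (b (g u))" using ab[OF gu(1)] by blast
      moreover have nv: "norm v = 1" using chart_norm[OF ch] v by blast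
      ultimately have "dist u (a (g u)) \<le> dist u v \<or> dist u (b (g u)) \<le> dist u v"
        using uG by (intro dist_arc_endpoint_le) auto
      then show ?thesis
        using chart_compare[OF ch, of u v "a (g u)" 1] chart_compare[OF ch, of u v "b (g u)" 1] u v False
          arc_interior_topology(6,7)[OF arc] by auto
    qed simp
  qed simp
qed

text \<open>The arbitrary sets \<open>X A\<close> inserted in the gaps make the induction work: the points that the last step
  adds to a gap \<open>A\<close> of the preceding set, together with everything inserted in the smaller gaps, form the
  new \<open>X A\<close>. In this way each step costs a constant summand and not a constant factor.\<close>
lemma lacunary_insertion:
  assumes "chart \<sigma> Q" "lacunary N \<Omega>" "901 \<le> S"
    "\<And>A. A \<in> gaps \<Omega> \<Longrightarrow> X A \<subseteq> A" "\<And>A. A \<in> gaps \<Omega> \<Longrightarrow> dual_bounded lborel (parallelograms (\<sigma> ` (X A \<inter> Q))) S"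
  shows "dual_bounded lborel (parallelograms (\<sigma> ` ((\<Omega> \<union> (\<Union>A\<in>gaps \<Omega>. X A)) \<inter> Q))) (S + 336 * (20 + 1) * lacunary_const * real N)"
  using assms(2-)
proof (induction arbitrary: S X)
  case (one \<Omega>)
  have "dual_bounded lborel (parallelograms (\<sigma> ` \<Omega>)) lacunary_const"
    using one_lacunary_bounded[OF assms(1) one(1), of 0 0] by (rule dual_bounded_parallelograms_mono) auto
  from gap_insertion[OF assms(1) this _ order_refl one(2) one(3) one(4)] show ?case
    by (simp add: lacunary_const_def)
next
  case (step N \<Omega> T)
  let ?\<Omega>' = "\<Omega> \<union> (\<Union>A\<in>gaps \<Omega>. T A)"
  define \<G> where "\<G> A = {G \<in> gaps ?\<Omega>'. G \<subseteq> A}" for A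
  define Y where "Y A = T A \<union> (\<Union>G\<in>\<G> A. X G)" for A
  have TA: "T A \<subseteq> A" if "A \<in> gaps \<Omega>" for A using step(2)[OF that] by blast
  have XG: "X G \<subseteq> G" "dual_bounded lborel (parallelograms (\<sigma> ` (X G \<inter> Q))) S" if "G \<in> gaps ?\<Omega>'" for G
    using step.prems that by auto
  \<comment> \<open>The induction hypothesis is used with a larger bound for the inserted sets. What
    this step costs is paid inside the gaps and is therefore only added.\<close>
  have "dual_bounded lborel (parallelograms (\<sigma> ` ((\<Omega> \<union> (\<Union>A\<in>gaps \<Omega>. Y A)) \<inter> Q)))
      ((S + 336 * (20 + 1) * lacunary_const) + 336 * (20 + 1) * lacunary_const * real N)"
  proof (rule step.IH)
    show "901 \<le> S + 336 * (20 + 1) * lacunary_const" using step.prems(1) by (simp add: lacunary_const_def)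
  next
    fix A assume A: "A \<in> gaps \<Omega>"
    show "Y A \<subseteq> A" unfolding Y_def \<G>_def using TA[OF A] XG(1) by blast
    obtain a b where ab: "a \<in> \<Omega>" "b \<in> \<Omega>" "a \<noteq> b" "arc_interior A a b" "A \<inter> \<Omega> = {}" using A by (rule gapsE)
    have sub: "\<G> A \<subseteq> gaps (T A \<union> {a, b})"
    proof
      fix G assume G: "G \<in> \<G> A"
      then have G': "G \<in> gaps ?\<Omega>'" "G \<subseteq> A" by (auto simp: \<G>_def)
      show "G \<in> gaps (T A \<union> {a, b})" using TA G'(1) A G'(2) ab(1,2,4) by (rule refined_gap)
    qed
    \<comment> \<open>Inside \<open>A\<close>, the set with the smaller gaps is \<open>T A\<close>
      together with the ends of \<open>A\<close>; its bound is the same at every level.\<close>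
    have "dual_bounded lborel (parallelograms (\<sigma> ` (((T A \<union> {a, b}) \<union> (\<Union>G\<in>\<G> A. X G)) \<inter> Q))) (S + 336 * (20 + 1) * lacunary_const)"
    proof (rule gap_insertion[OF assms(1) _ _ sub step.prems(1)])
      show "dual_bounded lborel (parallelograms (\<sigma> ` (T A \<union> {a, b}))) lacunary_const"
        using step(2)[OF A] by (intro one_lacunary_bounded[OF assms(1)]) blast
    qed (use XG in \<open>auto simp: \<G>_def lacunary_const_def\<close>)
    then show "dual_bounded lborel (parallelograms (\<sigma> ` (Y A \<inter> Q))) (S + 336 * (20 + 1) * lacunary_const)"
      by (rule dual_bounded_parallelograms_mono) (auto simp: Y_def)
  qed
  then show ?case
  proof (rule dual_bounded_parallelograms_mono)
    have "X G \<subseteq> (\<Union>A\<in>gaps \<Omega>. Y A)" if G: "G \<in> gaps ?\<Omega>'" for G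
    proof -
      obtain A where "A \<in> gaps \<Omega>" "G \<subseteq> A" using refined_gap_subset[of \<Omega> T, OF TA G] by blast
      then show ?thesis using G unfolding Y_def \<G>_def by blast
    qed
    moreover have "T A \<subseteq> Y A" for A by (auto simp: Y_def)
    ultimately have "?\<Omega>' \<union> (\<Union>G\<in>gaps ?\<Omega>'. X G) \<subseteq> \<Omega> \<union> (\<Union>A\<in>gaps \<Omega>. Y A)" by blast
    then show "\<sigma> ` ((?\<Omega>' \<union> (\<Union>G\<in>gaps ?\<Omega>'. X G)) \<inter> Q) \<subseteq> \<sigma> ` ((\<Omega> \<union> (\<Union>A\<in>gaps \<Omega>. Y A)) \<inter> Q)" by blast
    show "S + 336 * (20 + 1) * lacunary_const + 336 * (20 + 1) * lacunary_const * real N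
       \<le> S + 336 * (20 + 1) * lacunary_const * real (Suc N)" by (simp add: algebra_simps)
  qed
qed

lemma lacunary_bounded:
  assumes "chart \<sigma> Q" "lacunary N \<Omega>"
  shows "dual_bounded lborel (parallelograms (\<sigma> ` (\<Omega> \<inter> Q))) (901 + 336 * 21 * lacunary_const * real N)"
proof -
  have "dual_bounded lborel (parallelograms (\<sigma> ` ((\<Omega> \<union> (\<Union>A\<in>gaps \<Omega>. {})) \<inter> Q))) (901 + 336 * (20 + 1) * lacunary_const * real N)"
    by (rule lacunary_insertion[OF assms]) (auto intro!: dual_bounded_parallelograms_subset_single[of _ 0])
  then show ?thesis by simp
qed

subsection \<open>From weighted families to the maximal operator\<close>

text \<open>On \<open>E i\<close> the largest mean is \<open>a i\<close>, so the left side is at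
  most \<open>G\<close>. As the \<open>a i\<close> are means of \<open>f\<close>, \<open>G\<close>
  is also the integral of \<open>f * F\<close>, while the dual bound controls the integral of
  \<open>F * F\<close> by \<open>A\<^sup>2 * G\<close>.\<close>

lemma dual_bounded_imp_maximal_le:
  fixes f :: "'a \<Rightarrow> real"
  assumes bd: "dual_bounded M \<C> A" and A: "0 < A" and fm: "\<C> \<subseteq> fmeasurable M"
    and pos: "\<And>P. P \<in> \<C> \<Longrightarrow> 0 < measure M P"
    and f[measurable]: "f \<in> borel_measurable M" and f0: "\<And>x. 0 \<le> f x"
    and J: "finite (J :: nat set)" "\<And>i. i \<in> J \<Longrightarrow> P i \<in> \<C>"
  shows "(\<integral>\<^sup>+x. (SUP i\<in>{i\<in>J. x \<in> P i}. (\<integral>\<^sup>+y\<in>P i. ennreal (f y) \<partial>M) / emeasure M (P i))\<^sup>2 \<partial>M)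
     \<le> ennreal (A\<^sup>2) * (\<integral>\<^sup>+x. (ennreal (f x))\<^sup>2 \<partial>M)"
proof (cases "(\<integral>\<^sup>+x. (ennreal (f x))\<^sup>2 \<partial>M) = \<infinity>")
  case True
  then show ?thesis using A by (simp add: ennreal_mult_top)
next
  case False
  have sq: "(\<integral>\<^sup>+x. ennreal ((f x)\<^sup>2) \<partial>M) = (\<integral>\<^sup>+x. (ennreal (f x))\<^sup>2 \<partial>M)"
    using f0 by (intro nn_integral_cong) (simp add: ennreal_power)
  have f2: "integrable M (\<lambda>x. (f x)\<^sup>2)"
    using False by (intro integrableI_nonneg) (auto simp: sq top.not_eq_extremum)
  have If2: "(\<integral>\<^sup>+x. (ennreal (f x))\<^sup>2 \<partial>M) = ennreal (\<integral>x. (f x)\<^sup>2 \<partial>M)"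
    unfolding sq[symmetric] by (intro nn_integral_eq_integral f2) auto
  have PM: "P i \<in> fmeasurable M" "0 < measure M (P i)" "P i \<in> sets M" if "i \<in> J" for i
    using J(2)[OF that] fm pos by auto
  have ind: "integrable M (indicat_real (P i))" if "i \<in> J" for i
    using PM[OF that] by (auto simp: fmeasurable_def)
  have fP: "integrable M (\<lambda>x. f x * indicat_real (P i) x)" if "i \<in> J" for i
  proof (rule Bochner_Integration.integrable_bound)
    show "integrable M (\<lambda>x. (f x)\<^sup>2 + indicat_real (P i) x)" using f2 ind[OF that] by simp
    show "(\<lambda>x. f x * indicat_real (P i) x) \<in> borel_measurable M" using PM[OF that] by measurable
    show "AE x in M. norm (f x * indicat_real (P i) x) \<le> norm ((f x)\<^sup>2 + indicat_real (P i) x)"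
    proof (rule AE_I2)
      fix x
      \<comment> \<open>This reduces integrability on a set of finite measure to that of the
        square.\<close>
      have "f x \<le> (f x)\<^sup>2 + 1" using zero_le_power2[of "f x - 1/2"] by (simp add: power2_eq_square algebra_simps)
      then show "norm (f x * indicat_real (P i) x) \<le> norm ((f x)\<^sup>2 + indicat_real (P i) x)"
        using f0[of x] by (simp add: indicator_def)
    qed
  qed
  define a where "a i = (\<integral>x. f x * indicat_real (P i) x \<partial>M) / measure M (P i)" for i
  have a0: "0 \<le> a i" for i unfolding a_def using f0 by (intro divide_nonneg_nonneg integral_nonneg_AE) auto
  have avg: "(\<integral>\<^sup>+y\<in>P i. ennreal (f y) \<partial>M) / emeasure M (P i) = ennreal (a i)" if i: "i \<in> J" for i
  proof -
    have "(\<integral>\<^sup>+y\<in>P i. ennreal (f y) \<partial>M) = (\<integral>\<^sup>+y. ennreal (f y * indicat_real (P i) y) \<partial>M)"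
      by (intro nn_integral_cong) (simp add: indicator_def)
    also have "\<dots> = ennreal (\<integral>x. f x * indicat_real (P i) x \<partial>M)"
      using f0 by (intro nn_integral_eq_integral fP i) auto
    finally show ?thesis
      using PM[OF i] by (simp add: a_def emeasure_eq_measure2 divide_ennreal f0 integral_nonneg_AE)
  qed
  \<comment> \<open>Ties between equal means are broken by the index, which makes the sets
    \<open>E i\<close> disjoint.\<close>
  define before where "before j i \<longleftrightarrow> a i < a j \<or> (a i = a j \<and> j < i)" for i j
  define E where "E i = P i - (\<Union>j\<in>{j\<in>J. before j i}. P j)" for i
  have disj: "E i \<inter> E j = {}" if "i \<in> J" "j \<in> J" "i \<noteq> j" for i j
  proof -
    have "before i j \<or> before j i" using that(3) unfolding before_def by linarith
    then show ?thesis using that unfolding E_def by blast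
  qed
  have EM: "E i \<in> sets M" if "i \<in> J" for i
    using PM(3) that J(1) unfolding E_def by (intro sets.Diff sets.finite_UN) auto
  have ad: "admissible M \<C> J P E a"
    unfolding admissible_def disjoint_family_on_def
    using J disj EM a0 by (auto simp: E_def)
  have sup: "(SUP i\<in>{i\<in>J. x \<in> P i}. (\<integral>\<^sup>+y\<in>P i. ennreal (f y) \<partial>M) / emeasure M (P i))\<^sup>2
      \<le> (\<Sum>i\<in>J. ennreal ((a i)\<^sup>2) * indicator (E i) x)" for x
  proof (cases "{i\<in>J. x \<in> P i} = {}")
    case True
    show ?thesis unfolding True by (simp add: bot_ennreal)
  next
    case False
    define I where "I = {i\<in>J. x \<in> P i}"
    have I: "finite I" "I \<noteq> {}" using False J(1) by (auto simp: I_def)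
    define m where "m = Max (a ` I)"
    define k where "k = Min {i\<in>I. a i = m}"
    have m: "m \<in> a ` I" "\<And>i. i \<in> I \<Longrightarrow> a i \<le> m" unfolding m_def using I by auto
    then have "{i\<in>I. a i = m} \<noteq> {}" by auto
    then have k: "k \<in> {i\<in>I. a i = m}" unfolding k_def using I by (intro Min_in) auto
    have kmin: "k \<le> i" if "i \<in> I" "a i = m" for i unfolding k_def using I that by (intro Min_le) auto
    have "\<not> before j k" if "j \<in> I" for j
      using m(2)[OF that] kmin[OF that] k unfolding before_def by auto
    then have kE: "x \<in> E k" using k unfolding E_def I_def by auto
    have "(SUP i\<in>I. (\<integral>\<^sup>+y\<in>P i. ennreal (f y) \<partial>M) / emeasure M (P i)) \<le> ennreal (a k)"
      using avg m(2) k unfolding I_def by (intro SUP_least) (auto intro!: ennreal_leI)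
    then have "(SUP i\<in>I. (\<integral>\<^sup>+y\<in>P i. ennreal (f y) \<partial>M) / emeasure M (P i))\<^sup>2 \<le> (ennreal (a k))\<^sup>2"
      by (intro power_mono) auto
    also have "\<dots> = ennreal ((a k)\<^sup>2) * indicator (E k) x" using kE a0 by (simp add: ennreal_power)
    also have "\<dots> \<le> (\<Sum>i\<in>J. ennreal ((a i)\<^sup>2) * indicator (E i) x)"
      using k J(1) unfolding I_def by (intro member_le_sum) auto
    finally show ?thesis unfolding I_def .
  qed
  define G where "G = (\<Sum>i\<in>J. (a i)\<^sup>2 * measure M (E i))"
  have EP: "emeasure M (E i) = ennreal (measure M (E i))" if "i \<in> J" for i
  proof -
    have "E i \<in> fmeasurable M" by (rule fmeasurableI2[OF PM(1)[OF that] _ EM[OF that]]) (auto simp: E_def)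
    then show ?thesis by (simp add: emeasure_eq_measure2)
  qed
  have "(\<integral>\<^sup>+x. (SUP i\<in>{i\<in>J. x \<in> P i}. (\<integral>\<^sup>+y\<in>P i. ennreal (f y) \<partial>M) / emeasure M (P i))\<^sup>2 \<partial>M)
      \<le> (\<integral>\<^sup>+x. (\<Sum>i\<in>J. ennreal ((a i)\<^sup>2) * indicator (E i) x) \<partial>M)"
    by (intro nn_integral_mono sup)
  also have "\<dots> = (\<Sum>i\<in>J. \<integral>\<^sup>+x. ennreal ((a i)\<^sup>2) * indicator (E i) x \<partial>M)"
    using EM by (intro nn_integral_sum) auto
  also have "\<dots> = (\<Sum>i\<in>J. ennreal ((a i)\<^sup>2 * measure M (E i)))"
    using EM EP by (intro sum.cong refl) (simp add: nn_integral_cmult_indicator ennreal_mult)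
  also have "\<dots> = ennreal G" unfolding G_def by (intro sum_ennreal) auto
  finally have le: "(\<integral>\<^sup>+x. (SUP i\<in>{i\<in>J. x \<in> P i}. (\<integral>\<^sup>+y\<in>P i. ennreal (f y) \<partial>M) / emeasure M (P i))\<^sup>2 \<partial>M) \<le> ennreal G" .
  define z where "z i = a i * measure M (E i) / measure M (P i)" for i
  define F where "F x = (\<Sum>i\<in>J. z i * indicat_real (P i) x)" for x
  have FF: "integrable M (\<lambda>x. F x * F x)"
    "integral\<^sup>L M (\<lambda>x. F x * F x) = (\<Sum>i\<in>J. \<Sum>j\<in>J. z i * z j * measure M (P i \<inter> P j))"
    unfolding F_def by (intro indicator_sums_integral J(1) PM(1); assumption)+
  have "integral\<^sup>L M (\<lambda>x. F x * F x) = overlap_form M J P (\<lambda>i. a i * measure M (E i))"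
    unfolding FF(2) overlap_form_def z_def overlap_def by (intro sum.cong refl) simp
  then have FG: "integral\<^sup>L M (\<lambda>x. F x * F x) \<le> A\<^sup>2 * G"
    using dual_boundedD[OF bd ad] by (simp add: G_def)
  have fF: "(\<lambda>x. f x * F x) = (\<lambda>x. \<Sum>i\<in>J. z i * (f x * indicat_real (P i) x))"
    unfolding F_def by (simp add: sum_distrib_left mult_ac)
  have ifF: "integrable M (\<lambda>x. f x * F x)"
    unfolding fF by (intro Bochner_Integration.integrable_sum integrable_mult_right fP)
  have "integral\<^sup>L M (\<lambda>x. f x * F x) = (\<Sum>i\<in>J. z i * (\<integral>x. f x * indicat_real (P i) x \<partial>M))"
    unfolding fF using fP by (subst Bochner_Integration.integral_sum) auto
  also have "\<dots> = G"
    unfolding G_def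
  proof (intro sum.cong refl)
    fix i assume "i \<in> J"
    then have "0 < measure M (P i)" by (rule PM)
    then show "z i * (\<integral>x. f x * indicat_real (P i) x \<partial>M) = (a i)\<^sup>2 * measure M (E i)"
      by (simp add: z_def a_def power2_eq_square)
  qed
  finally have G_eq: "integral\<^sup>L M (\<lambda>x. f x * F x) = G" .
  \<comment> \<open>With the weight \<open>A\<^sup>2\<close> the dual bound turns the second term
    into \<open>G\<close>, of which the left side contains two copies.\<close>
  have "(\<integral>x. 2 * (f x * F x) \<partial>M) \<le> (\<integral>x. A\<^sup>2 * (f x)\<^sup>2 + (F x * F x) / A\<^sup>2 \<partial>M)"
  proof (rule integral_mono)
    fix x
    have "0 \<le> (A * f x - F x / A)\<^sup>2" by simp
    also have "\<dots> = A\<^sup>2 * (f x)\<^sup>2 + (F x * F x) / A\<^sup>2 - 2 * (f x * F x)"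
      using A by (simp add: power2_eq_square field_simps)
    finally show "2 * (f x * F x) \<le> A\<^sup>2 * (f x)\<^sup>2 + (F x * F x) / A\<^sup>2" by simp
  qed (use ifF f2 FF(1) in auto)
  also have "\<dots> = A\<^sup>2 * (\<integral>x. (f x)\<^sup>2 \<partial>M) + (\<integral>x. F x * F x \<partial>M) / A\<^sup>2"
    using f2 FF(1) by simp
  also have "\<dots> \<le> A\<^sup>2 * (\<integral>x. (f x)\<^sup>2 \<partial>M) + G"
    using FG A by (simp add: divide_le_eq mult.commute)
  finally have "G \<le> A\<^sup>2 * (\<integral>x. (f x)\<^sup>2 \<partial>M)" using ifF G_eq by simp
  then have "ennreal G \<le> ennreal (A\<^sup>2) * (\<integral>\<^sup>+x. (ennreal (f x))\<^sup>2 \<partial>M)"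
    unfolding If2 by (simp add: ennreal_mult[symmetric] ennreal_leI)
  then show ?thesis using le by (rule order_trans[rotated])
qed

section \<open>Area-preserving coordinates of the plane\<close>

definition coords :: "real^2 \<Rightarrow> real \<times> real" where "coords x = (x $ 1, x $ 2)"
definition coords_swap :: "real^2 \<Rightarrow> real \<times> real" where "coords_swap x = (x $ 2, x $ 1)"

lemma borel_measurable_coords [measurable]: "coords \<in> borel \<rightarrow>\<^sub>M borel" "coords_swap \<in> borel \<rightarrow>\<^sub>M borel"
  unfolding coords_def[abs_def] coords_swap_def[abs_def]
  by (intro borel_measurable_continuous_onI continuous_intros)+

lemma borel_measurable_vec2 [measurable]:
  "(\<lambda>z. vector [fst z, snd z] :: real^2) \<in> borel \<rightarrow>\<^sub>M borel" "(\<lambda>z. vector [snd z, fst z] :: real^2) \<in> borel \<rightarrow>\<^sub>M borel"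
proof -
  have eq: "(\<lambda>z. fst z *\<^sub>R axis 1 1 + snd z *\<^sub>R axis 2 1) = (\<lambda>z. vector [fst z, snd z] :: real^2)"
    "(\<lambda>z. snd z *\<^sub>R axis 1 1 + fst z *\<^sub>R axis 2 1) = (\<lambda>z. vector [snd z, fst z] :: real^2)"
    by (auto simp: fun_eq_iff vec2_eq_iff axis_def)
  show "(\<lambda>z. vector [fst z, snd z] :: real^2) \<in> borel \<rightarrow>\<^sub>M borel" "(\<lambda>z. vector [snd z, fst z] :: real^2) \<in> borel \<rightarrow>\<^sub>M borel"
    unfolding eq[symmetric] by (intro borel_measurable_continuous_onI continuous_intros)+
qed

lemma emeasure_box_vec2:
  fixes l u :: "real^2" assumes "l $ 1 \<le> u $ 1" "l $ 2 \<le> u $ 2"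
  shows "emeasure lborel (box l u) = ennreal ((u $ 1 - l $ 1) * (u $ 2 - l $ 2))"
    "emeasure lborel (cbox l u) = ennreal ((u $ 1 - l $ 1) * (u $ 2 - l $ 2))"
proof -
  have "(\<Prod>b\<in>Basis. (u - l) \<bullet> b) = (u $ 1 - l $ 1) * (u $ 2 - l $ 2)"
    by (simp add: Basis_vec_def UNIV_2 axis_eq_axis inner_axis)
  moreover have "\<forall>b\<in>Basis. l \<bullet> b \<le> u \<bullet> b"
    using assms by (simp add: Basis_vec_def UNIV_2 inner_axis)
  ultimately show "emeasure lborel (box l u) = ennreal ((u $ 1 - l $ 1) * (u $ 2 - l $ 2))"
    "emeasure lborel (cbox l u) = ennreal ((u $ 1 - l $ 1) * (u $ 2 - l $ 2))"
    by simp_all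
qed

lemma box_prod: "box l u = box (fst l) (fst u) \<times> box (snd l) (snd u)" for l u :: "real \<times> real"
  by (cases l, cases u) (auto simp: box_def Basis_prod_def ball_Un inner_prod_def)

lemma distr_coords: "distr lborel lborel coords = lborel" "distr lborel lborel coords_swap = lborel"
proof -
  have prod: "ennreal (\<Prod>b\<in>Basis. (u - l) \<bullet> b) = ennreal ((fst u - fst l) * (snd u - snd l))"
    if "\<And>b. b \<in> Basis \<Longrightarrow> l \<bullet> b \<le> u \<bullet> b" for l u :: "real \<times> real"
  proof -
    have le: "fst l \<le> fst u" "snd l \<le> snd u" using that[of "(1,0)"] that[of "(0,1)"] by (auto simp: Basis_prod_def inner_prod_def)
    have "ennreal (\<Prod>b\<in>Basis. (u - l) \<bullet> b) = emeasure lborel (box l u)" using that by simp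
    also have "box l u = box (fst l) (fst u) \<times> box (snd l) (snd u)" by (rule box_prod)
    also have "emeasure lborel (box (fst l) (fst u) \<times> box (snd l) (snd u)) = ennreal (fst u - fst l) * ennreal (snd u - snd l)"
      unfolding lborel_prod[symmetric] using le by (subst lborel.emeasure_pair_measure_Times) auto
    finally show ?thesis using le by (simp add: ennreal_mult)
  qed
  have le: "fst l \<le> fst u \<and> snd l \<le> snd u" if "\<And>b. b \<in> Basis \<Longrightarrow> l \<bullet> b \<le> u \<bullet> b" for l u :: "real \<times> real"
    using that[of "(1,0)"] that[of "(0,1)"] by (auto simp: Basis_prod_def inner_prod_def)
  have "lborel = distr lborel lborel coords"
  proof (rule lborel_eqI)
    fix l u :: "real \<times> real" assume *: "\<And>b. b \<in> Basis \<Longrightarrow> l \<bullet> b \<le> u \<bullet> b"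
    have "coords -` box l u = box (vector [fst l, snd l]) (vector [fst u, snd u])"
      by (auto simp: coords_def box_prod mem_box_cart forall_2)
    moreover have pr: "ennreal (\<Prod>b\<in>Basis. (u - l) \<bullet> b) = ennreal ((fst u - fst l) * (snd u - snd l))"
      using * by (rule prod)
    moreover have le': "fst l \<le> fst u \<and> snd l \<le> snd u" using * by (rule le)
    ultimately have "emeasure (distr lborel lborel coords) (box l u) = emeasure lborel (box (vector [fst l, snd l]) (vector [fst u, snd u] :: real^2))"
      by (subst emeasure_distr) auto
    then show "emeasure (distr lborel lborel coords) (box l u) = ennreal (\<Prod>b\<in>Basis. (u - l) \<bullet> b)"
      using pr le' by (subst (asm) emeasure_box_vec2) auto
  qed simp
  then show "distr lborel lborel coords = lborel" by simp
  have "lborel = distr lborel lborel coords_swap"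
  proof (rule lborel_eqI)
    fix l u :: "real \<times> real" assume *: "\<And>b. b \<in> Basis \<Longrightarrow> l \<bullet> b \<le> u \<bullet> b"
    have "coords_swap -` box l u = box (vector [snd l, fst l]) (vector [snd u, fst u])"
      by (auto simp: coords_swap_def box_prod mem_box_cart forall_2)
    moreover have pr: "ennreal (\<Prod>b\<in>Basis. (u - l) \<bullet> b) = ennreal ((fst u - fst l) * (snd u - snd l))"
      using * by (rule prod)
    moreover have le': "fst l \<le> fst u \<and> snd l \<le> snd u" using * by (rule le)
    ultimately have "emeasure (distr lborel lborel coords_swap) (box l u) = emeasure lborel (box (vector [snd l, fst l]) (vector [snd u, fst u] :: real^2))"
      by (subst emeasure_distr) auto
    then show "emeasure (distr lborel lborel coords_swap) (box l u) = ennreal (\<Prod>b\<in>Basis. (u - l) \<bullet> b)"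
      using pr le' by (subst (asm) emeasure_box_vec2) (auto simp: mult.commute)
  qed simp
  then show "distr lborel lborel coords_swap = lborel" by simp
qed

subsection \<open>Rectangles with prescribed directions\<close>

text \<open>The isometries \<open>flip\<close> and \<open>flip_swap\<close> move the direction of the longer side of a rectangle, up to
  sign, to the right quarter of the circle. The longer side is perpendicular to the given direction in
  half of the cases.\<close>
definition flip :: "real \<Rightarrow> real \<Rightarrow> real^2 \<Rightarrow> real^2" where "flip \<epsilon> \<delta> u = vector [\<epsilon> * u $ 1, \<delta> * u $ 2]"
definition flip_swap :: "real \<Rightarrow> real \<Rightarrow> real^2 \<Rightarrow> real^2" where "flip_swap \<epsilon> \<delta> u = vector [\<epsilon> * u $ 2, \<delta> * u $ 1]"

lemma flip_nth [simp]:
  "flip \<epsilon> \<delta> u $ 1 = \<epsilon> * u $ 1" "flip \<epsilon> \<delta> u $ 2 = \<delta> * u $ 2"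
  "flip_swap \<epsilon> \<delta> u $ 1 = \<epsilon> * u $ 2" "flip_swap \<epsilon> \<delta> u $ 2 = \<delta> * u $ 1"
  by (simp_all add: flip_def flip_swap_def)

lemma flip_isometry:
  assumes "\<bar>\<epsilon>\<bar> = 1" "\<bar>\<delta>\<bar> = 1"
  shows "norm (flip \<epsilon> \<delta> u) = norm u" "norm (flip_swap \<epsilon> \<delta> u) = norm u"
    "dist (flip \<epsilon> \<delta> u) (flip \<epsilon> \<delta> v) = dist u v" "dist (flip_swap \<epsilon> \<delta> u) (flip_swap \<epsilon> \<delta> v) = dist u v"
proof -
  have sq: "\<epsilon>\<^sup>2 = 1" "\<delta>\<^sup>2 = 1" using assms by (simp_all add: abs_square_eq_1)
  have n: "norm (flip \<epsilon> \<delta> u) = norm u" "norm (flip_swap \<epsilon> \<delta> u) = norm u" for u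
  proof -
    have "(norm (flip \<epsilon> \<delta> u))\<^sup>2 = (norm u)\<^sup>2" "(norm (flip_swap \<epsilon> \<delta> u))\<^sup>2 = (norm u)\<^sup>2"
      by (simp_all add: norm_vec2_square power_mult_distrib sq)
    then show "norm (flip \<epsilon> \<delta> u) = norm u" "norm (flip_swap \<epsilon> \<delta> u) = norm u"
      by (simp_all add: power2_eq_iff_nonneg)
  qed
  have "flip \<epsilon> \<delta> u - flip \<epsilon> \<delta> v = flip \<epsilon> \<delta> (u - v)" "flip_swap \<epsilon> \<delta> u - flip_swap \<epsilon> \<delta> v = flip_swap \<epsilon> \<delta> (u - v)"
    by (simp_all add: vec2_eq_iff algebra_simps)
  then show "norm (flip \<epsilon> \<delta> u) = norm u" "norm (flip_swap \<epsilon> \<delta> u) = norm u"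
    "dist (flip \<epsilon> \<delta> u) (flip \<epsilon> \<delta> v) = dist u v" "dist (flip_swap \<epsilon> \<delta> u) (flip_swap \<epsilon> \<delta> v) = dist u v"
    using n by (simp_all add: dist_norm)
qed

text \<open>\<open>T\<close> selects the axis over which the long sides are graphs of slope at most
  1, and \<tau> turns a given direction into that of the long side in these coordinates, up to sign.
  For the isometries \<tau> in use, the composed slope is again a chart.\<close>

definition chart_parallelograms :: "(real^2 \<Rightarrow> real \<times> real) \<Rightarrow> (real^2 \<Rightarrow> real^2) \<Rightarrow> (real^2) set \<Rightarrow> (real^2) set set" where
  "chart_parallelograms T \<tau> \<Omega> = (\<lambda>P. T -` P) ` parallelograms ((\<lambda>u. slope (\<tau> u)) ` (\<Omega> \<inter> {u. norm u = 1 \<and> \<tau> u \<in> right_quarter}))"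

lemma coords_vimage_measure:
  assumes "X \<in> sets borel" "T = coords \<or> T = coords_swap"
  shows "emeasure lborel (T -` X) = emeasure lborel X" "T -` X \<in> sets borel"
proof -
  have T: "T \<in> borel \<rightarrow>\<^sub>M borel" "distr lborel lborel T = lborel" using assms(2) distr_coords by auto
  show "T -` X \<in> sets borel" using measurable_sets[OF T(1) assms(1)] by simp
  have "emeasure (distr lborel lborel T) X = emeasure lborel (T -` X)"
    using T(1) assms(1) by (subst emeasure_distr) auto
  then show "emeasure lborel (T -` X) = emeasure lborel X" using T(2) by simp
qed

lemma chart_parallelograms_fmeasurable:
  assumes "T = coords \<or> T = coords_swap"
  shows "chart_parallelograms T \<tau> \<Omega> \<subseteq> fmeasurable lborel"
proof
  fix P assume "P \<in> chart_parallelograms T \<tau> \<Omega>"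
  then obtain Q where Q: "P = T -` Q" "Q \<in> fmeasurable lborel"
    using parallelograms_fmeasurable unfolding chart_parallelograms_def by blast
  then show "P \<in> fmeasurable lborel"
    using coords_vimage_measure[OF _ assms, of Q] by (auto simp: fmeasurable_def)
qed

lemma dual_bounded_chart_parallelograms:
  assumes T: "T = coords \<or> T = coords_swap" and lac: "lacunary N \<Omega>"
    and iso: "\<And>u. norm (\<tau> u) = norm u" "\<And>u v. dist (\<tau> u) (\<tau> v) = dist u v"
  shows "dual_bounded lborel (chart_parallelograms T \<tau> \<Omega>) (901 + 336 * 21 * lacunary_const * real N)"
proof -
  let ?S = "if T = coords then (\<lambda>z. vector [fst z, snd z]) else (\<lambda>z. vector [snd z, fst z]) :: real \<times> real \<Rightarrow> real^2"
  show ?thesis unfolding chart_parallelograms_def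
  proof (rule dual_bounded_vimage[where S="?S" and N=lborel])
    show "T \<in> lborel \<rightarrow>\<^sub>M lborel" "distr lborel lborel T = lborel" using T distr_coords by auto
    show "?S \<in> lborel \<rightarrow>\<^sub>M lborel" by (simp split: if_split)
    show "?S (T x) = x" for x using T by (auto simp: coords_def coords_swap_def vec2_eq_iff)
    show "T (?S y) = y" for y using T by (auto simp: coords_def coords_swap_def)
    show "parallelograms ((\<lambda>u. slope (\<tau> u)) ` (\<Omega> \<inter> {u. norm u = 1 \<and> \<tau> u \<in> right_quarter})) \<subseteq> sets lborel"
      using parallelograms_fmeasurable by (auto dest!: subsetD simp: fmeasurable_def)
    show "dual_bounded lborel (parallelograms ((\<lambda>u. slope (\<tau> u)) ` (\<Omega> \<inter> {u. norm u = 1 \<and> \<tau> u \<in> right_quarter})))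
        (901 + 336 * 21 * lacunary_const * real N)"
      by (rule lacunary_bounded[OF chart_isometry[OF chart_slope iso] lac])
  qed auto
qed

definition rect :: "real^2 \<Rightarrow> real^2 \<Rightarrow> real^2 \<Rightarrow> real \<Rightarrow> real \<Rightarrow> (real^2) set" where
  "rect p u w a b = {p + s *\<^sub>R u + t *\<^sub>R w | s t. 0 \<le> s \<and> s \<le> a \<and> 0 \<le> t \<and> t \<le> b}"

lemma rectangles_alongE:
  assumes "R \<in> rectangles_along \<Omega>"
  obtains p u w a b where "R = rect p u w a b" "u \<in> \<Omega>" "norm u = 1" "norm w = 1" "u \<bullet> w = 0" "0 < a" "0 < b"
  using assms unfolding rectangles_along_def rect_def orthogonal_def by blast

lemma rectangles_alongI:
  "u \<in> \<Omega> \<Longrightarrow> norm u = 1 \<Longrightarrow> norm w = 1 \<Longrightarrow> u \<bullet> w = 0 \<Longrightarrow> 0 < a \<Longrightarrow> 0 < b \<Longrightarrow> rect p u w a b \<in> rectangles_along \<Omega>"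
  unfolding rectangles_along_def rect_def orthogonal_def by blast

lemma orthonormal_vec2:
  fixes u w :: "real^2"
  assumes "norm u = 1" "norm w = 1" "u \<bullet> w = 0"
  obtains c where "\<bar>c\<bar> = 1" "w $ 1 = - c * u $ 2" "w $ 2 = c * u $ 1"
proof -
  define c where "c = u $ 1 * w $ 2 - u $ 2 * w $ 1"
  have u: "(u $ 1)\<^sup>2 + (u $ 2)\<^sup>2 = 1" and w: "(w $ 1)\<^sup>2 + (w $ 2)\<^sup>2 = 1" and uw: "u $ 1 * w $ 1 + u $ 2 * w $ 2 = 0"
    using assms by (simp_all add: norm_vec2_eq_1_iff inner_vec2)
  have "w $ 1 = w $ 1 * ((u $ 1)\<^sup>2 + (u $ 2)\<^sup>2) - u $ 1 * (u $ 1 * w $ 1 + u $ 2 * w $ 2)" using u uw by simp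
  then have w1: "w $ 1 = - c * u $ 2" by (simp add: c_def power2_eq_square algebra_simps)
  have "w $ 2 = w $ 2 * ((u $ 1)\<^sup>2 + (u $ 2)\<^sup>2) - u $ 2 * (u $ 1 * w $ 1 + u $ 2 * w $ 2)" using u uw by simp
  then have w2: "w $ 2 = c * u $ 1" by (simp add: c_def power2_eq_square algebra_simps)
  have "c\<^sup>2 = c\<^sup>2 * ((u $ 1)\<^sup>2 + (u $ 2)\<^sup>2)" using u by simp
  also have "\<dots> = (w $ 1)\<^sup>2 + (w $ 2)\<^sup>2" unfolding w1 w2 by (simp add: power_mult_distrib algebra_simps)
  finally have "\<bar>c\<bar> = 1" using w by (simp add: abs_square_eq_1)
  then show ?thesis using w1 w2 that by blast
qed

lemma orthonormal_expansion_vec2: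
  fixes u w v :: "real^2"
  assumes "norm u = 1" "norm w = 1" "u \<bullet> w = 0"
  shows "v = (v \<bullet> u) *\<^sub>R u + (v \<bullet> w) *\<^sub>R w"
proof -
  obtain c where c: "\<bar>c\<bar> = 1" "w $ 1 = - c * u $ 2" "w $ 2 = c * u $ 1" using orthonormal_vec2[OF assms] .
  have c2: "c * c = 1" using c(1) by (simp add: abs_square_eq_1 flip: power2_eq_square)
  have u: "u $ 1 * u $ 1 + u $ 2 * u $ 2 = 1" using assms(1) by (simp add: norm_vec2_eq_1_iff power2_eq_square)
  have "(v \<bullet> u) * u $ 1 + (v \<bullet> w) * w $ 1 = v $ 1 * (u $ 1 * u $ 1 + (c * c) * (u $ 2 * u $ 2)) + v $ 2 * (u $ 1 * u $ 2) * (1 - c * c)"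
    unfolding inner_vec2 c by (simp add: algebra_simps)
  then have 1: "v $ 1 = (v \<bullet> u) * u $ 1 + (v \<bullet> w) * w $ 1" using u c2 by simp
  have "(v \<bullet> u) * u $ 2 + (v \<bullet> w) * w $ 2 = v $ 2 * (u $ 2 * u $ 2 + (c * c) * (u $ 1 * u $ 1)) + v $ 1 * (u $ 1 * u $ 2) * (1 - c * c)"
    unfolding inner_vec2 c by (simp add: algebra_simps)
  then have 2: "v $ 2 = (v \<bullet> u) * u $ 2 + (v \<bullet> w) * w $ 2" using u c2 by (simp add: add.commute)
  show ?thesis using 1 2 by (simp add: vec2_eq_iff)
qed

lemma rect_measure:
  assumes uw: "norm u = 1" "norm w = 1" "u \<bullet> w = 0" and ab: "0 < a" "0 < b"
  shows "rect p u w a b \<in> sets borel" "emeasure lborel (rect p u w a b) = ennreal (a * b)"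
proof -
  define f where "f z = z $ 1 *\<^sub>R u + z $ 2 *\<^sub>R w" for z :: "real^2"
  have "linear f" by (rule linearI) (simp_all add: f_def algebra_simps)
  moreover have "f v \<bullet> f z = v \<bullet> z" for v z
    using uw by (simp add: f_def inner_add_left inner_add_right inner_commute[of w u] norm_eq_1 inner_vec2[of v z])
  ultimately have f: "orthogonal_transformation f" by (simp add: orthogonal_transformation_def)
  define B where "B = cbox 0 (vector [a, b] :: real^2)"
  have R: "rect p u w a b = (+) p ` (f ` B)"
  proof (intro equalityI subsetI)
    fix x assume "x \<in> rect p u w a b"
    then obtain s t where st: "x = p + s *\<^sub>R u + t *\<^sub>R w" "0 \<le> s" "s \<le> a" "0 \<le> t" "t \<le> b" by (auto simp: rect_def)
    then have "x = p + f (vector [s, t])" "vector [s, t] \<in> B" by (simp_all add: f_def B_def mem_box_cart forall_2)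
    then show "x \<in> (+) p ` (f ` B)" by blast
  next
    fix x assume "x \<in> (+) p ` (f ` B)"
    then obtain z where "z \<in> B" "x = p + f z" by auto
    then show "x \<in> rect p u w a b"
      unfolding rect_def by (intro CollectI exI[of _ "z $ 1"] exI[of _ "z $ 2"]) (simp add: f_def B_def mem_box_cart forall_2)
  qed
  have "compact ((+) p ` (f ` B))"
    using \<open>linear f\<close> unfolding B_def
    by (intro compact_continuous_image continuous_intros linear_continuous_on compact_cbox) (simp add: linear_conv_bounded_linear)
  then have comp: "compact (rect p u w a b)" using R by simp
  then show bo: "rect p u w a b \<in> sets borel" by (simp add: borel_compact)
  have "measure lebesgue (rect p u w a b) = measure lebesgue (f ` B)" unfolding R by (rule measure_translation)
  also have "\<dots> = measure lebesgue B" by (rule measure_orthogonal_image[OF f]) (simp add: B_def)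
  also have "\<dots> = a * b"
    using emeasure_box_vec2(2)[of 0 "vector [a, b]"] ab unfolding B_def by (simp add: measure_def)
  finally have "measure lborel (rect p u w a b) = a * b" using bo by simp
  moreover have "emeasure lborel (rect p u w a b) < \<infinity>" using comp by (intro emeasure_bounded_finite compact_imp_bounded)
  ultimately show "emeasure lborel (rect p u w a b) = ennreal (a * b)"
    by (simp add: emeasure_eq_ennreal_measure)
qed

text \<open>The first coordinate moves by at most \<open>L + W \<le> 2 * L\<close>. Subtracting
  \<open>m\<close> times it cancels the motion along the long side, and as the slope is at most 1
  the rest is at most \<open>2 * W\<close>. The resulting area \<open>4 * L * (4 * W)\<close> is the
  origin of the factor 16.\<close>

lemma strip_point_in_parallelogram:
  fixes px py dx dy ex ey s t L W m :: real
  assumes "dx \<noteq> 0" "\<bar>dy\<bar> \<le> \<bar>dx\<bar>" "\<bar>dx\<bar> \<le> 1" "\<bar>ex\<bar> \<le> 1" "\<bar>ey\<bar> \<le> 1" "W \<le> L" "m = dy / dx" "\<bar>s\<bar> \<le> L" "\<bar>t\<bar> \<le> W"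
  shows "(px + s * dx + t * ex, py + s * dy + t * ey) \<in> parallelogram m (px - 2 * L) (px + 2 * L) (py - m * px - 2 * W) (py - m * px + 2 * W)"
proof -
  have "\<bar>s * dx\<bar> \<le> L * 1" "\<bar>t * ex\<bar> \<le> W * 1" unfolding abs_mult using assms by (intro mult_mono; linarith)+
  then have x: "\<bar>s * dx + t * ex\<bar> \<le> 2 * L" using assms by linarith
  have m: "\<bar>m\<bar> \<le> 1" "m * dx = dy" using assms by (auto simp: abs_divide divide_le_eq)
  have "\<bar>m * ex\<bar> \<le> 1 * 1" unfolding abs_mult using assms m by (intro mult_mono) linarith+
  then have "\<bar>ey - m * ex\<bar> \<le> 2" using assms by linarith
  then have "\<bar>t * (ey - m * ex)\<bar> \<le> W * 2" unfolding abs_mult using assms by (intro mult_mono) linarith+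
  moreover have "py + s * dy + t * ey - m * (px + s * dx + t * ex) = (py - m * px) + t * (ey - m * ex)"
    unfolding m(2)[symmetric] by (simp add: algebra_simps)
  ultimately have "\<bar>py + s * dy + t * ey - m * (px + s * dx + t * ex) - (py - m * px)\<bar> \<le> 2 * W" by linarith
  then show ?thesis using x unfolding parallelogram_def by (simp add: abs_le_iff)
qed

text \<open>The long side \<open>d\<close> may be \<open>u\<close> or its perpendicular. In the
  coordinates \<open>T\<close> it agrees with \<open>\<tau> u\<close> up to the sign \<epsilon>,
  which a slope does not see.\<close>

lemma strip_subset_chart_parallelograms:
  fixes d e p u :: "real^2"
  assumes T: "T = coords \<or> T = coords_swap" and u: "u \<in> \<Omega>" "norm u = 1"
    and \<tau>: "norm (\<tau> u) = norm u" "\<tau> u $ 1 = \<epsilon> * fst (T d)" "\<tau> u $ 2 = \<epsilon> * snd (T d)" "\<bar>\<epsilon>\<bar> = 1" "0 < \<epsilon> * fst (T d)"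
    and d: "\<bar>snd (T d)\<bar> \<le> \<bar>fst (T d)\<bar>" and nrm: "norm d = 1" "norm e = 1" and LW: "0 < W" "W \<le> L"
    and R: "\<And>x. x \<in> R \<Longrightarrow> \<exists>s t. x = p + s *\<^sub>R d + t *\<^sub>R e \<and> \<bar>s\<bar> \<le> L \<and> \<bar>t\<bar> \<le> W"
  shows "\<exists>P\<in>chart_parallelograms T \<tau> \<Omega>. R \<subseteq> P \<and> measure lborel P \<le> 16 * (L * W)"
proof -
  have le1: "\<bar>fst (T z)\<bar> \<le> norm z" "\<bar>snd (T z)\<bar> \<le> norm z" for z
    using T component_le_norm_cart[of z] by (auto simp: coords_def coords_swap_def)
  have lin: "fst (T (p + s *\<^sub>R d + t *\<^sub>R e)) = fst (T p) + s * fst (T d) + t * fst (T e)"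
    "snd (T (p + s *\<^sub>R d + t *\<^sub>R e)) = snd (T p) + s * snd (T d) + t * snd (T e)" for s t
    using T by (auto simp: coords_def coords_swap_def)
  have ne: "fst (T d) \<noteq> 0" "\<epsilon> \<noteq> 0" using \<tau> by auto
  have "\<bar>\<tau> u $ 2\<bar> \<le> \<bar>\<tau> u $ 1\<bar>" unfolding \<tau>(2,3) abs_mult \<tau>(4) using d by simp
  then have "\<bar>\<tau> u $ 2\<bar> \<le> \<tau> u $ 1" using \<tau>(2,5) by simp
  then have rq: "\<tau> u \<in> right_quarter" using \<tau>(1) u(2) by (simp add: right_quarter_def)
  define m where "m = snd (T d) / fst (T d)"
  have sl: "slope (\<tau> u) = m" unfolding right_quarter_nth1(2)[OF rq] \<tau>(2,3) m_def using ne by simp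
  define Q where "Q = parallelogram m (fst (T p) - 2 * L) (fst (T p) + 2 * L) (snd (T p) - m * fst (T p) - 2 * W) (snd (T p) - m * fst (T p) + 2 * W)"
  have "m \<in> (\<lambda>u. slope (\<tau> u)) ` (\<Omega> \<inter> {u. norm u = 1 \<and> \<tau> u \<in> right_quarter})"
    using sl u rq by blast
  then have "Q \<in> parallelograms ((\<lambda>u. slope (\<tau> u)) ` (\<Omega> \<inter> {u. norm u = 1 \<and> \<tau> u \<in> right_quarter}))"
    unfolding Q_def using LW by (intro parsI) auto
  then have 1: "T -` Q \<in> chart_parallelograms T \<tau> \<Omega>" unfolding chart_parallelograms_def by blast
  have Qm: "measure lborel Q = 16 * (L * W)" "Q \<in> fmeasurable lborel"
    unfolding Q_def using LW by (simp_all add: measure_parallelogram)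
  have 2: "measure lborel (T -` Q) \<le> 16 * (L * W)"
    using coords_vimage_measure(1)[OF _ T, of Q] Qm by (simp add: measure_def fmeasurable_def)
  have "x \<in> T -` Q" if xR: "x \<in> R" for x
  proof -
    obtain s t where x: "x = p + s *\<^sub>R d + t *\<^sub>R e" "\<bar>s\<bar> \<le> L" "\<bar>t\<bar> \<le> W" using R[OF xR] by blast
    have "T x = (fst (T p) + s * fst (T d) + t * fst (T e), snd (T p) + s * snd (T d) + t * snd (T e))"
      unfolding x(1) using lin by (simp add: prod_eq_iff)
    also have "\<dots> \<in> Q" unfolding Q_def
      using ne d le1[of d] le1[of e] nrm LW x by (intro strip_point_in_parallelogram) (auto simp: m_def)
    finally show ?thesis by simp
  qed
  then show ?thesis using 1 2 by blast
qed

lemma sign_cases: fixes x :: real assumes "x \<noteq> 0" obtains \<epsilon> where "\<epsilon> = 1 \<or> \<epsilon> = -1" "0 < \<epsilon> * x"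
  using assms that[of 1] that[of "-1"] by (cases "0 < x") auto

text \<open>Two choices of the axis, two for the longer side, along or across the given direction,
  and a sign. The unions are nested to depth three, so that \<open>dual_bounded_Un\<close> costs the
  factor 8.\<close>

definition all_chart_parallelograms :: "(real^2) set \<Rightarrow> (real^2) set set" where
  "all_chart_parallelograms \<Omega> =
    ((chart_parallelograms coords (flip 1 1) \<Omega> \<union> chart_parallelograms coords (flip (-1) (-1)) \<Omega>) \<union>
     (chart_parallelograms coords (flip_swap (-1) 1) \<Omega> \<union> chart_parallelograms coords (flip_swap 1 (-1)) \<Omega>)) \<union>
    ((chart_parallelograms coords_swap (flip_swap 1 1) \<Omega> \<union> chart_parallelograms coords_swap (flip_swap (-1) (-1)) \<Omega>) \<union>
     (chart_parallelograms coords_swap (flip 1 (-1)) \<Omega> \<union> chart_parallelograms coords_swap (flip (-1) 1) \<Omega>))"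

lemma rectangle_subset_chart_parallelograms:
  assumes "R \<in> rectangles_along \<Omega>"
  shows "\<exists>P\<in>all_chart_parallelograms \<Omega>. R \<subseteq> P \<and> measure lborel P \<le> 16 * measure lborel R"
proof -
  obtain p u w a b where R: "R = rect p u w a b" and u: "u \<in> \<Omega>" "norm u = 1" and w: "norm w = 1" "u \<bullet> w = 0"
    and ab: "0 < a" "0 < b" using assms by (rule rectangles_alongE)
  have mR: "measure lborel R = a * b" using rect_measure(2)[OF u(2) w ab] ab R by (simp add: measure_def)
  obtain c where c: "\<bar>c\<bar> = 1" "w $ 1 = - c * u $ 2" "w $ 2 = c * u $ 1" using orthonormal_vec2[OF u(2) w] .
  have c': "c = 1 \<or> c = -1" using c(1) by linarith
  have nz: "z \<noteq> 0 \<Longrightarrow> \<bar>z $ 2\<bar> \<le> \<bar>z $ 1\<bar> \<Longrightarrow> z $ 1 \<noteq> 0" "z \<noteq> 0 \<Longrightarrow> \<bar>z $ 1\<bar> \<le> \<bar>z $ 2\<bar> \<Longrightarrow> z $ 2 \<noteq> 0" for z :: "real^2"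
    by (auto simp: vec2_eq_iff)
  have u0: "u \<noteq> 0" "w \<noteq> 0" using u w by auto
  note iso = flip_isometry(1,2)
  show ?thesis
  proof (cases "b \<le> a")
    case True
    have st: "\<exists>s t. x = p + s *\<^sub>R u + t *\<^sub>R w \<and> \<bar>s\<bar> \<le> a \<and> \<bar>t\<bar> \<le> b" if x: "x \<in> R" for x
    proof -
      obtain s t where "x = p + s *\<^sub>R u + t *\<^sub>R w" "0 \<le> s" "s \<le> a" "0 \<le> t" "t \<le> b" using x unfolding R rect_def by auto
      then show ?thesis by (intro exI[of _ s] exI[of _ t]) simp
    qed
    note main = strip_subset_chart_parallelograms[where d=u and e=w and p=p and L=a and W=b and u=u and \<Omega>=\<Omega> and R=R,
        OF _ u _ _ _ _ _ _ u(2) w(1) ab(2) True st]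
    show ?thesis
    proof (cases "\<bar>u $ 2\<bar> \<le> \<bar>u $ 1\<bar>")
      case le: True
      obtain \<epsilon> where \<epsilon>: "\<epsilon> = 1 \<or> \<epsilon> = -1" "0 < \<epsilon> * u $ 1" using sign_cases[OF nz(1)[OF u0(1) le]] .
      have "\<exists>P\<in>chart_parallelograms coords (flip \<epsilon> \<epsilon>) \<Omega>. R \<subseteq> P \<and> measure lborel P \<le> 16 * (a * b)"
        by (rule main[where \<epsilon>=\<epsilon>]) (use \<epsilon> le iso in \<open>auto simp: coords_def\<close>)
      then obtain P where P: "P \<in> chart_parallelograms coords (flip \<epsilon> \<epsilon>) \<Omega>" "R \<subseteq> P" "measure lborel P \<le> 16 * (a * b)" by blast
      then have "P \<in> all_chart_parallelograms \<Omega>" using \<epsilon>(1) by (auto simp: all_chart_parallelograms_def)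
      then show ?thesis using P unfolding mR by blast
    next
      case False
      then have le: "\<bar>u $ 1\<bar> \<le> \<bar>u $ 2\<bar>" by simp
      obtain \<epsilon> where \<epsilon>: "\<epsilon> = 1 \<or> \<epsilon> = -1" "0 < \<epsilon> * u $ 2" using sign_cases[OF nz(2)[OF u0(1) le]] .
      have "\<exists>P\<in>chart_parallelograms coords_swap (flip_swap \<epsilon> \<epsilon>) \<Omega>. R \<subseteq> P \<and> measure lborel P \<le> 16 * (a * b)"
        by (rule main[where \<epsilon>=\<epsilon>]) (use \<epsilon> le iso in \<open>auto simp: coords_swap_def\<close>)
      then obtain P where P: "P \<in> chart_parallelograms coords_swap (flip_swap \<epsilon> \<epsilon>) \<Omega>" "R \<subseteq> P" "measure lborel P \<le> 16 * (a * b)" by blast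
      then have "P \<in> all_chart_parallelograms \<Omega>" using \<epsilon>(1) by (auto simp: all_chart_parallelograms_def)
      then show ?thesis using P unfolding mR by blast
    qed
  next
    case False
    then have ba: "a \<le> b" by simp
    have st: "\<exists>s t. x = p + s *\<^sub>R w + t *\<^sub>R u \<and> \<bar>s\<bar> \<le> b \<and> \<bar>t\<bar> \<le> a" if x: "x \<in> R" for x
    proof -
      obtain s t where "x = p + s *\<^sub>R u + t *\<^sub>R w" "0 \<le> s" "s \<le> a" "0 \<le> t" "t \<le> b" using x unfolding R rect_def by auto
      then show ?thesis by (intro exI[of _ t] exI[of _ s]) (simp add: add_ac)
    qed
    note main = strip_subset_chart_parallelograms[where d=w and e=u and p=p and L=b and W=a and u=u and \<Omega>=\<Omega> and R=R,
        OF _ u _ _ _ _ _ _ w(1) u(2) ab(1) ba st]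
    show ?thesis
    proof (cases "\<bar>w $ 2\<bar> \<le> \<bar>w $ 1\<bar>")
      case le: True
      obtain \<epsilon> where \<epsilon>: "\<epsilon> = 1 \<or> \<epsilon> = -1" "0 < \<epsilon> * w $ 1" using sign_cases[OF nz(1)[OF u0(2) le]] .
      \<comment> \<open>Since \<open>w\<close> is \<open>c\<close> times the rotation of
        \<open>u\<close> by a right angle, \<open>\<epsilon> *\<^sub>R w\<close> has the coordinates
        \<open>- (\<epsilon> * c) * u $ 2\<close> and \<open>\<epsilon> * c * u $ 1\<close>.\<close>
      have "\<exists>P\<in>chart_parallelograms coords (flip_swap (- (\<epsilon> * c)) (\<epsilon> * c)) \<Omega>. R \<subseteq> P \<and> measure lborel P \<le> 16 * (b * a)"
        by (rule main[where \<epsilon>=\<epsilon>]) (use \<epsilon> le iso c c' in \<open>auto simp: coords_def\<close>)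
      then obtain P where P: "P \<in> chart_parallelograms coords (flip_swap (- (\<epsilon> * c)) (\<epsilon> * c)) \<Omega>" "R \<subseteq> P" "measure lborel P \<le> 16 * (b * a)" by blast
      then have "P \<in> all_chart_parallelograms \<Omega>" using \<epsilon>(1) c' by (auto simp: all_chart_parallelograms_def)
      then show ?thesis using P unfolding mR mult.commute[of a b] by blast
    next
      case False
      then have le: "\<bar>w $ 1\<bar> \<le> \<bar>w $ 2\<bar>" by simp
      obtain \<epsilon> where \<epsilon>: "\<epsilon> = 1 \<or> \<epsilon> = -1" "0 < \<epsilon> * w $ 2" using sign_cases[OF nz(2)[OF u0(2) le]] .
      have "\<exists>P\<in>chart_parallelograms coords_swap (flip (\<epsilon> * c) (- (\<epsilon> * c))) \<Omega>. R \<subseteq> P \<and> measure lborel P \<le> 16 * (b * a)"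
        by (rule main[where \<epsilon>=\<epsilon>]) (use \<epsilon> le iso c c' in \<open>auto simp: coords_swap_def\<close>)
      then obtain P where P: "P \<in> chart_parallelograms coords_swap (flip (\<epsilon> * c) (- (\<epsilon> * c))) \<Omega>" "R \<subseteq> P" "measure lborel P \<le> 16 * (b * a)" by blast
      then have "P \<in> all_chart_parallelograms \<Omega>" using \<epsilon>(1) c' by (auto simp: all_chart_parallelograms_def)
      then show ?thesis using P unfolding mR mult.commute[of a b] by blast
    qed
  qed
qed

lemma all_chart_parallelograms_fmeasurable: "all_chart_parallelograms \<Omega> \<subseteq> fmeasurable lborel"
  unfolding all_chart_parallelograms_def using chart_parallelograms_fmeasurable by (simp add: le_sup_iff)

lemma rectangles_along_fmeasurable:
  "R \<in> rectangles_along \<Omega> \<Longrightarrow> R \<in> fmeasurable lborel \<and> 0 < measure lborel R \<and> R \<in> sets borel"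
  using rect_measure by (auto elim!: rectangles_alongE simp: fmeasurable_def measure_def)

text \<open>\<open>128 = 8 * 16\<close>: the union of eight families, and the ratio of areas in the
  covering of rectangles by parallelograms.\<close>

lemma dual_bounded_rectangles_along:
  assumes "lacunary N \<Omega>"
  shows "dual_bounded lborel (rectangles_along \<Omega>) (128 * (901 + 336 * 21 * lacunary_const * real N))"
proof -
  define B where "B = 901 + 336 * 21 * lacunary_const * real N"
  have c: "dual_bounded lborel (chart_parallelograms T (flip \<epsilon> \<delta>) \<Omega>) B" "dual_bounded lborel (chart_parallelograms T (flip_swap \<epsilon> \<delta>) \<Omega>) B"
    if "T = coords \<or> T = coords_swap" "\<bar>\<epsilon>\<bar> = 1" "\<bar>\<delta>\<bar> = 1" for T \<epsilon> \<delta>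
    unfolding B_def using that assms flip_isometry by (intro dual_bounded_chart_parallelograms; simp)+
  have "dual_bounded lborel (all_chart_parallelograms \<Omega>) (2 * (2 * (2 * B)))"
    unfolding all_chart_parallelograms_def
    by (intro dual_bounded_Un c) (use all_chart_parallelograms_fmeasurable[of \<Omega>] in \<open>auto simp: all_chart_parallelograms_def le_sup_iff\<close>)
  then have "dual_bounded lborel (rectangles_along \<Omega>) (16 * (2 * (2 * (2 * B))))"
    by (rule dual_bounded_dominated)
      (use all_chart_parallelograms_fmeasurable rectangles_along_fmeasurable rectangle_subset_chart_parallelograms in auto)
  then show ?thesis by (simp add: B_def)
qed

section \<open>From finite to arbitrary families of rectangles\<close>

definition avg :: "(real^2 \<Rightarrow> real) \<Rightarrow> (real^2) set \<Rightarrow> ennreal" where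
  "avg g R = (\<integral>\<^sup>+y\<in>R. ennreal (g y) \<partial>lborel) / emeasure lborel R"

lemma ball_subset_enlarged_rect:
  assumes uw: "norm u = 1" "norm w = 1" "u \<bullet> w = 0" and x: "x \<in> rect p u w a b"
  shows "ball x \<epsilon> \<subseteq> rect (p - \<epsilon> *\<^sub>R u - \<epsilon> *\<^sub>R w) u w (a + 2 * \<epsilon>) (b + 2 * \<epsilon>)"
proof
  fix y assume y: "y \<in> ball x \<epsilon>"
  obtain s t where st: "x = p + s *\<^sub>R u + t *\<^sub>R w" "0 \<le> s" "s \<le> a" "0 \<le> t" "t \<le> b" using x by (auto simp: rect_def)
  have n: "norm (y - x) < \<epsilon>" using y by (simp add: dist_norm norm_minus_commute)
  have "\<bar>(y - x) \<bullet> u\<bar> < \<epsilon>" "\<bar>(y - x) \<bullet> w\<bar> < \<epsilon>"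
    using Cauchy_Schwarz_ineq2[of "y - x" u] Cauchy_Schwarz_ineq2[of "y - x" w] n uw by simp_all
  then have le: "-\<epsilon> < (y - x) \<bullet> u" "(y - x) \<bullet> u < \<epsilon>" "-\<epsilon> < (y - x) \<bullet> w" "(y - x) \<bullet> w < \<epsilon>" by linarith+
  have "y = x + (((y - x) \<bullet> u) *\<^sub>R u + ((y - x) \<bullet> w) *\<^sub>R w)"
    using orthonormal_expansion_vec2[OF uw, of "y - x"] by simp
  also have "\<dots> = p - \<epsilon> *\<^sub>R u - \<epsilon> *\<^sub>R w + (s + (y - x) \<bullet> u + \<epsilon>) *\<^sub>R u + (t + (y - x) \<bullet> w + \<epsilon>) *\<^sub>R w"
    unfolding st(1) by (simp add: algebra_simps)
  finally show "y \<in> rect (p - \<epsilon> *\<^sub>R u - \<epsilon> *\<^sub>R w) u w (a + 2 * \<epsilon>) (b + 2 * \<epsilon>)"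
    unfolding rect_def
    by (intro CollectI exI[of _ "s + (y - x) \<bullet> u + \<epsilon>"] exI[of _ "t + (y - x) \<bullet> w + \<epsilon>"] conjI; (assumption | use le st in linarith))
qed

lemma rect_subset_enlarged:
  assumes "0 < \<epsilon>"
  shows "rect p u w a b \<subseteq> rect (p - \<epsilon> *\<^sub>R u - \<epsilon> *\<^sub>R w) u w (a + 2 * \<epsilon>) (b + 2 * \<epsilon>)"
proof
  fix x assume "x \<in> rect p u w a b"
  then obtain s t where st: "x = p + s *\<^sub>R u + t *\<^sub>R w" "0 \<le> s" "s \<le> a" "0 \<le> t" "t \<le> b" by (auto simp: rect_def)
  have "x = p - \<epsilon> *\<^sub>R u - \<epsilon> *\<^sub>R w + (s + \<epsilon>) *\<^sub>R u + (t + \<epsilon>) *\<^sub>R w" unfolding st(1) by (simp add: algebra_simps)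
  then show "x \<in> rect (p - \<epsilon> *\<^sub>R u - \<epsilon> *\<^sub>R w) u w (a + 2 * \<epsilon>) (b + 2 * \<epsilon>)"
    unfolding rect_def
    by (intro CollectI exI[of _ "s + \<epsilon>"] exI[of _ "t + \<epsilon>"] conjI; (assumption | use assms st in linarith))
qed

text \<open>A slight enlargement costs arbitrarily little of the mean and moves the point to the
  interior. This makes superlevel sets of the maximal function open and admits open covers, although
  the rectangles are closed.\<close>

lemma rectangle_enlarge:
  assumes R: "R \<in> rectangles_along \<Omega>" and x: "x \<in> R" and l: "l < avg g R"
  obtains R' where "R' \<in> rectangles_along \<Omega>" "x \<in> interior R'" "l < avg g R'"
proof -
  obtain p u w a b where Req: "R = rect p u w a b" and u: "u \<in> \<Omega>" "norm u = 1" and w: "norm w = 1" "u \<bullet> w = 0"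
    and ab: "0 < a" "0 < b" using R by (rule rectangles_alongE)
  note uw = u(2) w
  define I where "I = (\<integral>\<^sup>+y\<in>R. ennreal (g y) \<partial>lborel)"
  have avgR: "avg g R = I / ennreal (a * b)"
    unfolding avg_def I_def Req rect_measure(2)[OF uw ab] ..
  have "\<exists>\<epsilon>>0. l < I / ennreal ((a + 2 * \<epsilon>) * (b + 2 * \<epsilon>))"
  proof (cases "I = \<infinity>")
    case True
    have "l < \<infinity>" using l by (rule less_le_trans) simp
    then show ?thesis using True ab by (intro exI[of _ 1]) (simp add: ennreal_top_divide)
  next
    case False
    then obtain r where r: "I = ennreal r" "0 \<le> r" by (cases I) auto
    have "l < ennreal (r / (a * b))" using l r ab unfolding avgR by (simp add: divide_ennreal)
    then obtain l' where l': "l = ennreal l'" "0 \<le> l'" by (cases l) auto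
    then have lt: "l' < r / (a * b)" using \<open>l < ennreal (r / (a * b))\<close> by (simp add: ennreal_less_iff)
    have "((\<lambda>\<epsilon>. r / ((a + 2 * \<epsilon>) * (b + 2 * \<epsilon>))) \<longlongrightarrow> r / ((a + 2 * 0) * (b + 2 * 0))) (at_right 0)"
      using ab by (intro tendsto_intros) auto
    then have "\<forall>\<^sub>F \<epsilon> in at_right 0. l' < r / ((a + 2 * \<epsilon>) * (b + 2 * \<epsilon>))"
      by (rule order_tendstoD) (use lt in simp)
    then have "\<forall>\<^sub>F \<epsilon> in at_right 0. 0 < \<epsilon> \<and> l' < r / ((a + 2 * \<epsilon>) * (b + 2 * \<epsilon>))"
      using eventually_at_right_less[of "0::real"] by eventually_elim simp
    then obtain \<epsilon> where e: "0 < \<epsilon>" "l' < r / ((a + 2 * \<epsilon>) * (b + 2 * \<epsilon>))"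
      using eventually_happens[of _ "at_right (0::real)"] by (auto simp: trivial_limit_at_right_real)
    then have "l < I / ennreal ((a + 2 * \<epsilon>) * (b + 2 * \<epsilon>))"
      using ab r l' by (simp add: divide_ennreal ennreal_less_iff)
    then show ?thesis using e by blast
  qed
  then obtain \<epsilon> where e: "0 < \<epsilon>" "l < I / ennreal ((a + 2 * \<epsilon>) * (b + 2 * \<epsilon>))" by blast
  define R' where "R' = rect (p - \<epsilon> *\<^sub>R u - \<epsilon> *\<^sub>R w) u w (a + 2 * \<epsilon>) (b + 2 * \<epsilon>)"
  have ab': "0 < a + 2 * \<epsilon>" "0 < b + 2 * \<epsilon>" using ab e by auto
  have "I \<le> (\<integral>\<^sup>+y\<in>R'. ennreal (g y) \<partial>lborel)"
    unfolding I_def using rect_subset_enlarged[OF e(1), of p u w a b] unfolding Req R'_def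
    by (intro nn_integral_mono) (auto simp: indicator_def)
  then have "I / ennreal ((a + 2 * \<epsilon>) * (b + 2 * \<epsilon>)) \<le> avg g R'"
    unfolding avg_def R'_def rect_measure(2)[OF uw ab'] by (rule divide_right_mono_ennreal)
  then have 1: "l < avg g R'" using e(2) by (rule order.strict_trans2[rotated])
  have 2: "R' \<in> rectangles_along \<Omega>" unfolding R'_def by (intro rectangles_alongI u w ab')
  have "ball x \<epsilon> \<subseteq> R'" unfolding R'_def using x unfolding Req by (rule ball_subset_enlarged_rect[OF uw])
  then have "x \<in> interior R'" using e(1) by (auto simp: mem_interior)
  then show ?thesis using that 1 2 by blast
qed

definition max_avg :: "(real^2) set \<Rightarrow> (real^2 \<Rightarrow> real) \<Rightarrow> real^2 \<Rightarrow> ennreal" where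
  "max_avg \<Omega> g x = (SUP R\<in>{R\<in>rectangles_along \<Omega>. x \<in> R}. avg g R)"

lemma borel_measurable_max_avg: "max_avg \<Omega> g \<in> borel_measurable borel"
proof (rule borel_measurableI_greater)
  fix l
  have "open {x. l < max_avg \<Omega> g x}"
    unfolding open_subopen[of "{x. l < max_avg \<Omega> g x}"]
  proof
    fix x assume "x \<in> {x. l < max_avg \<Omega> g x}"
    then obtain R where "R \<in> rectangles_along \<Omega>" "x \<in> R" "l < avg g R" by (auto simp: max_avg_def less_SUP_iff)
    then obtain R' where R': "R' \<in> rectangles_along \<Omega>" "x \<in> interior R'" "l < avg g R'" by (rule rectangle_enlarge)
    have "interior R' \<subseteq> {x. l < max_avg \<Omega> g x}"
      using R' interior_subset[of R'] by (auto simp: max_avg_def less_SUP_iff)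
    then show "\<exists>T. open T \<and> x \<in> T \<and> T \<subseteq> {x. l < max_avg \<Omega> g x}" using R'(2) by blast
  qed
  then show "{x \<in> space borel. l < max_avg \<Omega> g x} \<in> sets borel" by simp
qed

text \<open>At each rational level, by Lindelof, the interiors of countably many rectangles with
  means above the level cover the same set as all of them. As rational levels are dense, the union
  of these countable families has the same supremum at every point.\<close>

lemma max_avg_countable:
  "\<exists>\<C>. countable \<C> \<and> \<C> \<subseteq> rectangles_along \<Omega> \<and>
    (\<forall>x. max_avg \<Omega> g x = (SUP R\<in>{R\<in>\<C>. x \<in> R}. avg g R))"
proof -
  define \<F> where "\<F> q = {R \<in> rectangles_along \<Omega>. ennreal (real_of_rat q) < avg g R}" for q
  have "\<exists>\<C>. countable \<C> \<and> \<C> \<subseteq> \<F> q \<and> (\<Union>R\<in>\<C>. interior R) = (\<Union>R\<in>\<F> q. interior R)" for q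
  proof -
    obtain \<G> where G: "\<G> \<subseteq> interior ` \<F> q" "countable \<G>" "\<Union>\<G> = \<Union>(interior ` \<F> q)"
      using Lindelof[of "interior ` \<F> q"] by auto
    obtain \<C> where "countable \<C>" "\<C> \<subseteq> \<F> q" "\<G> = interior ` \<C>"
      using G(1,2) countable_subset_image[of \<G> interior "\<F> q"] by auto
    then show ?thesis using G(3) by auto
  qed
  then obtain \<C> where C: "\<And>q. countable (\<C> q)" "\<And>q. \<C> q \<subseteq> \<F> q"
      "\<And>q. (\<Union>R\<in>\<C> q. interior R) = (\<Union>R\<in>\<F> q. interior R)" by metis
  define \<D> where "\<D> = (\<Union>q. \<C> q)"
  have sub: "\<D> \<subseteq> rectangles_along \<Omega>" using C(2) by (auto simp: \<D>_def \<F>_def)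
  have "max_avg \<Omega> g x = (SUP R\<in>{R\<in>\<D>. x \<in> R}. avg g R)" for x
  proof (rule antisym)
    show "(SUP R\<in>{R\<in>\<D>. x \<in> R}. avg g R) \<le> max_avg \<Omega> g x"
      unfolding max_avg_def using sub by (intro SUP_subset_mono) auto
    show "max_avg \<Omega> g x \<le> (SUP R\<in>{R\<in>\<D>. x \<in> R}. avg g R)"
    proof (rule dense_le)
      fix l assume "l < max_avg \<Omega> g x"
      then obtain R where R: "R \<in> rectangles_along \<Omega>" "x \<in> R" "l < avg g R" by (auto simp: max_avg_def less_SUP_iff)
      obtain q where q: "l < ennreal (real_of_rat q)" "ennreal (real_of_rat q) < avg g R"
        using ennreal_rat_dense[OF R(3)] by auto
      obtain R' where "R' \<in> rectangles_along \<Omega>" "x \<in> interior R'" "ennreal (real_of_rat q) < avg g R'"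
        using R(1,2) q(2) by (rule rectangle_enlarge)
      then have "x \<in> (\<Union>R\<in>\<F> q. interior R)" by (auto simp: \<F>_def)
      then obtain R'' where R'': "R'' \<in> \<C> q" "x \<in> interior R''" using C(3) by blast
      then have "x \<in> R''" using interior_subset by blast
      have "ennreal (real_of_rat q) < avg g R''" using C(2)[of q] R''(1) unfolding \<F>_def by blast
      then have "l \<le> avg g R''" using less_trans[OF q(1)] by (intro less_imp_le) blast
      also have "\<dots> \<le> (SUP R\<in>{R\<in>\<D>. x \<in> R}. avg g R)"
        using R''(1) \<open>x \<in> R''\<close> by (intro SUP_upper) (auto simp: \<D>_def)
      finally show "l \<le> (SUP R\<in>{R\<in>\<D>. x \<in> R}. avg g R)" .
    qed
  qed
  moreover have "countable \<D>" unfolding \<D>_def using C(1) by (intro countable_UN) auto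
  ultimately show ?thesis using sub by blast
qed

lemma SUP_power2_incseq:
  fixes s :: "nat \<Rightarrow> ennreal" assumes "incseq s"
  shows "(SUP n. s n)\<^sup>2 \<le> (SUP n. (s n)\<^sup>2)"
proof -
  have "(SUP n. s n)\<^sup>2 = (SUP m. SUP n. s n * s m)"
    by (simp add: power2_eq_square SUP_mult_left_ennreal SUP_mult_right_ennreal)
  also have "\<dots> \<le> (SUP n. (s n)\<^sup>2)"
  proof (intro SUP_least)
    fix m n
    have "s n * s m \<le> s (max m n) * s (max m n)" using assms by (intro mult_mono) (auto simp: incseq_def)
    also have "\<dots> \<le> (SUP n. (s n)\<^sup>2)" by (intro SUP_upper2[of "max m n"]) (auto simp: power2_eq_square)
    finally show "s n * s m \<le> (SUP n. (s n)\<^sup>2)" .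
  qed
  finally show ?thesis .
qed

text \<open>The bound for finite families is independent of their size, so monotone convergence
  carries it over to the countable family.\<close>

lemma max_avg_L2_le:
  assumes bd: "dual_bounded lborel (rectangles_along \<Omega>) A" and A: "0 < A"
    and g: "g \<in> borel_measurable borel" "\<And>x. 0 \<le> g x"
  shows "(\<integral>\<^sup>+x. (max_avg \<Omega> g x)\<^sup>2 \<partial>lborel) \<le> ennreal (A\<^sup>2) * (\<integral>\<^sup>+x. (ennreal (g x))\<^sup>2 \<partial>lborel)"
proof -
  obtain \<C> where C: "countable \<C>" "\<C> \<subseteq> rectangles_along \<Omega>"
    "\<And>x. max_avg \<Omega> g x = (SUP R\<in>{R\<in>\<C>. x \<in> R}. avg g R)" using max_avg_countable[of \<Omega> g] by blast
  show ?thesis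
  proof (cases "\<C> = {}")
    case True
    then show ?thesis by (simp add: C(3) bot_ennreal)
  next
    case False
    define R where "R = from_nat_into \<C>"
    have R: "range R = \<C>" unfolding R_def by (rule range_from_nat_into[OF False C(1)])
    then have RO: "R i \<in> rectangles_along \<Omega>" for i using C(2) by auto
    define s where "s n x = (SUP i\<in>{i\<in>{..<n}. x \<in> R i}. avg g (R i))" for n x
    have inc: "incseq (\<lambda>n. s n x)" for x
      unfolding incseq_def s_def by (intro allI impI SUP_subset_mono) auto
    have M: "max_avg \<Omega> g x \<le> (SUP n. s n x)" for x
      unfolding C(3)
    proof (rule SUP_least)
      fix Q assume "Q \<in> {R \<in> \<C>. x \<in> R}"
      then obtain i where "Q = R i" "x \<in> R i" using R by auto
      then have "avg g Q \<le> s (Suc i) x" unfolding s_def by (intro SUP_upper2[of i]) auto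
      also have "\<dots> \<le> (SUP n. s n x)" by (intro SUP_upper) simp
      finally show "avg g Q \<le> (SUP n. s n x)" .
    qed
    have sm: "s n \<in> borel_measurable lborel" for n
    proof -
      have "s n = (\<lambda>x. SUP i\<in>{..<n}. avg g (R i) * indicator (R i) x)"
      proof
        fix x
        show "s n x = (SUP i\<in>{..<n}. avg g (R i) * indicator (R i) x)"
          unfolding s_def
        proof (rule antisym)
          show "(SUP i\<in>{i\<in>{..<n}. x \<in> R i}. avg g (R i)) \<le> (SUP i\<in>{..<n}. avg g (R i) * indicator (R i) x)"
            by (rule SUP_least) (auto intro!: SUP_upper2)
          show "(SUP i\<in>{..<n}. avg g (R i) * indicator (R i) x) \<le> (SUP i\<in>{i\<in>{..<n}. x \<in> R i}. avg g (R i))"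
            by (rule SUP_least) (auto simp: indicator_def intro: SUP_upper)
        qed
      qed
      moreover have "R i \<in> sets lborel" for i using rectangles_along_fmeasurable[OF RO] by simp
      ultimately show ?thesis by (auto intro!: borel_measurable_SUP)
    qed
    have "(\<integral>\<^sup>+x. (max_avg \<Omega> g x)\<^sup>2 \<partial>lborel) \<le> (\<integral>\<^sup>+x. (SUP n. (s n x)\<^sup>2) \<partial>lborel)"
      by (intro nn_integral_mono order_trans[OF power_mono[OF M] SUP_power2_incseq[OF inc]]) auto
    also have "\<dots> = (SUP n. \<integral>\<^sup>+x. (s n x)\<^sup>2 \<partial>lborel)"
    proof (rule nn_integral_monotone_convergence_SUP)
      show "incseq (\<lambda>n x. (s n x)\<^sup>2)"
        using inc by (auto simp: incseq_def le_fun_def intro!: power_mono)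
    qed (use sm in measurable)
    also have "\<dots> \<le> ennreal (A\<^sup>2) * (\<integral>\<^sup>+x. (ennreal (g x))\<^sup>2 \<partial>lborel)"
      unfolding s_def avg_def
      by (intro SUP_least dual_bounded_imp_maximal_le[OF bd A]) (use RO g rectangles_along_fmeasurable in auto)
    finally show ?thesis .
  qed
qed

theorem theorem1:
  shows "\<exists>K::real. K > 0 \<and>
    (\<forall>(N::nat) (\<Omega> :: (real^2) set) (f :: real^2 \<Rightarrow> complex).
       N \<ge> 1 \<longrightarrow> lacunary N \<Omega> \<longrightarrow> in_L2 f \<longrightarrow>
         maximal_op \<Omega> f \<in> borel_measurable lebesgue \<and>
         L2_norm (maximal_op \<Omega> f) \<le> ennreal (K * real N) * L2_norm (\<lambda>x. ennreal (norm (f x))))"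
proof -
  define K where "K = 128 * (901 + 336 * 21 * lacunary_const)"
  have K: "0 < K" by (simp add: K_def lacunary_const_def)
  have main: "maximal_op \<Omega> f \<in> borel_measurable lebesgue \<and>
         L2_norm (maximal_op \<Omega> f) \<le> ennreal (K * real N) * L2_norm (\<lambda>x. ennreal (norm (f x)))"
    if N: "N \<ge> 1" and lac: "lacunary N \<Omega>" and f: "in_L2 f" for N \<Omega> and f :: "real^2 \<Rightarrow> complex"
  proof -
    define A where "A = K * real N"
    have A: "0 < A" using K N by (simp add: A_def)
    have bd: "dual_bounded lborel (rectangles_along \<Omega>) A"
      using dual_bounded_rectangles_along[OF lac]
    proof (rule dual_bounded_mono)
      \<comment> \<open>Here \<open>N \<ge> 1\<close> turns the constant summand into a multiple of
        \<open>N\<close>.\<close>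
      have "901 * 1 \<le> 901 * real N" using N by simp
      then show "128 * (901 + 336 * 21 * lacunary_const * real N) \<le> A"
        by (simp add: A_def K_def algebra_simps)
    qed simp
    have "(\<lambda>x. norm (f x)) \<in> borel_measurable (completion lborel)" using f by (auto simp: in_L2_def)
    \<comment> \<open>A Borel representative of \<open>|f|\<close>. Changing \<open>|f|\<close> on a
      null set alters no mean, so the maximal function stays the same at every single point and not
      only almost everywhere.\<close>
    then obtain g0 where g0: "g0 \<in> borel_measurable lborel" "AE x in lborel. norm (f x) = g0 x"
      using completion_ex_borel_measurable_real by blast
    define g where "g x = \<bar>g0 x\<bar>" for x
    have g: "g \<in> borel_measurable borel" "\<And>x. 0 \<le> g x" using g0(1) by (auto simp: g_def[abs_def])
    have ae: "AE x in lborel. norm (f x) = g x" using g0(2) by eventually_elim (simp add: g_def, metis abs_norm_cancel)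
    have op: "maximal_op \<Omega> f x = max_avg \<Omega> g x" for x
      unfolding maximal_op_def max_avg_def
    proof (rule SUP_cong)
      fix R assume "R \<in> {R \<in> rectangles_along \<Omega>. x \<in> R}"
      then have R: "R \<in> sets borel" using rectangles_along_fmeasurable by blast
      have "(\<integral>\<^sup>+y\<in>R. ennreal (norm (f y)) \<partial>lebesgue) = (\<integral>\<^sup>+y\<in>R. ennreal (g y) \<partial>lborel)"
        unfolding nn_integral_completion by (rule nn_integral_cong_AE) (use ae in eventually_elim, simp)
      then show "(\<integral>\<^sup>+y\<in>R. ennreal (norm (f y)) \<partial>lebesgue) / emeasure lebesgue R = avg g R"
        using R by (simp add: avg_def)
    qed simp
    have meas: "maximal_op \<Omega> f \<in> borel_measurable lebesgue"
    proof -
      have "maximal_op \<Omega> f = max_avg \<Omega> g" by (rule ext) (rule op)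
      moreover have "max_avg \<Omega> g \<in> borel_measurable lborel" using borel_measurable_max_avg by simp
      ultimately show ?thesis by (simp only: measurable_completion)
    qed
    define I where "I = (\<integral>\<^sup>+x. (ennreal (norm (f x)))\<^sup>2 \<partial>lebesgue)"
    define J where "J = (\<integral>\<^sup>+x. (maximal_op \<Omega> f x)\<^sup>2 \<partial>lebesgue)"
    have I_eq: "I = (\<integral>\<^sup>+x. (ennreal (g x))\<^sup>2 \<partial>lborel)"
      unfolding I_def nn_integral_completion by (rule nn_integral_cong_AE) (use ae in eventually_elim, simp)
    have "J \<le> ennreal (A\<^sup>2) * I"
      unfolding J_def I_eq op nn_integral_completion by (rule max_avg_L2_le[OF bd A g])
    moreover have "I \<noteq> \<infinity>" using f by (auto simp: in_L2_def L2_norm_def I_def Let_def split: if_splits)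
    then obtain r where r: "I = ennreal r" "0 \<le> r" by (cases I) auto
    ultimately have "J \<le> ennreal (A\<^sup>2 * r)" by (simp add: ennreal_mult)
    then obtain m where m: "J = ennreal m" "0 \<le> m" "m \<le> A\<^sup>2 * r"
    proof -
      assume "J \<le> ennreal (A\<^sup>2 * r)"
      moreover have "0 \<le> A\<^sup>2 * r" using r by simp
      ultimately show ?thesis using that by (cases J) (auto simp: top_unique)
    qed
    have "sqrt m \<le> sqrt (A\<^sup>2 * r)" using m(3) by simp
    also have "\<dots> = A * sqrt r" using A by (simp add: real_sqrt_mult)
    finally have "ennreal (sqrt m) \<le> ennreal A * ennreal (sqrt r)"
      using A r by (simp add: ennreal_mult[symmetric] ennreal_leI)
    moreover have "L2_norm (maximal_op \<Omega> f) = ennreal (sqrt m)"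
      unfolding L2_norm_def J_def[symmetric] Let_def using m by simp
    moreover have "L2_norm (\<lambda>x. ennreal (norm (f x))) = ennreal (sqrt r)"
      unfolding L2_norm_def I_def[symmetric] Let_def using r by simp
    ultimately show ?thesis using meas by (simp add: A_def)
  qed
  show ?thesis using K main by blast
qed

end
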